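(* The exponentials $f_\tau,f_\nu$ and the logarithms $g_\tau,g_\nu$ of the formal groups $F_\tau$ and $F_\nu$ over $\mathcal A=\mathbb Z[t_1,t_2,\dots]$ have the forms $$f_\tau(z)=z+\sum_{k=1}^\infty M_k(t)z^{k+1},\qquad f_\nu(z)=z+\sum_{k=1}^\infty t_kz^{k+1},$$ $$g_\tau(u)=u+\sum_{k=1}^\infty N_k(t)u^{k+1},\qquad g_\nu(u)=u+\sum_{k=1}^\infty L_k(t)u^{k+1}.$$
   Context: **Polynomials.** (i) Lagrange inversion polynomials $L_n$: if $f(x)=x+\sum_{n\ge1}a_nx^{n+1}$ has compositional inverse $g(y)=y+\sum_{n\ge1}b_ny^{n+1}$, then $b_n=L_n(a_1,\dots,a_n)$. (ii) Multiplicative inversion polynomials $M_n$: if $F(x)=1+\sum_{n\ge1}f_nx^n$ has multiplicative inverse $G(x)=1+\sum_{n\ge1}g_nx^n$, then $g_n=M_n(f_1,\dots,f_n)$. (iii) $N_n(t_1,\dots,t_n)=\frac1{n+1}[x^n](1+xt_1+x^2t_2+\dots+x^nt_n)^{n+1}$, where $[x^n]h(x)$ is the coefficient of $x^n$ in $h$; these are the generating polynomials of noncrossing partitions of an $n$-element set by type. All have integer coefficients, and $L_k(t),M_k(t),N_k(t)$ means evaluation at $(t_1,\dots,t_k)$. **Monomial Chern numbers.** For a compact complex manifold $M^n$ of complex dimension $n$, with tangent bundle $\tau M^n$ and (stable) normal bundle $\nu M^n$ ($\tau M^n\oplus\nu M^n$ stably trivial), and a partition $\lambda=(\lambda_1\ge\dots\ge\lambda_k)$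 of $n$, let $c_\lambda(\tau M^n)$, $c_\lambda^\nu(M^n)$ be the values on the fundamental cycle of the characteristic classes of $\tau M^n$, resp. $\nu M^n$, corresponding to the monomial symmetric function $m_\lambda$ in the Chern roots. Put $C^\tau(M^n,t)=\sum_{|\lambda|=n}c_\lambda(\tau M^n)t_\lambda$ and $C^\nu(M^n,t)=\sum_{|\lambda|=n}c^\nu_\lambda(M^n)t_\lambda$, where $t_\lambda=t_{\lambda_1}\cdots t_{\lambda_k}$. **Formal groups.** $\Omega_U$ is the complex cobordism ring, and $\mathcal A=\mathbb Z[t_1,t_2,\dots]$ is graded by $\deg t_k=k$. The ring homomorphisms $\Phi_\tau,\Phi_\nu:\Omega_U\to\mathcal A$ are defined by $\Phi_\tau([M^n])=C^\tau(M^n,t)$, $\Phi_\nu([M^n])=C^\nu(M^n,t)$. Let $F$ be the formal group of geometric complex cobordisms $u*v=u+v+\sum_{i,j\ge1}a_{ij}u^iv^j$, $a_{ij}\in\Omega_U$; it is the formal group determined by its logarithm $g_F(u)=u+\sum_{n\ge1}[\mathbb{CP}^n]\frac{u^{n+1}}{n+1}$ (over $\Omega_U\otimes\mathbb Q$). $F_\tau$ and $F_\nu$ are the formal groups over $\mathcal A$ obtained from $F$ by applying $\Phi_\tau$, resp. $\Phi_\nu$, to the coefficients $a_{ij}$. The logarithm of a formal group is the power series $g(u)=u+\cdots$ (a priori with coefficients in $\mathcal A\otimes\mathbb Q$) with $g(u*v)=g(u)+g(v)$; the exponential is its compositional inverse. *)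

theory Defs
  imports
    "HOL-Analysis.Analysis"
    "HOL-Homology.Homology"
    "HOL-Computational_Algebra.Formal_Power_Series"
    "HOL-Library.Poly_Mapping"
    "HOL-Library.Multiset"
    "HOL-Library.Nat_Bijection"
    "Jordan_Normal_Form.Matrix"
begin

section \<open>Compact complex manifolds\<close>

definition cspace :: "nat \<Rightarrow> (nat \<Rightarrow> complex) topology" where
  "cspace n = subtopology (product_topology (\<lambda>_. euclidean) UNIV) {z. \<forall>k\<ge>n. z k = 0}"

definition cpartial :: "nat \<Rightarrow> ((nat \<Rightarrow> complex) \<Rightarrow> complex) \<Rightarrow> (nat \<Rightarrow> complex) \<Rightarrow> complex" where
  "cpartial l F z = deriv (\<lambda>w. F (z(l := w))) (z l)"

text \<open>Continuous and separately holomorphic, which is holomorphy in several variables.\<close>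

definition holomorphic_cn :: "nat \<Rightarrow> (nat \<Rightarrow> complex) set \<Rightarrow> ((nat \<Rightarrow> complex) \<Rightarrow> complex) \<Rightarrow> bool" where
  "holomorphic_cn n U F \<longleftrightarrow>
     continuous_map (subtopology (cspace n) U) euclidean F \<and>
     (\<forall>z\<in>U. \<forall>l<n. (\<lambda>w. F (z(l := w))) field_differentiable (at (z l)))"

text \<open>Indexing atlases (and, below, trivialising covers) by natural numbers is no restriction
  over a compact base.\<close>

record 'p cmanifold =
  cbase :: "'p topology"
  cdim :: nat
  cidx :: "nat set"
  cdom :: "nat \<Rightarrow> 'p set"
  cchart :: "nat \<Rightarrow> 'p \<Rightarrow> nat \<Rightarrow> complex"

definition chart_inv :: "'p cmanifold \<Rightarrow> nat \<Rightarrow> (nat \<Rightarrow> complex) \<Rightarrow> 'p" where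
  "chart_inv M i = inv_into (cdom M i) (cchart M i)"

definition compact_complex_manifold :: "'p cmanifold \<Rightarrow> bool" where
  "compact_complex_manifold M \<longleftrightarrow>
     compact_space (cbase M) \<and> Hausdorff_space (cbase M) \<and>
     (\<Union>i\<in>cidx M. cdom M i) = topspace (cbase M) \<and>
     (\<forall>i\<in>cidx M. openin (cbase M) (cdom M i) \<and>
        openin (cspace (cdim M)) (cchart M i ` cdom M i) \<and>
        homeomorphic_map (subtopology (cbase M) (cdom M i))
          (subtopology (cspace (cdim M)) (cchart M i ` cdom M i)) (cchart M i)) \<and>
     (\<forall>i\<in>cidx M. \<forall>j\<in>cidx M. \<forall>k<cdim M.
        holomorphic_cn (cdim M) (cchart M j ` (cdom M i \<inter> cdom M j))
          (\<lambda>z. cchart M i (chart_inv M j z) k))"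

section \<open>Complex vector bundles\<close>

text \<open>A bundle is given by a cocycle: fibre coordinates over two members of the cover are related
  by \<open>v\<^sub>i = g\<^sub>i\<^sub>j v\<^sub>j\<close>.\<close>

record 'p cbundle =
  brank :: nat
  bidx :: "nat set"
  bdom :: "nat \<Rightarrow> 'p set"
  btrans :: "nat \<Rightarrow> nat \<Rightarrow> 'p \<Rightarrow> complex mat"

definition continuous_matrix :: "'p topology \<Rightarrow> 'p set \<Rightarrow> nat \<Rightarrow> ('p \<Rightarrow> complex mat) \<Rightarrow> bool" where
  "continuous_matrix X U r g \<longleftrightarrow>
     (\<forall>x\<in>U. g x \<in> carrier_mat r r) \<and>
     (\<forall>k<r. \<forall>l<r. continuous_map (subtopology X U) euclidean (\<lambda>x. g x $$ (k, l)))"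

definition complex_vector_bundle :: "'p topology \<Rightarrow> 'p cbundle \<Rightarrow> bool" where
  "complex_vector_bundle X E \<longleftrightarrow>
     (\<forall>i\<in>bidx E. openin X (bdom E i)) \<and> (\<Union>i\<in>bidx E. bdom E i) = topspace X \<and>
     (\<forall>i\<in>bidx E. \<forall>j\<in>bidx E.
        continuous_matrix X (bdom E i \<inter> bdom E j) (brank E) (btrans E i j)) \<and>
     (\<forall>i\<in>bidx E. \<forall>x\<in>bdom E i. btrans E i i x = 1\<^sub>m (brank E)) \<and>
     (\<forall>i\<in>bidx E. \<forall>j\<in>bidx E. \<forall>k\<in>bidx E. \<forall>x\<in>bdom E i \<inter> bdom E j \<inter> bdom E k.
        btrans E i j x * btrans E j k x = btrans E i k x)"

definition bundle_iso :: "'p topology \<Rightarrow> 'p cbundle \<Rightarrow> 'p cbundle \<Rightarrow> bool" where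
  "bundle_iso X E F \<longleftrightarrow> brank E = brank F \<and>
     (\<exists>h :: nat \<Rightarrow> nat \<Rightarrow> 'p \<Rightarrow> complex mat.
        (\<forall>a\<in>bidx F. \<forall>i\<in>bidx E.
           continuous_matrix X (bdom F a \<inter> bdom E i) (brank E) (h a i) \<and>
           (\<forall>x\<in>bdom F a \<inter> bdom E i. invertible_mat (h a i x))) \<and>
        (\<forall>a\<in>bidx F. \<forall>b\<in>bidx F. \<forall>i\<in>bidx E. \<forall>j\<in>bidx E.
           \<forall>x\<in>bdom F a \<inter> bdom F b \<inter> bdom E i \<inter> bdom E j.
             h a i x * btrans E i j x = btrans F a b x * h b j x))"

definition trivial_bundle :: "'p topology \<Rightarrow> nat \<Rightarrow> 'p cbundle" where
  "trivial_bundle X r =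
     \<lparr>brank = r, bidx = {0}, bdom = (\<lambda>_. topspace X), btrans = (\<lambda>_ _ _. 1\<^sub>m r)\<rparr>"

text \<open>The direct sum lives on the common refinement of the two covers, whose pairs of indices are
  encoded as natural numbers.\<close>

definition direct_sum_bundle :: "'p cbundle \<Rightarrow> 'p cbundle \<Rightarrow> 'p cbundle" where
  "direct_sum_bundle E F =
     \<lparr>brank = brank E + brank F,
      bidx = prod_encode ` (bidx E \<times> bidx F),
      bdom = (\<lambda>k. bdom E (fst (prod_decode k)) \<inter> bdom F (snd (prod_decode k))),
      btrans = (\<lambda>k l x. diag_block_mat
        [btrans E (fst (prod_decode k)) (fst (prod_decode l)) x,
         btrans F (snd (prod_decode k)) (snd (prod_decode l)) x])\<rparr>"

definition pullback_bundle :: "'p topology \<Rightarrow> ('p \<Rightarrow> 'p) \<Rightarrow> 'p cbundle \<Rightarrow> 'p cbundle" where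
  "pullback_bundle X f E =
     \<lparr>brank = brank E, bidx = bidx E,
      bdom = (\<lambda>i. {x \<in> topspace X. f x \<in> bdom E i}),
      btrans = (\<lambda>i j x. btrans E i j (f x))\<rparr>"

definition tangent_bundle :: "'p cmanifold \<Rightarrow> 'p cbundle" where
  "tangent_bundle M =
     \<lparr>brank = cdim M, bidx = cidx M, bdom = cdom M,
      btrans = (\<lambda>i j x. mat (cdim M) (cdim M) (\<lambda>(k, l).
        cpartial l (\<lambda>z. cchart M i (chart_inv M j z) k) (cchart M j x)))\<rparr>"

definition stable_normal_bundle :: "'p cmanifold \<Rightarrow> 'p cbundle \<Rightarrow> bool" where
  "stable_normal_bundle M N \<longleftrightarrow> complex_vector_bundle (cbase M) N \<and>
     (\<exists>a b. bundle_iso (cbase M)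
        (direct_sum_bundle (direct_sum_bundle (tangent_bundle M) N) (trivial_bundle (cbase M) a))
        (trivial_bundle (cbase M) b))"

section \<open>Complex projective spaces\<close>

text \<open>All manifolds have points in this one type. It is large enough to carry a copy of every
  compact complex manifold, and it contains the projective spaces as sets of lines, with
  \<open>CP\<^sup>n\<^sup>-\<^sup>1\<close> literally a subset of \<open>CP\<^sup>n\<close> (the hyperplane where coordinate n vanishes).\<close>

type_synonym point = "(nat \<Rightarrow> complex) set"

definition cline :: "(nat \<Rightarrow> complex) \<Rightarrow> point" where
  "cline v = {(\<lambda>k. a * v k) |a. True}"

definition cp_points :: "nat \<Rightarrow> point set" where
  "cp_points n = cline ` (topspace (cspace (Suc n)) - {\<lambda>_. 0})"

text \<open>The quotient topology from the punctured affine space.\<close>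

definition cp_topology :: "nat \<Rightarrow> point topology" where
  "cp_topology n = topology (\<lambda>U. U \<subseteq> cp_points n \<and>
     openin (cspace (Suc n)) {v \<in> topspace (cspace (Suc n)) - {\<lambda>_. 0}. cline v \<in> U})"

lemma openin_cp_topology:
  "openin (cp_topology n) U \<longleftrightarrow> U \<subseteq> cp_points n \<and>
     openin (cspace (Suc n)) {v \<in> topspace (cspace (Suc n)) - {\<lambda>_. 0}. cline v \<in> U}"
proof -
  define S where "S = topspace (cspace (Suc n)) - {\<lambda>_. 0}"
  have inter: "{v \<in> S. cline v \<in> A \<inter> B} = {v \<in> S. cline v \<in> A} \<inter> {v \<in> S. cline v \<in> B}" for A B
    by blast
  have union: "{v \<in> S. cline v \<in> \<Union>K} = (\<Union>A\<in>K. {v \<in> S. cline v \<in> A})" for K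
    by blast
  have "istopology (\<lambda>U. U \<subseteq> cp_points n \<and> openin (cspace (Suc n)) {v \<in> S. cline v \<in> U})"
    unfolding istopology_def inter union
    by (intro conjI allI impI openin_Int openin_Union) auto
  then show ?thesis
    by (simp add: cp_topology_def topology_inverse' S_def)
qed

definition normal_rep :: "nat \<Rightarrow> point \<Rightarrow> nat \<Rightarrow> complex" where
  "normal_rep i L = (THE v. v \<in> L \<and> v i = 1)"

definition cp_dom :: "nat \<Rightarrow> nat \<Rightarrow> point set" where
  "cp_dom n i = {L \<in> cp_points n. \<exists>v\<in>L. v i \<noteq> 0}"

definition complex_projective_space :: "nat \<Rightarrow> point cmanifold" where
  "complex_projective_space n =
     \<lparr>cbase = cp_topology n, cdim = n, cidx = {..n}, cdom = cp_dom n,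
      cchart = (\<lambda>i L k. if k < n then normal_rep i L (if k < i then k else Suc k) else 0)\<rparr>"

text \<open>The dual of the tautological line bundle: a linear form on a line is described over the
  i-th chart by its value at the vector with i-th coordinate 1, so that the transition function
  is \<open>z\<^sub>j / z\<^sub>i\<close>.\<close>

definition hyperplane_bundle :: "nat \<Rightarrow> point cbundle" where
  "hyperplane_bundle n =
     \<lparr>brank = 1, bidx = {..n}, bdom = cp_dom n,
      btrans = (\<lambda>i j L. mat 1 1 (\<lambda>_. normal_rep i L j))\<rparr>"

section \<open>Singular cohomology and Chern classes\<close>

type_synonym 'p cochain = "((nat \<Rightarrow> real) \<Rightarrow> 'p) \<Rightarrow> int"

definition cochain_eval :: "'p cochain \<Rightarrow> 'p chain \<Rightarrow> int" where
  "cochain_eval \<phi> c = (\<Sum>\<sigma>\<in>Poly_Mapping.keys c. Poly_Mapping.lookup c \<sigma> * \<phi> \<sigma>)"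

definition cocycle :: "nat \<Rightarrow> 'p topology \<Rightarrow> 'p cochain \<Rightarrow> bool" where
  "cocycle p X \<phi> \<longleftrightarrow> (\<forall>\<sigma>. singular_simplex (Suc p) X \<sigma> \<longrightarrow>
     cochain_eval \<phi> (chain_boundary (Suc p) (frag_of \<sigma>)) = 0)"

definition cohomologous :: "nat \<Rightarrow> 'p topology \<Rightarrow> 'p cochain \<Rightarrow> 'p cochain \<Rightarrow> bool" where
  "cohomologous p X \<phi> \<psi> \<longleftrightarrow> (\<exists>\<theta>. \<forall>\<sigma>. singular_simplex p X \<sigma> \<longrightarrow>
     \<phi> \<sigma> - \<psi> \<sigma> = cochain_eval \<theta> (chain_boundary p (frag_of \<sigma>)))"

definition cochain_pullback :: "nat \<Rightarrow> ('p \<Rightarrow> 'q) \<Rightarrow> 'q cochain \<Rightarrow> 'p cochain" where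
  "cochain_pullback p f \<phi> \<sigma> = \<phi> (simplex_map p f \<sigma>)"

definition front_face :: "nat \<Rightarrow> ((nat \<Rightarrow> real) \<Rightarrow> 'p) \<Rightarrow> (nat \<Rightarrow> real) \<Rightarrow> 'p" where
  "front_face p \<sigma> = restrict \<sigma> (standard_simplex p)"

definition back_face :: "nat \<Rightarrow> nat \<Rightarrow> ((nat \<Rightarrow> real) \<Rightarrow> 'p) \<Rightarrow> (nat \<Rightarrow> real) \<Rightarrow> 'p" where
  "back_face p q \<sigma> =
     restrict (\<lambda>x. \<sigma> (\<lambda>i. if i < p then 0 else x (i - p))) (standard_simplex q)"

definition cup :: "nat \<Rightarrow> nat \<Rightarrow> 'p cochain \<Rightarrow> 'p cochain \<Rightarrow> 'p cochain" where
  "cup p q \<phi> \<psi> \<sigma> = \<phi> (front_face p \<sigma>) * \<psi> (back_face p q \<sigma>)"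

text \<open>The affine simplex below has vertices \<open>p - \<epsilon> s\<close>, \<open>p + \<epsilon> e\<^sub>0\<close>, \<open>p + \<epsilon> i e\<^sub>0\<close>,
  \<open>p + \<epsilon> e\<^sub>1\<close>, \<open>p + \<epsilon> i e\<^sub>1\<close>, \dots, where s is the sum of all the real basis vectors. It contains p in
  its interior and is positively oriented for the complex orientation, so it represents the
  local orientation at p.\<close>

definition orientation_simplex :: "nat \<Rightarrow> (nat \<Rightarrow> complex) \<Rightarrow> real \<Rightarrow> (nat \<Rightarrow> real) \<Rightarrow> nat \<Rightarrow> complex" where
  "orientation_simplex n z \<epsilon> x k =
     (if k < n then z k + of_real \<epsilon> * Complex (x (2 * k + 1) - x 0) (x (2 * k + 2) - x 0) else 0)"

definition fundamental_cycle :: "'p cmanifold \<Rightarrow> 'p chain \<Rightarrow> bool" where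
  "fundamental_cycle M \<zeta> \<longleftrightarrow>
     singular_relcycle (2 * cdim M) (cbase M) {} \<zeta> \<and>
     (\<forall>i\<in>cidx M. \<forall>p\<in>cdom M i. \<forall>\<epsilon>>0.
        orientation_simplex (cdim M) (cchart M i p) \<epsilon> ` standard_simplex (2 * cdim M)
          \<subseteq> cchart M i ` cdom M i \<longrightarrow>
        homologous_rel (2 * cdim M) (cbase M) (topspace (cbase M) - {p}) \<zeta>
          (frag_of (restrict (chart_inv M i \<circ> orientation_simplex (cdim M) (cchart M i p) \<epsilon>)
             (standard_simplex (2 * cdim M)))))"

text \<open>Hirzebruch's axioms, which determine Chern classes of bundles over compact Hausdorff spaces;
  \<open>c X E k\<close> is a cocycle representing the k-th Chern class. The last clause is his normalisation:
  the total class of the hyperplane bundle is 1 plus the class Poincare dual to the hyperplane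
  \<open>CP\<^sup>n\<^sup>-\<^sup>1\<close>, where \<open>\<mu>\<close> selects fundamental cycles.\<close>

definition chern_classes ::
  "(point cmanifold \<Rightarrow> point chain) \<Rightarrow>
   (point topology \<Rightarrow> point cbundle \<Rightarrow> nat \<Rightarrow> point cochain) \<Rightarrow> bool" where
  "chern_classes \<mu> c \<longleftrightarrow>
     (\<forall>X E. compact_space X \<and> Hausdorff_space X \<and> complex_vector_bundle X E \<longrightarrow>
        (\<forall>k. cocycle (2 * k) X (c X E k)) \<and>
        cohomologous 0 X (c X E 0) (\<lambda>_. 1) \<and>
        (\<forall>k>brank E. cohomologous (2 * k) X (c X E k) (\<lambda>_. 0))) \<and>
     (\<forall>X E F. compact_space X \<and> Hausdorff_space X \<and>
        complex_vector_bundle X E \<and> complex_vector_bundle X F \<and> bundle_iso X E F \<longrightarrow>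
        (\<forall>k. cohomologous (2 * k) X (c X E k) (c X F k))) \<and>
     (\<forall>X Y f E. compact_space X \<and> Hausdorff_space X \<and> compact_space Y \<and> Hausdorff_space Y \<and>
        continuous_map X Y f \<and> complex_vector_bundle Y E \<longrightarrow>
        (\<forall>k. cohomologous (2 * k) X (c X (pullback_bundle X f E) k)
           (cochain_pullback (2 * k) f (c Y E k)))) \<and>
     (\<forall>X E F. compact_space X \<and> Hausdorff_space X \<and>
        complex_vector_bundle X E \<and> complex_vector_bundle X F \<longrightarrow>
        (\<forall>k. cohomologous (2 * k) X (c X (direct_sum_bundle E F) k)
           (\<lambda>\<sigma>. \<Sum>i\<le>k. cup (2 * i) (2 * (k - i)) (c X E i) (c X F (k - i)) \<sigma>))) \<and>
     (\<forall>n y. cocycle (2 * n) (cp_topology (Suc n)) y \<longrightarrow>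
        cochain_eval (cup (2 * n) 2 y (c (cp_topology (Suc n)) (hyperplane_bundle (Suc n)) 1))
          (\<mu> (complex_projective_space (Suc n)))
        = cochain_eval y (\<mu> (complex_projective_space n)))"

section \<open>Monomial Chern numbers\<close>

definition partitions_of :: "nat \<Rightarrow> nat multiset set" where
  "partitions_of n = {l. sum_mset l = n \<and> 0 \<notin># l}"

definition monomial_sym :: "nat \<Rightarrow> nat multiset \<Rightarrow> (nat \<Rightarrow> int) \<Rightarrow> int" where
  "monomial_sym N l x =
     (\<Sum>a | a \<in> ({..<N} \<rightarrow>\<^sub>E {..sum_mset l}) \<and>
            filter_mset (\<lambda>e. e \<noteq> 0) (image_mset a (mset_set {..<N})) = l.
        \<Prod>i<N. x i ^ a i)"

definition elementary_sym :: "nat \<Rightarrow> nat \<Rightarrow> (nat \<Rightarrow> int) \<Rightarrow> int" where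
  "elementary_sym N k x = (\<Sum>S | S \<subseteq> {..<N} \<and> card S = k. \<Prod>i\<in>S. x i)"

text \<open>The expression of a monomial symmetric function as an integer polynomial in the elementary
  ones, indexed by partitions; it exists and is unique by the fundamental theorem on symmetric
  polynomials. An identity at all integer points is an identity of polynomials.\<close>

definition elementary_coeffs :: "nat multiset \<Rightarrow> nat multiset \<Rightarrow> int" where
  "elementary_coeffs l = (SOME q. \<forall>N x. monomial_sym N l x =
     (\<Sum>r\<in>partitions_of (sum_mset l). q r * (\<Prod>k\<in>#r. elementary_sym N k x)))"

fun cup_chern :: "(nat \<Rightarrow> 'p cochain) \<Rightarrow> nat list \<Rightarrow> 'p cochain" where
  "cup_chern ch [] = (\<lambda>_. 1)"
| "cup_chern ch (k # ks) = cup (2 * k) (2 * sum_list ks) (ch k) (cup_chern ch ks)"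

text \<open>The characteristic class of a monomial symmetric function in the Chern roots. The order of
  the factors is immaterial up to cohomology, because all degrees are even.\<close>

definition monomial_class :: "(nat \<Rightarrow> 'p cochain) \<Rightarrow> nat multiset \<Rightarrow> 'p cochain" where
  "monomial_class ch l \<sigma> = (\<Sum>r\<in>partitions_of (sum_mset l).
     elementary_coeffs l r * cup_chern ch (sorted_list_of_multiset r) \<sigma>)"

text \<open>Polynomials in variables indexed by all natural numbers; the variable with index k stands
  for \<open>t\<close> with index \<open>k + 1\<close>, so this is exactly the ring generated by \<open>t\<^sub>1, t\<^sub>2, \<dots>\<close>.\<close>

type_synonym 'a tpoly = "(nat \<Rightarrow>\<^sub>0 nat) \<Rightarrow>\<^sub>0 'a"

definition tvar :: "nat \<Rightarrow> int tpoly" where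
  "tvar k = Poly_Mapping.single (Poly_Mapping.single (k - 1) 1) 1"

definition chern_number_poly ::
  "(point topology \<Rightarrow> point cbundle \<Rightarrow> nat \<Rightarrow> point cochain) \<Rightarrow>
   (point cmanifold \<Rightarrow> point chain) \<Rightarrow> point cmanifold \<Rightarrow> point cbundle \<Rightarrow> int tpoly" where
  "chern_number_poly c \<mu> M E = (\<Sum>l\<in>partitions_of (cdim M).
     of_int (cochain_eval (monomial_class (c (cbase M) E) l) (\<mu> M)) * (\<Prod>k\<in>#l. tvar k))"

section \<open>The complex cobordism ring\<close>

text \<open>Cobordism is modelled by embedded manifolds: subsets of some \<open>\<real>\<^sup>N\<close>, itself
  embedded in the type of real sequences by padding with zeros.\<close>

type_synonym rvec = "nat \<Rightarrow> real"

definition rpartial :: "nat \<Rightarrow> (rvec \<Rightarrow> real) \<Rightarrow> rvec \<Rightarrow> real" where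
  "rpartial k f x = deriv (\<lambda>s. f (x(k := s))) (x k)"

definition smooth_fun :: "nat \<Rightarrow> rvec set \<Rightarrow> (rvec \<Rightarrow> real) \<Rightarrow> bool" where
  "smooth_fun N U f \<longleftrightarrow> (\<forall>ks\<in>lists {..<N}.
     continuous_map (subtopology (Euclidean_space N) U) euclideanreal (fold rpartial ks f) \<and>
     (\<forall>x\<in>U. \<forall>k<N. (\<lambda>s. fold rpartial ks f (x(k := s))) field_differentiable (at (x k))))"

definition independent_gradients :: "nat \<Rightarrow> nat \<Rightarrow> (nat \<Rightarrow> rvec \<Rightarrow> real) \<Rightarrow> rvec \<Rightarrow> bool" where
  "independent_gradients N d f x \<longleftrightarrow>
     (\<forall>b :: nat \<Rightarrow> real. (\<forall>k<N. (\<Sum>j<d. b j * rpartial k (f j) x) = 0) \<longrightarrow> (\<forall>j<d. b j = 0))"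

definition closed_submanifold :: "nat \<Rightarrow> nat \<Rightarrow> rvec set \<Rightarrow> bool" where
  "closed_submanifold N m M \<longleftrightarrow> m \<le> N \<and> compactin (Euclidean_space N) M \<and>
     (\<forall>x\<in>M. \<exists>U f. openin (Euclidean_space N) U \<and> x \<in> U \<and> (\<forall>j<N - m. smooth_fun N U (f j)) \<and>
        M \<inter> U = {y \<in> U. \<forall>j<N - m. f j y = 0} \<and>
        (\<forall>y\<in>M \<inter> U. independent_gradients N (N - m) f y))"

text \<open>A compact submanifold W of the half space of \<open>\<real>\<^sup>N\<^sup>+\<^sup>1\<close> on which coordinate 0 is nonnegative,
  of dimension m + 1, meeting the boundary hyperplane orthogonally, and there in the shifted
  copy of M.\<close>

definition bounding_submanifold :: "nat \<Rightarrow> nat \<Rightarrow> rvec set \<Rightarrow> rvec set \<Rightarrow> bool" where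
  "bounding_submanifold N m M W \<longleftrightarrow> m \<le> N \<and> compactin (Euclidean_space (Suc N)) W \<and>
     (\<forall>y\<in>W. 0 \<le> y 0) \<and> {y \<in> W. y 0 = 0} = case_nat 0 ` M \<and>
     (\<forall>x\<in>W. \<exists>U f. openin (Euclidean_space (Suc N)) U \<and> x \<in> U \<and>
        (\<forall>j<N - m. smooth_fun (Suc N) U (f j)) \<and>
        W \<inter> U = {y \<in> U. 0 \<le> y 0 \<and> (\<forall>j<N - m. f j y = 0)} \<and>
        (\<forall>y\<in>W \<inter> U. independent_gradients (Suc N) (N - m) f y \<and>
           (y 0 = 0 \<longrightarrow> (\<forall>j<N - m. rpartial 0 (f j) y = 0))))"

text \<open>For a manifold with boundary this is the full tangent space also at boundary points.\<close>

definition tangent_space :: "nat \<Rightarrow> rvec set \<Rightarrow> rvec \<Rightarrow> rvec set" where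
  "tangent_space N M x = {v \<in> topspace (Euclidean_space N).
     \<forall>U f. openin (Euclidean_space N) U \<and> x \<in> U \<and> smooth_fun N U f \<and> (\<forall>y\<in>M \<inter> U. f y = 0) \<longrightarrow>
       (\<Sum>k<N. v k * rpartial k f x) = 0}"

text \<open>A stable complex structure is one on the sum of the tangent bundle and a trivial real
  bundle of rank k.\<close>

definition stable_tangent_space :: "nat \<Rightarrow> nat \<Rightarrow> rvec set \<Rightarrow> rvec \<Rightarrow> (rvec \<times> rvec) set" where
  "stable_tangent_space N k M x = tangent_space N M x \<times> topspace (Euclidean_space k)"

definition lincomb2 :: "real \<Rightarrow> rvec \<times> rvec \<Rightarrow> real \<Rightarrow> rvec \<times> rvec \<Rightarrow> rvec \<times> rvec" where
  "lincomb2 a u b u' = (\<lambda>i. a * fst u i + b * fst u' i, \<lambda>i. a * snd u i + b * snd u' i)"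

type_synonym jfield = "rvec \<Rightarrow> rvec \<times> rvec \<Rightarrow> rvec \<times> rvec"

definition stable_complex_structure :: "nat \<Rightarrow> nat \<Rightarrow> rvec set \<Rightarrow> jfield \<Rightarrow> bool" where
  "stable_complex_structure N k M J \<longleftrightarrow>
     (\<forall>x\<in>M. \<forall>u\<in>stable_tangent_space N k M x.
        J x u \<in> stable_tangent_space N k M x \<and> J x (J x u) = lincomb2 (-1) u 0 u \<and>
        (\<forall>u'\<in>stable_tangent_space N k M x. \<forall>a b.
           J x (lincomb2 a u b u') = lincomb2 a (J x u) b (J x u'))) \<and>
     continuous_on {(x, u). x \<in> M \<and> u \<in> stable_tangent_space N k M x} (\<lambda>(x, u). J x u)"

definition U_manifold :: "nat \<Rightarrow> nat \<Rightarrow> rvec set \<Rightarrow> jfield \<Rightarrow> bool" where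
  "U_manifold m k M J \<longleftrightarrow>
     (\<exists>N. closed_submanifold N m M \<and> stable_complex_structure N k M J)"

text \<open>Adding a trivial complex line to the stable tangent bundle.\<close>

definition stabilize :: "nat \<Rightarrow> jfield \<Rightarrow> jfield" where
  "stabilize k J x u =
     (let u' = J x (fst u, \<lambda>i. if i < k then snd u i else 0)
      in (fst u', \<lambda>i. if i < k then snd u' i else if i = k then - snd u (k + 1)
                      else if i = k + 1 then snd u k else 0))"

fun stabilize_times :: "nat \<Rightarrow> nat \<Rightarrow> jfield \<Rightarrow> jfield" where
  "stabilize_times 0 k J = J"
| "stabilize_times (Suc l) k J = stabilize (k + 2 * l) (stabilize_times l k J)"

text \<open>The inward normal (coordinate 0) of W along M is identified with the first direction of the
  trivial summand for M. With the outward normal one would get the same notion, because M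
  bounds if and only if M with the conjugate of that direction does.\<close>

definition U_bounds :: "nat \<Rightarrow> nat \<Rightarrow> rvec set \<Rightarrow> jfield \<Rightarrow> bool" where
  "U_bounds m k M J \<longleftrightarrow> (\<exists>l k' N W JW. k + 2 * l = Suc k' \<and>
     bounding_submanifold N m M W \<and> stable_complex_structure (Suc N) k' W JW \<and>
     (\<forall>x\<in>M. \<forall>v\<in>tangent_space N M x. \<forall>w\<in>topspace (Euclidean_space k'). \<forall>s.
        let u = stabilize_times l k J x (v, case_nat s w)
        in JW (case_nat 0 x) (case_nat s v, w) = (case_nat (snd u 0) (fst u), \<lambda>i. snd u (Suc i))))"

definition interleave :: "rvec \<Rightarrow> rvec \<Rightarrow> rvec" where
  "interleave x y i = (if even i then x (i div 2) else y (i div 2))"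

definition product_J :: "nat \<Rightarrow> jfield \<Rightarrow> jfield \<Rightarrow> jfield" where
  "product_J k J J' z u =
     (let a = J (\<lambda>i. z (2 * i)) (\<lambda>i. fst u (2 * i), \<lambda>i. if i < k then snd u i else 0);
          b = J' (\<lambda>i. z (2 * i + 1)) (\<lambda>i. fst u (2 * i + 1), \<lambda>i. snd u (i + k))
      in (interleave (fst a) (fst b), \<lambda>i. if i < k then snd a i else snd b (i - k)))"

text \<open>This characterises the ring of cobordism classes of stably complex closed manifolds
  up to isomorphism: \<open>cls m k M J\<close> is the class of M, of dimension m; sum is
  disjoint union, product is Cartesian product, and the last two clauses say that the ring is the
  direct sum of its homogeneous parts, each consisting of classes of manifolds.\<close>

definition complex_cobordism_ring ::
  "(nat \<Rightarrow> nat \<Rightarrow> rvec set \<Rightarrow> jfield \<Rightarrow> 'o::comm_ring_1) \<Rightarrow> bool" where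
  "complex_cobordism_ring cls \<longleftrightarrow>
     (\<forall>m k M J. U_manifold m k M J \<longrightarrow> cls m (k + 2) M (stabilize k J) = cls m k M J) \<and>
     (\<forall>m k M J. U_manifold m k M J \<longrightarrow> (cls m k M J = 0 \<longleftrightarrow> U_bounds m k M J)) \<and>
     (\<forall>m k M J M' J'. U_manifold m k M J \<and> U_manifold m k M' J' \<and> M \<inter> M' = {} \<longrightarrow>
        cls m k (M \<union> M') (\<lambda>x. if x \<in> M then J x else J' x) = cls m k M J + cls m k M' J') \<and>
     (\<forall>m k M J m' k' M' J'. U_manifold m k M J \<and> U_manifold m' k' M' J' \<longrightarrow>
        cls (m + m') (k + k') {interleave x y |x y. x \<in> M \<and> y \<in> M'} (product_J k J J')
        = cls m k M J * cls m' k' M' J') \<and>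
     cls 0 0 {\<lambda>_. 0} (\<lambda>_ u. u) = 1 \<and>
     (\<forall>x. \<exists>D k M J. (\<forall>m\<le>D. U_manifold m (k m) (M m) (J m)) \<and>
        x = (\<Sum>m\<le>D. cls m (k m) (M m) (J m))) \<and>
     (\<forall>D k M J. (\<forall>m\<le>D. U_manifold m (k m) (M m) (J m)) \<and>
        (\<Sum>m\<le>D. cls m (k m) (M m) (J m)) = 0 \<longrightarrow> (\<forall>m\<le>D. cls m (k m) (M m) (J m) = 0))"

definition cplx_coords :: "nat \<Rightarrow> rvec \<Rightarrow> nat \<Rightarrow> complex" where
  "cplx_coords n y k = (if k < n then Complex (y (2 * k)) (y (2 * k + 1)) else 0)"

definition mult_i :: "rvec \<Rightarrow> rvec" where
  "mult_i v i = (if even i then - v (i + 1) else v (i - 1))"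

text \<open>The pair (S, J) is the image of the complex manifold M under a smooth embedding e into a
  Euclidean space, with the transported complex structure on its tangent spaces.\<close>

definition embedded_copy :: "'p cmanifold \<Rightarrow> rvec set \<Rightarrow> jfield \<Rightarrow> bool" where
  "embedded_copy M S J \<longleftrightarrow>
     (\<exists>N (e :: 'p \<Rightarrow> rvec).
        closed_submanifold N (2 * cdim M) S \<and> stable_complex_structure N 0 S J \<and>
        bij_betw e (topspace (cbase M)) S \<and>
        (\<forall>i\<in>cidx M.
           let V = {y \<in> topspace (Euclidean_space (2 * cdim M)).
                     cplx_coords (cdim M) y \<in> cchart M i ` cdom M i};
               E = (\<lambda>a y. e (chart_inv M i (cplx_coords (cdim M) y)) a);
               push = (\<lambda>y v a. \<Sum>l<2 * cdim M. v l * rpartial l (E a) y)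
           in (\<forall>a<N. smooth_fun (2 * cdim M) V (E a)) \<and>
              (\<forall>y\<in>V. \<forall>v\<in>topspace (Euclidean_space (2 * cdim M)).
                 (push y v = (\<lambda>_. 0) \<longrightarrow> v = (\<lambda>_. 0)) \<and>
                 J (e (chart_inv M i (cplx_coords (cdim M) y))) (push y v, \<lambda>_. 0)
                   = (push y (mult_i v), \<lambda>_. 0))))"

definition cobordism_class ::
  "(nat \<Rightarrow> nat \<Rightarrow> rvec set \<Rightarrow> jfield \<Rightarrow> 'o) \<Rightarrow> 'p cmanifold \<Rightarrow> 'o" where
  "cobordism_class cls M = (THE x. \<exists>S J. embedded_copy M S J \<and> x = cls (2 * cdim M) 0 S J)"

section \<open>Formal groups\<close>

text \<open>A family \<open>a i j\<close> stands for the series \<open>u + v + \<Sum> a\<^sub>i\<^sub>j u\<^sup>i v\<^sup>j\<close> with the sum over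
  \<open>i, j \<ge> 1\<close>; entries with i or j zero are ignored.\<close>

definition fg_coeff :: "(nat \<Rightarrow> nat \<Rightarrow> 'r::comm_ring_1) \<Rightarrow> nat \<Rightarrow> nat \<Rightarrow> 'r" where
  "fg_coeff a i j =
     (if i = 0 then (if j = 1 then 1 else 0) else if j = 0 then (if i = 1 then 1 else 0) else a i j)"

definition fg_power_coeff :: "(nat \<Rightarrow> nat \<Rightarrow> 'r::comm_ring_1) \<Rightarrow> nat \<Rightarrow> nat \<Rightarrow> nat \<Rightarrow> 'r" where
  "fg_power_coeff a p i j =
     fps_nth (fps_nth ((Abs_fps (\<lambda>j. Abs_fps (\<lambda>i. fg_coeff a i j))) ^ p) j) i"

text \<open>Commutativity and associativity; the latter compares the coefficients of \<open>u\<^sup>i v\<^sup>j w\<^sup>k\<close> in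
  \<open>(u * v) * w\<close> and \<open>u * (v * w)\<close>. Powers of a series without constant term contribute
  only finitely many terms.\<close>

definition formal_group :: "(nat \<Rightarrow> nat \<Rightarrow> 'r::comm_ring_1) \<Rightarrow> bool" where
  "formal_group a \<longleftrightarrow> (\<forall>i j. fg_coeff a i j = fg_coeff a j i) \<and>
     (\<forall>i j k. (\<Sum>p\<le>i + j. fg_coeff a p k * fg_power_coeff a p i j)
            = (\<Sum>q\<le>j + k. fg_coeff a i q * fg_power_coeff a q j k))"

text \<open>The logarithm has coefficients in the rationalisation \<open>\<iota>\<close> of the coefficient ring; the equation
  compares the coefficients of \<open>u\<^sup>i v\<^sup>j\<close> in \<open>g(u * v)\<close> and \<open>g(u) + g(v)\<close>.\<close>

definition is_logarithm ::
  "('r::comm_ring_1 \<Rightarrow> 'q::comm_ring_1) \<Rightarrow> (nat \<Rightarrow> nat \<Rightarrow> 'r) \<Rightarrow> 'q fps \<Rightarrow> bool" where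
  "is_logarithm \<iota> a g \<longleftrightarrow> fps_nth g 0 = 0 \<and> fps_nth g 1 = 1 \<and>
     (\<forall>i j. (\<Sum>p\<le>i + j. fps_nth g p * fg_power_coeff (\<lambda>i j. \<iota> (a i j)) p i j)
          = (if j = 0 then fps_nth g i else 0) + (if i = 0 then fps_nth g j else 0))"

definition compositional_inverses :: "'r::comm_ring_1 fps \<Rightarrow> 'r fps \<Rightarrow> bool" where
  "compositional_inverses f g \<longleftrightarrow> fps_nth f 0 = 0 \<and> fps_nth g 0 = 0 \<and>
     fps_compose f g = fps_X \<and> fps_compose g f = fps_X"

definition is_exponential ::
  "('r::comm_ring_1 \<Rightarrow> 'q::comm_ring_1) \<Rightarrow> (nat \<Rightarrow> nat \<Rightarrow> 'r) \<Rightarrow> 'q fps \<Rightarrow> bool" where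
  "is_exponential \<iota> a f \<longleftrightarrow> (\<exists>g. is_logarithm \<iota> a g \<and> compositional_inverses f g)"

text \<open>\<open>\<iota>\<close> is the canonical map of a ring R to \<open>R \<otimes> \<rat>\<close>.\<close>

definition rationalization :: "('r::comm_ring_1 \<Rightarrow> 'q::comm_ring_1) \<Rightarrow> bool" where
  "rationalization \<iota> \<longleftrightarrow> comm_ring_hom \<iota> \<and>
     (\<forall>n>0. \<exists>y. of_nat n * y = (1 :: 'q)) \<and>
     (\<forall>y. \<exists>n>0. \<exists>x. of_nat n * y = \<iota> x) \<and>
     (\<forall>x. \<iota> x = 0 \<longleftrightarrow> (\<exists>n>0. of_nat n * x = 0))"

definition rat_tpoly :: "int tpoly \<Rightarrow> rat tpoly" where
  "rat_tpoly = Poly_Mapping.map rat_of_int"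

section \<open>The three families of polynomials\<close>

definition normalized_series :: "(nat \<Rightarrow> 'r::comm_ring_1) \<Rightarrow> 'r fps" where
  "normalized_series c = Abs_fps (\<lambda>n. if n = 0 then 0 else if n = 1 then 1 else c (n - 1))"

text \<open>Each polynomial is the coefficient obtained for the generic series, with coefficients
  \<open>t\<^sub>1, t\<^sub>2, \<dots>\<close>.\<close>

definition L_poly :: "nat \<Rightarrow> int tpoly" where
  "L_poly n = fps_nth (THE g. compositional_inverses (normalized_series tvar) g) (n + 1)"

definition M_poly :: "nat \<Rightarrow> int tpoly" where
  "M_poly n = fps_nth (THE G. Abs_fps (\<lambda>k. if k = 0 then 1 else tvar k) * G = 1) n"

definition N_poly :: "nat \<Rightarrow> int tpoly" where
  "N_poly n = (THE p. of_nat (n + 1) * p =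
     fps_nth ((1 + (\<Sum>k=1..n. fps_const (tvar k) * fps_X ^ k)) ^ (n + 1)) n)"

end

theory Submission
  imports Defs "HOL-Combinatorics.Permutations" "Jordan_Normal_Form.Determinant"
begin

text \<open>
  By uniqueness of logarithms it suffices to know the images of the classes of the projective spaces,
  that is, the monomial Chern numbers of the tangent and normal bundles of \<open>CP\<^sup>n\<close>. The Euler
  sequence gives \<open>\<tau> \<oplus> 1 = (n + 1) H\<close>, so all classes are multiples of powers of
  \<open>h = c\<^sub>1(H)\<close>, and the total classes of \<open>\<tau>\<close> and \<open>\<nu>\<close> are \<open>(1 + h)\<^sup>n\<^sup>+\<^sup>1\<close> and its
  inverse. With \<open>T(z) = 1 + t\<^sub>1 z + t\<^sub>2 z\<^sup>2 + \<dots>\<close>, the generating polynomials of the Chern numbers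
  are the coefficients of \<open>z\<^sup>n\<close> in \<open>T(z)\<^sup>n\<^sup>+\<^sup>1\<close> and in \<open>T(z)\<^sup>-\<^sup>n\<^sup>-\<^sup>1\<close>; divided by
  \<open>n + 1\<close>, they are by Lagrange inversion the coefficients of the compositional inverses of
  \<open>z / T(z)\<close> and \<open>z T(z)\<close>.
\<close>

section \<open>Compositional inverses and Lagrange inversion\<close>

text \<open>Chern classes are given by axioms, as cocycles known up to coboundary. Their values are
  therefore carried as integers: the k-th class of every bundle that occurs on CP^n is cohomologous
  to an integer multiple of the k-th power of h, and the Whitney formula becomes a convolution of
  integers that can be solved for one summand. The power h^n takes the value 1 on the fundamental
  cycle, because Hirzebruch's normalisation descends from CP^n to CP^(n-1), down to a point whose
  cycle is fixed by its orientation. Stably, the Chern roots of the tangent bundle are n + 1 copies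
  of h, so its numbers are monomial symmetric functions at n + 1 ones. The obstacle is the normal
  bundle, which would need -(n + 1) roots. Its classes are compared modulo K with those of M - n - 1
  copies of H, where (1 + h)^M is 1 modulo K up to degree n; congruence modulo all large K is
  equality. The monomial classes are defined by a choice of coefficients in the elementary symmetric
  functions, whence the proof that such coefficients exist.\<close>

lemma normalized_series_nth:
  "fps_nth (normalized_series c) n = (if n = 0 then 0 else if n = 1 then 1 else c (n - 1))"
  by (simp add: normalized_series_def)

lemma fps_nth_power_diag:
  fixes f :: "'a::comm_ring_1 fps"
  assumes "fps_nth f 0 = 0" "fps_nth f 1 = 1"
  shows "fps_nth (f ^ n) n = 1"
  using startsby_zero_power_nth_same[OF assms(1), of n] assms(2) by simp

text \<open>Since \<open>f ^ i\<close> starts in degree i with coefficient 1, the equations for the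
  coefficients of g are triangular with ones on the diagonal, so they have a solution over any
  commutative ring.\<close>

lemma normalized_left_inverse_exists:
  fixes f :: "'a::comm_ring_1 fps"
  assumes f: "fps_nth f 0 = 0" "fps_nth f 1 = 1"
  shows "\<exists>g. fps_nth g 0 = 0 \<and> fps_nth g 1 = 1 \<and> fps_compose g f = fps_X"
proof -
  define R where "R = (\<lambda>n (c :: nat \<Rightarrow> 'a). fps_nth fps_X n - (\<Sum>i<n. c i * fps_nth (f ^ i) n))"
  \<comment> \<open>Each coefficient depends on all earlier ones, hence the well-founded
    recursion.\<close>
  define c where "c = wfrec less_than (\<lambda>c n. R n c)"
  have c: "c n = fps_nth fps_X n - (\<Sum>i<n. c i * fps_nth (f ^ i) n)" for n
  proof -
    have "c n = R n (cut c less_than n)"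
      unfolding c_def by (subst wfrec) auto
    also have "\<dots> = R n c"
      unfolding R_def by (auto intro!: sum.cong simp: cut_apply)
    finally show ?thesis
      by (simp add: R_def)
  qed
  define g where "g = Abs_fps c"
  have "fps_nth (fps_compose g f) n = fps_nth fps_X n" for n
  proof -
    have "fps_nth (fps_compose g f) n = (\<Sum>i\<in>insert n {..<n}. c i * fps_nth (f ^ i) n)"
      unfolding fps_compose_nth g_def by (intro sum.cong) auto
    also have "\<dots> = c n + (\<Sum>i<n. c i * fps_nth (f ^ i) n)"
      using fps_nth_power_diag[OF f, of n] by simp
    finally show ?thesis
      by (simp add: c[of n])
  qed
  moreover have "c 0 = 0"
    using c[of 0] by simp
  moreover have "c 1 = 1"
    using c[of 1] \<open>c 0 = 0\<close> by simp
  ultimately show ?thesis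
    by (intro exI[of _ g]) (auto simp: g_def fps_eq_iff)
qed

lemma compositional_inverses_sym: "compositional_inverses f g \<longleftrightarrow> compositional_inverses g f"
  by (auto simp: compositional_inverses_def)

text \<open>A left inverse is two-sided because it has a left inverse k of its own, and
  associativity of composition forces k = f.\<close>

lemma compositional_inverses_left:
  fixes f g :: "'a::idom fps"
  assumes f: "fps_nth f 0 = 0" "fps_nth f 1 = 1"
    and g: "fps_nth g 0 = 0" "fps_nth g 1 = 1" and gf: "fps_compose g f = fps_X"
  shows "compositional_inverses f g"
proof -
  obtain k where k: "fps_nth k 0 = 0" "fps_compose k g = fps_X"
    using normalized_left_inverse_exists[OF g] by auto
  have "k = fps_compose k (fps_compose g f)"
    by (simp add: gf)
  also have "\<dots> = fps_compose (fps_compose k g) f"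
    by (rule fps_compose_assoc[OF f(1) g(1)])
  also have "\<dots> = f"
    by (simp add: k f)
  finally show ?thesis
    using k gf f g by (simp add: compositional_inverses_def)
qed

lemma compositional_inverse_exists:
  fixes f :: "'a::idom fps"
  assumes f: "fps_nth f 0 = 0" "fps_nth f 1 = 1"
  shows "\<exists>g. fps_nth g 1 = 1 \<and> compositional_inverses f g"
  using normalized_left_inverse_exists[OF f] compositional_inverses_left[OF f] by blast

lemma compositional_inverse_unique:
  fixes f g h :: "'a::idom fps"
  assumes "compositional_inverses f g" "compositional_inverses f h"
  shows "g = h"
proof -
  have "g = fps_compose g (fps_compose f h)"
    using assms by (simp add: compositional_inverses_def)
  also have "\<dots> = fps_compose (fps_compose g f) h"
    using assms by (intro fps_compose_assoc) (auto simp: compositional_inverses_def)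
  also have "\<dots> = h"
    using assms by (simp add: compositional_inverses_def)
  finally show ?thesis .
qed

text \<open>The powers \<open>b ^ k\<close> with k > n do not reach degree n, so one finite range of
  k serves for all the coefficients that enter the product.\<close>

lemma fps_nth_compose_mult:
  fixes a b h :: "'a::comm_ring_1 fps"
  assumes "fps_nth b 0 = 0"
  shows "fps_nth (fps_compose a b * h) n = (\<Sum>k\<le>n. fps_nth a k * fps_nth (b ^ k * h) n)"
proof -
  have "fps_nth (fps_compose a b) i = (\<Sum>k\<le>n. fps_nth a k * fps_nth (b ^ k) i)" if "i \<le> n" for i
    unfolding fps_compose_nth using that startsby_zero_power_prefix[OF assms]
    by (intro sum.mono_neutral_left) auto
  then have "fps_nth (fps_compose a b * h) n
      = (\<Sum>i=0..n. (\<Sum>k\<le>n. fps_nth a k * fps_nth (b ^ k) i) * fps_nth h (n - i))"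
    unfolding fps_mult_nth by (intro sum.cong) auto
  also have "\<dots> = (\<Sum>k\<le>n. \<Sum>i=0..n. fps_nth a k * (fps_nth (b ^ k) i * fps_nth h (n - i)))"
    by (subst sum.swap) (simp add: sum_distrib_right mult.assoc)
  finally show ?thesis
    by (simp add: fps_mult_nth sum_distrib_left)
qed

text \<open>Lagrange inversion without residues: differentiate \<open>g(f) = X\<close>, multiply by
  \<open>\<phi>\<^sup>n\<^sup>+\<^sup>1\<close> and compare coefficients; all terms but the last are
  coefficients of exact derivatives.\<close>

lemma lagrange_inversion:
  fixes \<phi> \<psi> g :: "'a::{idom,ring_char_0} fps"
  assumes inv: "\<phi> * \<psi> = 1" and \<phi>0: "fps_nth \<phi> 0 = 1"
    and comp: "fps_compose g (fps_X * \<psi>) = fps_X"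
  shows "of_nat (n + 1) * fps_nth g (n + 1) = fps_nth (\<phi> ^ (n + 1)) n"
proof -
  define f where "f = fps_X * \<psi>"
  have f0: "fps_nth f 0 = 0"
    by (simp add: f_def)
  have df: "fps_deriv f = \<psi> + fps_X * fps_deriv \<psi>"
    by (simp add: f_def)
  have "fps_deriv \<phi> * \<psi> + \<phi> * fps_deriv \<psi> = 0"
    using arg_cong[OF inv, of fps_deriv] by (simp add: add.commute)
  then have d\<psi>: "\<phi> * fps_deriv \<psi> = - (fps_deriv \<phi> * \<psi>)"
    by (simp add: eq_neg_iff_add_eq_0 add.commute)
  have \<psi>0: "fps_nth \<psi> 0 = 1"
    using arg_cong[OF inv, of "\<lambda>s. fps_nth s 0"] \<phi>0 by simp
  \<comment> \<open>For j > 0 the product is \<open>\<phi> ^ j\<close> minus X times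
    \<open>\<phi> ^ i * fps_deriv \<phi>\<close>. As j times this cofactor of X is the derivative of
    \<open>\<phi> ^ j\<close>, the two contributions in degree j agree and cancel.\<close>
  have trm: "fps_nth (\<phi> ^ (j + 1) * fps_deriv f) j = (if j = 0 then 1 else 0)" for j
  proof (cases j)
    case 0
    then show ?thesis
      by (simp add: df \<phi>0 \<psi>0)
  next
    case (Suc i)
    have "\<phi> ^ (j + 1) * fps_deriv f = \<phi> ^ j * (\<phi> * \<psi>) + fps_X * (\<phi> ^ j * (\<phi> * fps_deriv \<psi>))"
      unfolding df by (simp only: power_add power_one_right distrib_left mult_ac)
    moreover have "\<phi> ^ j * (\<phi> * fps_deriv \<psi>) = - (\<phi> ^ i * fps_deriv \<phi> * (\<phi> * \<psi>))"
      unfolding d\<psi> Suc power_Suc by (simp only: mult_minus_right mult_ac)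
    ultimately have "\<phi> ^ (j + 1) * fps_deriv f = \<phi> ^ j - fps_X * (\<phi> ^ i * fps_deriv \<phi>)"
      by (simp only: inv mult_1_right mult_minus_right diff_conv_add_uminus)
    then have "fps_nth (\<phi> ^ (j + 1) * fps_deriv f) j
        = fps_nth (\<phi> ^ j) j - fps_nth (\<phi> ^ i * fps_deriv \<phi>) i"
      by (simp only: Suc fps_sub_nth) simp
    moreover have "of_nat j * fps_nth (\<phi> ^ i * fps_deriv \<phi>) i = of_nat j * fps_nth (\<phi> ^ j) j"
    proof -
      have "fps_deriv (\<phi> ^ j) = fps_const (of_nat j) * (\<phi> ^ i * fps_deriv \<phi>)"
        unfolding Suc fps_deriv_power by (simp add: mult_ac)
      then have "fps_nth (fps_deriv (\<phi> ^ j)) i = of_nat j * fps_nth (\<phi> ^ i * fps_deriv \<phi>) i"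
        by (simp only: fps_mult_left_const_nth)
      then show ?thesis
        by (simp only: fps_deriv_nth Suc Suc_eq_plus1)
    qed
    then have "fps_nth (\<phi> ^ i * fps_deriv \<phi>) i = fps_nth (\<phi> ^ j) j"
      using Suc by (simp only: mult_cancel_left of_nat_eq_0_iff) simp
    ultimately show ?thesis
      using Suc by simp
  qed
  have "fps_compose (fps_deriv g) f * fps_deriv f = 1"
    using fps_compose_deriv[OF f0, of g] comp by (simp add: f_def)
  then have "fps_nth (\<phi> ^ (n + 1)) n
      = fps_nth (fps_compose (fps_deriv g) f * (fps_deriv f * \<phi> ^ (n + 1))) n"
    by (simp only: mult.assoc[symmetric] mult_1_left)
  also have "\<dots> = (\<Sum>k\<le>n. fps_nth (fps_deriv g) k * fps_nth (f ^ k * (fps_deriv f * \<phi> ^ (n + 1))) n)"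
    by (rule fps_nth_compose_mult[OF f0])
  also have "\<dots> = (\<Sum>k\<le>n. fps_nth (fps_deriv g) k * (if k = n then 1 else 0))"
  proof (intro sum.cong refl)
    fix k assume "k \<in> {..n}"
    then have k: "k \<le> n" by simp
    \<comment> \<open>As f is X times \<psi> and \<open>\<phi> * \<psi>\<close> is 1, k of the
      factors \<phi> cancel against \<open>f ^ k\<close> and leave \<open>fps_X ^ k\<close>, which
      reduces the term to \<open>trm\<close> at n - k.\<close>
    then have "\<phi> ^ (n + 1) = \<phi> ^ k * \<phi> ^ (n - k + 1)"
      by (simp only: power_add[symmetric]) simp
    then have "f ^ k * (fps_deriv f * \<phi> ^ (n + 1))
        = fps_X ^ k * ((\<phi> * \<psi>) ^ k * (\<phi> ^ (n - k + 1) * fps_deriv f))"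
      by (simp only: f_def power_mult_distrib mult_ac)
    then have "fps_nth (f ^ k * (fps_deriv f * \<phi> ^ (n + 1))) n
        = fps_nth (\<phi> ^ (n - k + 1) * fps_deriv f) (n - k)"
      using k by (simp only: inv power_one mult_1_left fps_X_power_mult_nth) simp
    also have "\<dots> = (if k = n then 1 else 0)"
      using k unfolding trm by simp
    finally show "fps_nth (fps_deriv g) k * fps_nth (f ^ k * (fps_deriv f * \<phi> ^ (n + 1))) n
      = fps_nth (fps_deriv g) k * (if k = n then 1 else 0)"
      by (simp only:)
  qed
  also have "\<dots> = fps_nth (fps_deriv g) n"
    by (simp only: mult_delta_right mult_1_right mult_zero_right sum.delta' sum.delta finite_atMost) simp
  finally show ?thesis
    by (simp only: fps_deriv_nth Suc_eq_plus1)
qed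

section \<open>Logarithms of formal groups\<close>

text \<open>The outer variable is v and the inner one is u, matching the order of extraction in
  \<open>fg_power_coeff\<close>.\<close>

definition fg_series :: "(nat \<Rightarrow> nat \<Rightarrow> 'r::comm_ring_1) \<Rightarrow> 'r fps fps" where
  "fg_series a = Abs_fps (\<lambda>j. Abs_fps (\<lambda>i. fg_coeff a i j))"

lemma fg_power_coeff_series: "fg_power_coeff a p i j = fps_nth (fps_nth (fg_series a ^ p) j) i"
  by (simp add: fg_power_coeff_def fg_series_def)

lemma fps_power_nth_1:
  fixes A :: "'a::comm_ring_1 fps"
  shows "fps_nth (A ^ p) 1 = of_nat p * fps_nth A 0 ^ (p - 1) * fps_nth A 1"
proof (induction p)
  case (Suc p)
  then show ?case
    by (cases p) (auto simp: fps_mult_nth_1 fps_power_zeroth algebra_simps)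
qed simp

text \<open>Modulo v^2 the group law is u + v (1 + ...), so the part of its (i + 1)-st power that is
  linear in v starts with (i + 1) u^i v. This is the pivot of the recursion for the
  logarithm.\<close>

lemma fg_power_coeff_diag:
  "fg_power_coeff a (Suc i) i 1 = (of_nat (Suc i) :: 'r::comm_ring_1)"
proof -
  have "fps_nth (fg_series a) 0 = fps_X"
    by (auto simp: fps_eq_iff fg_series_def fg_coeff_def)
  moreover have "fps_nth (fps_nth (fg_series a) 1) 0 = 1"
    by (simp add: fg_series_def fg_coeff_def)
  ultimately show ?thesis
    unfolding fg_power_coeff_series fps_power_nth_1 
    by (simp add: fps_of_nat[symmetric] fps_X_power_mult_nth mult.assoc del: of_nat_Suc)
qed

text \<open>The coefficients of \<open>u\<^sup>i v\<close> determine the logarithm recursively.\<close>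

lemma is_logarithm_unique:
  fixes g h :: "'q::{idom,ring_char_0} fps"
  assumes g: "is_logarithm \<iota> a g" and h: "is_logarithm \<iota> a h"
  shows "g = h"
proof -
  have "fps_nth g n = fps_nth h n" for n
  proof (induction n rule: less_induct)
    case (less n)
    show ?case
    proof (cases n)
      case 0
      then show ?thesis
        using g h by (simp add: is_logarithm_def)
    next
      case (Suc i)
      let ?P = "\<lambda>p. fg_power_coeff (\<lambda>i j. \<iota> (a i j)) p i 1"
      \<comment> \<open>The defining equation for u^i v: its right side depends only on the
        normalisation, so it is the same for all logarithms.\<close>
      have "(\<Sum>p\<le>Suc i. fps_nth s p * ?P p) = (if i = 0 then 1 else 0)"
        if "is_logarithm \<iota> a s" for s
      proof -
        have "(\<Sum>p\<le>i + 1. fps_nth s p * ?P p)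
            = (if (1::nat) = 0 then fps_nth s i else 0) + (if i = 0 then fps_nth s 1 else 0)"
          using that unfolding is_logarithm_def by blast
        then show ?thesis
          using that by (simp add: is_logarithm_def)
      qed
      then have "(\<Sum>p\<le>Suc i. fps_nth g p * ?P p) = (\<Sum>p\<le>Suc i. fps_nth h p * ?P p)"
        using g h by simp
      moreover have "(\<Sum>p\<le>i. fps_nth g p * ?P p) = (\<Sum>p\<le>i. fps_nth h p * ?P p)"
        using less Suc by (intro sum.cong) auto
      ultimately have "fps_nth g (Suc i) * of_nat (Suc i) = fps_nth h (Suc i) * of_nat (Suc i)"
        by (simp only: sum.atMost_Suc fg_power_coeff_diag add_left_cancel)
      then show ?thesis
        using of_nat_neq_0[of i, where 'a = 'q] by (simp add: Suc del: of_nat_Suc)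
    qed
  qed
  then show ?thesis
    by (simp add: fps_eq_iff)
qed

section \<open>Transport of formal groups along ring homomorphisms\<close>

definition fps_map :: "('a::comm_ring_1 \<Rightarrow> 'b::comm_ring_1) \<Rightarrow> 'a fps \<Rightarrow> 'b fps" where
  "fps_map h s = Abs_fps (\<lambda>n. h (fps_nth s n))"

lemma fps_nth_fps_map [simp]: "fps_nth (fps_map h s) n = h (fps_nth s n)"
  by (simp add: fps_map_def)

context comm_ring_hom
begin

lemma fps_map_mult: "fps_map hom (s * t) = fps_map hom s * fps_map hom t"
  by (simp add: fps_eq_iff fps_mult_nth hom_sum hom_mult)

lemma fps_map_power: "fps_map hom (s ^ n) = fps_map hom s ^ n"
proof (induction n)
  case 0
  then show ?case by (simp add: fps_eq_iff)
qed (simp add: fps_map_mult)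

lemma fps_map_compose: "fps_map hom (fps_compose s t) = fps_compose (fps_map hom s) (fps_map hom t)"
  by (simp add: fps_eq_iff fps_compose_nth hom_sum hom_mult fps_map_power[symmetric])

lemma compositional_inverses_map:
  assumes "compositional_inverses f g"
  shows "compositional_inverses (fps_map hom f) (fps_map hom g)"
proof -
  have "fps_map hom fps_X = fps_X"
    by (simp add: fps_eq_iff)
  then show ?thesis
    using assms by (simp add: compositional_inverses_def fps_map_compose[symmetric])
qed

lemma fg_power_coeff_hom:
  "fg_power_coeff (\<lambda>i j. hom (a i j)) p i j = hom (fg_power_coeff a p i j)"
proof -
  have coeff: "fg_coeff (\<lambda>i j. hom (a i j)) i j = hom (fg_coeff a i j)" for i j
    by (simp add: fg_coeff_def)
  have "fps_nth (fg_series (\<lambda>i j. hom (a i j)) ^ p) j = fps_map hom (fps_nth (fg_series a ^ p) j)" for j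
  proof (induction p arbitrary: j)
    case 0
    show ?case by (simp add: fps_eq_iff)
  next
    case (Suc p)
    have "fps_nth (fg_series (\<lambda>i j. hom (a i j))) j = fps_map hom (fps_nth (fg_series a) j)" for j
      by (simp add: fps_eq_iff fg_series_def coeff)
    then show ?case
      by (simp add: fps_mult_nth fps_map_mult[symmetric] Suc)
         (simp add: fps_eq_iff fps_sum_nth hom_sum)
  qed
  then show ?thesis
    by (simp add: fg_power_coeff_series)
qed

end

text \<open>\<open>\<iota>\<close> and \<open>\<kappa>\<close> are kept apart because h lives on the
  rationalised rings, while the two formal groups have their coefficients in the rings before
  rationalisation.\<close>

lemma is_logarithm_map:
  assumes "comm_ring_hom h" and log: "is_logarithm \<iota> a g"
    and eq: "\<And>i j. h (\<iota> (a i j)) = \<kappa> (b i j)"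
  shows "is_logarithm \<kappa> b (fps_map h g)"
proof -
  interpret comm_ring_hom h by fact
  have *: "fg_power_coeff (\<lambda>i j. \<kappa> (b i j)) p i j = h (fg_power_coeff (\<lambda>i j. \<iota> (a i j)) p i j)" for p i j
    using fg_power_coeff_hom[of "\<lambda>i j. \<iota> (a i j)" p i j] by (simp add: eq)
  have "(\<Sum>p\<le>i + j. fps_nth (fps_map h g) p * fg_power_coeff (\<lambda>i j. \<kappa> (b i j)) p i j)
     = h (\<Sum>p\<le>i + j. fps_nth g p * fg_power_coeff (\<lambda>i j. \<iota> (a i j)) p i j)" for i j
    by (simp add: * hom_sum hom_mult)
  then show ?thesis
    using log by (auto simp: is_logarithm_def hom_add)
qed

text \<open>The universal property of R \<otimes> Q: an element y with n y = \<iota> x has to go to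
  h x / n. The kernel of \<open>\<iota>\<close> is torsion, which h kills because the target is a
  domain of characteristic 0; this makes the value independent of the chosen fraction.\<close>

lemma rationalization_extend:
  fixes \<iota> :: "'o::comm_ring_1 \<Rightarrow> 'q::comm_ring_1" and h :: "'o \<Rightarrow> 'r::{idom,ring_char_0}"
  assumes rat: "rationalization \<iota>" and hom: "comm_ring_hom h"
    and div: "\<And>n. n > 0 \<Longrightarrow> \<exists>y. of_nat n * y = (1 :: 'r)"
  shows "\<exists>h'. comm_ring_hom h' \<and> (\<forall>x. h' (\<iota> x) = h x)"
proof -
  interpret i: comm_ring_hom \<iota>
    using rat by (simp add: rationalization_def)
  interpret h: comm_ring_hom h by fact
  have repr: "\<exists>n>0. \<exists>x. of_nat n * y = \<iota> x" for y
    using rat by (simp add: rationalization_def)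
  have tor: "\<iota> x = 0 \<longleftrightarrow> (\<exists>n>0. of_nat n * x = 0)" for x
    using rat by (simp add: rationalization_def)
  have ker: "h x = h y" if "\<iota> x = \<iota> y" for x y
  proof -
    have "\<iota> (x - y) = 0"
      using that by (simp add: i.hom_minus)
    then obtain n where "n > 0" "of_nat n * (x - y) = 0"
      using tor by auto
    then have "of_nat n * (h x - h y) = 0"
      by (metis h.hom_minus h.hom_mult h.hom_of_nat h.hom_zero)
    then show ?thesis
      using \<open>n > 0\<close> by simp
  qed
  \<comment> \<open>The graph of the extension: y is a fraction x / n of some x in the source, and z
    is the corresponding fraction of its image.\<close>
  define R where "R = (\<lambda>y z. \<exists>n>0. \<exists>x. of_nat n * y = \<iota> x \<and> of_nat n * z = h x)"
  have ex: "\<exists>z. R y z" for y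
  proof -
    obtain n x where n: "n > 0" "of_nat n * y = \<iota> x"
      using repr by blast
    obtain u :: 'r where "of_nat n * u = 1"
      using div n by blast
    then have "of_nat n * (u * h x) = h x"
      by (simp add: mult.assoc[symmetric])
    then show ?thesis
      using n unfolding R_def by blast
  qed
  have uniq: "z = z'" if "R y z" "R y z'" for y z z'
  proof -
    obtain n x where n: "n > 0" "of_nat n * y = \<iota> x" "of_nat n * z = h x"
      using \<open>R y z\<close> by (auto simp: R_def)
    obtain m x' where m: "m > 0" "of_nat m * y = \<iota> x'" "of_nat m * z' = h x'"
      using \<open>R y z'\<close> by (auto simp: R_def)
    have "\<iota> (of_nat m * x) = of_nat m * (of_nat n * y)"
      by (simp add: i.hom_mult i.hom_of_nat n)
    also have "\<dots> = of_nat n * (of_nat m * y)"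
      by (rule mult.left_commute)
    also have "\<dots> = \<iota> (of_nat n * x')"
      by (simp add: i.hom_mult i.hom_of_nat m)
    finally have "of_nat m * h x = of_nat n * h x'"
      using ker[of "of_nat m * x" "of_nat n * x'"] by (simp add: h.hom_mult h.hom_of_nat)
    then have "of_nat n * of_nat m * (z - z') = 0"
      by (simp add: n(3)[symmetric] m(3)[symmetric] algebra_simps)
    then show ?thesis
      using n(1) m(1) by simp
  qed
  define h' where "h' = (\<lambda>y. SOME z. R y z)"
  have R: "R y (h' y)" for y
    unfolding h'_def by (rule someI_ex[OF ex])
  have val: "h' y = z" if "R y z" for y z
    using uniq[OF R that] .
  have \<iota>: "h' (\<iota> x) = h x" for x
    by (rule val) (auto simp: R_def intro!: exI[of _ 1] exI[of _ x])
  have add: "h' (y + z) = h' y + h' z" and mult: "h' (y * z) = h' y * h' z" for y z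
  proof -
    obtain n x where n: "n > 0" "of_nat n * y = \<iota> x" "of_nat n * h' y = h x"
      using R[of y] by (auto simp: R_def)
    obtain m w where m: "m > 0" "of_nat m * z = \<iota> w" "of_nat m * h' z = h w"
      using R[of z] by (auto simp: R_def)
    have a1: "of_nat (n * m) * (y + z) = \<iota> (of_nat m * x + of_nat n * w)"
      by (simp add: i.hom_mult i.hom_add i.hom_of_nat n(2)[symmetric] m(2)[symmetric] algebra_simps)
    have a2: "of_nat (n * m) * (h' y + h' z) = h (of_nat m * x + of_nat n * w)"
      by (simp add: h.hom_mult h.hom_add h.hom_of_nat n(3)[symmetric] m(3)[symmetric] algebra_simps)
    have b1: "of_nat (n * m) * (y * z) = \<iota> (x * w)"
      by (simp add: i.hom_mult i.hom_of_nat n(2)[symmetric] m(2)[symmetric] algebra_simps)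
    have b2: "of_nat (n * m) * (h' y * h' z) = h (x * w)"
      by (simp add: h.hom_mult h.hom_of_nat n(3)[symmetric] m(3)[symmetric] algebra_simps)
    have nm: "n * m > 0"
      using n m by simp
    show "h' (y + z) = h' y + h' z"
      unfolding val[unfolded R_def, OF exI[of _ "n * m"], OF conjI, OF nm exI, OF conjI, OF a1 a2] ..
    show "h' (y * z) = h' y * h' z"
      unfolding val[unfolded R_def, OF exI[of _ "n * m"], OF conjI, OF nm exI, OF conjI, OF b1 b2] ..
  qed
  have "comm_ring_hom h'"
    using \<iota>[of 0] \<iota>[of 1] by unfold_locales (auto simp: add mult)
  then show ?thesis
    using \<iota> by blast
qed

section \<open>Integral and rational polynomials in the variables t\<close>

lemma poly_mapping_sum_monomials:
  fixes p :: "'a \<Rightarrow>\<^sub>0 'b::comm_monoid_add"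
  shows "p = (\<Sum>s\<in>Poly_Mapping.keys p. Poly_Mapping.single s (Poly_Mapping.lookup p s))"
proof (rule poly_mapping_eqI)
  fix k
  show "Poly_Mapping.lookup p k = Poly_Mapping.lookup
    (\<Sum>s\<in>Poly_Mapping.keys p. Poly_Mapping.single s (Poly_Mapping.lookup p s)) k"
    by (cases "k \<in> Poly_Mapping.keys p")
       (auto simp: lookup_sum lookup_single when_def in_keys_iff sum.delta)
qed

lemma lookup_rat_tpoly [simp]: "Poly_Mapping.lookup (rat_tpoly p) k = of_int (Poly_Mapping.lookup p k)"
  by (simp add: rat_tpoly_def Poly_Mapping.map.rep_eq when_def)

lemma rat_tpoly_single [simp]: "rat_tpoly (Poly_Mapping.single s z) = Poly_Mapping.single s (of_int z)"
  by (rule poly_mapping_eqI) (simp add: lookup_single when_def)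

lemma rat_tpoly_add: "rat_tpoly (p + q) = rat_tpoly p + rat_tpoly q"
  by (rule poly_mapping_eqI) (simp add: lookup_add)

lemma rat_tpoly_sum: "rat_tpoly (sum f A) = (\<Sum>x\<in>A. rat_tpoly (f x))"
  by (rule poly_mapping_eqI) (simp add: lookup_sum)

lemma rat_tpoly_hom: "comm_ring_hom rat_tpoly"
proof
  show "rat_tpoly 0 = 0" "rat_tpoly 1 = 1"
    by (auto intro!: poly_mapping_eqI simp: lookup_one when_def)
  show "rat_tpoly (p + q) = rat_tpoly p + rat_tpoly q" for p q
    by (rule rat_tpoly_add)
  show "rat_tpoly (p * q) = rat_tpoly p * rat_tpoly q" for p q
  proof -
    \<comment> \<open>Both factors are expanded into monomials, on which multiplicativity is a
      statement about integers.\<close>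
    have "rat_tpoly (p * q) = rat_tpoly
      ((\<Sum>s\<in>Poly_Mapping.keys p. Poly_Mapping.single s (Poly_Mapping.lookup p s)) *
       (\<Sum>s\<in>Poly_Mapping.keys q. Poly_Mapping.single s (Poly_Mapping.lookup q s)))"
      by (simp only: poly_mapping_sum_monomials[symmetric])
    also have "\<dots> = rat_tpoly (\<Sum>s\<in>Poly_Mapping.keys p. Poly_Mapping.single s (Poly_Mapping.lookup p s)) *
       rat_tpoly (\<Sum>s\<in>Poly_Mapping.keys q. Poly_Mapping.single s (Poly_Mapping.lookup q s))"
      by (simp add: sum_product rat_tpoly_sum mult_single)
    finally show ?thesis
      by (simp only: poly_mapping_sum_monomials[symmetric])
  qed
qed

lemma rat_tpoly_divisible:
  assumes "n > 0"
  shows "\<exists>y. of_nat n * y = (1 :: rat tpoly)"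
proof
  show "of_nat n * Poly_Mapping.single 0 (1 / of_nat n) = (1 :: rat tpoly)"
    using assms by (simp add: single_of_nat[symmetric] mult_single del: single_of_nat)
qed

lemma fps_map_normalized_series:
  assumes "comm_ring_hom h"
  shows "fps_map h (normalized_series c) = normalized_series (\<lambda>k. h (c k))"
proof -
  interpret comm_ring_hom h by fact
  show ?thesis
    by (simp add: fps_eq_iff normalized_series_nth)
qed

text \<open>The composite of \<Phi> with the inclusion into rational polynomials extends to the
  rationalised ring and carries the given logarithm to the logarithm of the image group, which is
  unique. One argument serves both groups: x n is the class of CP^n, and the pair (fc, gc) is (M, N)
  for the tangent and (t, L) for the normal version.\<close>

lemma formal_group_logarithm:
  fixes \<Phi> :: "'o::comm_ring_1 \<Rightarrow> int tpoly" and \<iota> :: "'o \<Rightarrow> 'q::comm_ring_1"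
  assumes \<Phi>: "comm_ring_hom \<Phi>" and rat: "rationalization \<iota>" and log: "is_logarithm \<iota> a g\<^sub>F"
    and coeff: "\<And>n. n \<ge> 1 \<Longrightarrow> of_nat (n + 1) * fps_nth g\<^sub>F (n + 1) = \<iota> (x n)"
    and gc: "\<And>n. n \<ge> 1 \<Longrightarrow> \<Phi> (x n) = of_nat (n + 1) * gc n"
    and inv: "compositional_inverses (normalized_series fc) (normalized_series gc)"
  shows "(\<forall>g. is_logarithm rat_tpoly (\<lambda>i j. \<Phi> (a i j)) g \<longleftrightarrow>
            g = normalized_series (\<lambda>k. rat_tpoly (gc k)))"
    and "(\<forall>f. is_exponential rat_tpoly (\<lambda>i j. \<Phi> (a i j)) f \<longleftrightarrow>
            f = normalized_series (\<lambda>k. rat_tpoly (fc k)))"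
proof -
  interpret \<Phi>: comm_ring_hom \<Phi> by fact
  interpret r: comm_ring_hom rat_tpoly by (rule rat_tpoly_hom)
  have "comm_ring_hom (\<lambda>x. rat_tpoly (\<Phi> x))"
    by unfold_locales (simp_all add: \<Phi>.hom_add \<Phi>.hom_mult r.hom_add r.hom_mult)
  then obtain h where h: "comm_ring_hom h" "\<And>x. h (\<iota> x) = rat_tpoly (\<Phi> x)"
    using rationalization_extend[OF rat _ rat_tpoly_divisible] by meson
  interpret h: comm_ring_hom h by fact
  let ?f = "normalized_series (\<lambda>k. rat_tpoly (fc k))"
    and ?g = "normalized_series (\<lambda>k. rat_tpoly (gc k))"
  have L: "is_logarithm rat_tpoly (\<lambda>i j. \<Phi> (a i j)) (fps_map h g\<^sub>F)"
    by (rule is_logarithm_map[OF h(1) log]) (rule h(2))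
  have "fps_nth (fps_map h g\<^sub>F) m = fps_nth ?g m" for m
  proof (cases "m \<le> 1")
    case True
    then show ?thesis
      using L by (auto simp: is_logarithm_def normalized_series_nth le_Suc_eq)
  next
    case False
    then obtain n where n: "m = n + 1" "n \<ge> 1"
      by (metis add.commute le_add_diff_inverse nat_le_linear not_less_eq_eq One_nat_def plus_1_eq_Suc Suc_le_mono)
    \<comment> \<open>The factor n + 1 in the coefficient of the logarithm cancels against the same
      factor in the Chern polynomial, since rational polynomials form a domain of characteristic
      0.\<close>
    have "of_nat (n + 1) * h (fps_nth g\<^sub>F (n + 1)) = of_nat (n + 1) * rat_tpoly (gc n)"
      using arg_cong[OF coeff[OF n(2)], of h] gc[OF n(2)] h(2)[of "x n"]
      by (simp only: h.hom_mult r.hom_mult h.hom_of_nat r.hom_of_nat)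
    then have "h (fps_nth g\<^sub>F (n + 1)) = rat_tpoly (gc n)"
      by (simp only: mult_cancel_left of_nat_eq_0_iff) simp
    then show ?thesis
      using n by (simp add: normalized_series_nth)
  qed
  then have eq: "fps_map h g\<^sub>F = ?g"
    by (simp add: fps_eq_iff)
  show log': "\<forall>g. is_logarithm rat_tpoly (\<lambda>i j. \<Phi> (a i j)) g \<longleftrightarrow> g = ?g"
    using L is_logarithm_unique[of rat_tpoly "\<lambda>i j. \<Phi> (a i j)"] unfolding eq by blast
  have inv': "compositional_inverses ?f ?g"
    using r.compositional_inverses_map[OF inv] by (simp only: fps_map_normalized_series rat_tpoly_hom)
  then have "compositional_inverses f ?g \<longleftrightarrow> f = ?f" for f
    using compositional_inverse_unique compositional_inverses_sym by blast
  then show "\<forall>f. is_exponential rat_tpoly (\<lambda>i j. \<Phi> (a i j)) f \<longleftrightarrow> f = ?f"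
    using log' by (simp add: is_exponential_def)
qed

section \<open>The polynomials L, M and N\<close>

definition tseries :: "int tpoly fps" where
  "tseries = Abs_fps (\<lambda>k. if k = 0 then 1 else tvar k)"

text \<open>The second argument of \<open>fps_right_inverse\<close> is the inverse of the constant
  term; it is 1, so the coefficients stay in Z[t].\<close>

definition tseries_inv :: "int tpoly fps" where
  "tseries_inv = fps_right_inverse tseries 1"

lemma tseries_nth: "fps_nth tseries k = (if k = 0 then 1 else tvar k)"
  by (simp add: tseries_def)

lemma tseries_mult_inv: "tseries * tseries_inv = 1"
  unfolding tseries_inv_def by (rule fps_right_inverse) (simp add: tseries_nth)

lemma tseries_inv_nth_0: "fps_nth tseries_inv 0 = 1"
  by (simp add: tseries_inv_def)

lemma M_poly_nth: "M_poly n = fps_nth tseries_inv n"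
proof -
  have "(THE G. tseries * G = 1) = tseries_inv"
  proof (rule the_equality)
    show "G = tseries_inv" if "tseries * G = 1" for G
    proof -
      have "G = (tseries * tseries_inv) * G"
        by (simp add: tseries_mult_inv)
      also have "\<dots> = tseries_inv * (tseries * G)"
        by (simp only: mult_ac)
      finally show ?thesis
        using that by simp
    qed
  qed (rule tseries_mult_inv)
  then show ?thesis
    by (simp add: M_poly_def tseries_def)
qed

text \<open>Serves to replace the truncated polynomial in the definition of \<open>N_poly\<close> by
  the full series.\<close>

lemma fps_power_nth_cong:
  fixes s t :: "'a::comm_ring_1 fps"
  assumes "\<And>k. k \<le> n \<Longrightarrow> fps_nth s k = fps_nth t k"
  shows "fps_nth (s ^ m) n = fps_nth (t ^ m) n"
  using assms
proof (induction m arbitrary: n)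
  case (Suc m)
  then show ?case
    by (auto simp: fps_mult_nth intro!: sum.cong)
qed simp

lemma normalized_series_eqI:
  assumes "fps_nth g 0 = 0" "fps_nth g 1 = 1" "\<And>n. n \<ge> 1 \<Longrightarrow> fps_nth g (n + 1) = c n"
  shows "g = normalized_series c"
proof (rule fps_ext)
  fix n
  show "fps_nth g n = fps_nth (normalized_series c) n"
    using assms(1,2) assms(3)[of "n - 1"] by (cases n) (auto simp: normalized_series_nth)
qed

lemma normalized_series_M_poly: "normalized_series M_poly = fps_X * tseries_inv"
  by (rule normalized_series_eqI[symmetric]) (auto simp: M_poly_nth tseries_inv_nth_0)

lemma normalized_series_tvar: "normalized_series tvar = fps_X * tseries"
  by (rule normalized_series_eqI[symmetric]) (auto simp: tseries_nth)

text \<open>The inverse of z / T(z) satisfies the equation that defines \<open>N_poly\<close>. As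
  this inverse exists over Z[t], division by n + 1 is possible there, which justifies the
  description operator.\<close>

lemma compositional_inverses_M_N: "compositional_inverses (normalized_series M_poly) (normalized_series N_poly)"
  and N_poly: "of_nat (n + 1) * N_poly n = fps_nth (tseries ^ (n + 1)) n"
proof -
  obtain g where g: "fps_nth g 1 = 1" and inv: "compositional_inverses (normalized_series M_poly) g"
    using compositional_inverse_exists[of "normalized_series M_poly"] by (auto simp: normalized_series_nth)
  have g0: "fps_nth g 0 = 0" and comp: "fps_compose g (fps_X * tseries_inv) = fps_X"
    using inv by (auto simp: compositional_inverses_def normalized_series_M_poly)
  have lag: "of_nat (n + 1) * fps_nth g (n + 1) = fps_nth (tseries ^ (n + 1)) n" for n
    by (rule lagrange_inversion[OF tseries_mult_inv _ comp]) (simp add: tseries_nth)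
  have N: "N_poly n = fps_nth g (n + 1)" for n
  proof -
    let ?s = "1 + (\<Sum>k=1..n. fps_const (tvar k) * fps_X ^ k)"
    have "fps_nth ?s k = fps_nth tseries k" if "k \<le> n" for k
      using that by (cases "k = 0")
        (auto simp: fps_sum_nth tseries_nth mult_delta_right)
    then have *: "fps_nth (?s ^ (n + 1)) n = fps_nth (tseries ^ (n + 1)) n"
      by (rule fps_power_nth_cong)
    show ?thesis
      unfolding N_poly_def *
    proof (rule the_equality)
      show "of_nat (n + 1) * fps_nth g (n + 1) = fps_nth (tseries ^ (n + 1)) n"
        by (rule lag)
      show "p = fps_nth g (n + 1)" if "of_nat (n + 1) * p = fps_nth (tseries ^ (n + 1)) n" for p
      proof -
        have "of_nat (n + 1) * p = of_nat (n + 1) * fps_nth g (n + 1)"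
          using that lag by (simp only:)
        then show ?thesis
          by (simp only: mult_cancel_left of_nat_eq_0_iff) simp
      qed
    qed
  qed
  show "of_nat (n + 1) * N_poly n = fps_nth (tseries ^ (n + 1)) n"
    unfolding N by (rule lag)
  have "g = normalized_series N_poly"
    using g g0 by (intro normalized_series_eqI) (auto simp: N)
  then show "compositional_inverses (normalized_series M_poly) (normalized_series N_poly)"
    using inv by simp
qed

text \<open>The same inversion with T and its reciprocal exchanged, starting from z T(z).\<close>

lemma compositional_inverses_t_L: "compositional_inverses (normalized_series tvar) (normalized_series L_poly)"
  and L_poly: "of_nat (n + 1) * L_poly n = fps_nth (tseries_inv ^ (n + 1)) n"
proof -
  obtain g where g: "fps_nth g 1 = 1" and inv: "compositional_inverses (normalized_series tvar) g"
    using compositional_inverse_exists[of "normalized_series tvar"] by (auto simp: normalized_series_nth)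
  have g0: "fps_nth g 0 = 0" and comp: "fps_compose g (fps_X * tseries) = fps_X"
    using inv by (auto simp: compositional_inverses_def normalized_series_tvar)
  have L: "L_poly n = fps_nth g (n + 1)" for n
  proof -
    have "(THE g. compositional_inverses (normalized_series tvar) g) = g"
      using inv by (rule the_equality) (rule compositional_inverse_unique[OF _ inv])
    then show ?thesis
      by (simp add: L_poly_def)
  qed
  show "of_nat (n + 1) * L_poly n = fps_nth (tseries_inv ^ (n + 1)) n"
    unfolding L using tseries_mult_inv
    by (intro lagrange_inversion[OF _ tseries_inv_nth_0 comp]) (simp add: mult.commute)
  have "g = normalized_series L_poly"
    using g g0 by (intro normalized_series_eqI) (auto simp: L)
  then show "compositional_inverses (normalized_series tvar) (normalized_series L_poly)"
    using inv by simp
qed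

section \<open>Monomial symmetric functions\<close>

lemma finite_partitions_of [simp]: "finite (partitions_of n)"
proof -
  have "partitions_of n \<subseteq> mset ` {xs. set xs \<subseteq> {..n} \<and> length xs \<le> n}"
  proof
    fix l assume l: "l \<in> partitions_of n"
    obtain xs where xs: "l = mset xs"
      by (metis ex_mset)
    have "length xs \<le> sum_list xs" if "0 \<notin> set xs" for xs :: "nat list"
      using that by (induction xs) auto
    then have "length xs \<le> n" "set xs \<subseteq> {..n}"
      using l xs member_le_sum_list[of _ xs] by (auto simp: partitions_of_def sum_mset_sum_list)
    then show "l \<in> mset ` {xs. set xs \<subseteq> {..n} \<and> length xs \<le> n}"
      using xs by blast
  qed
  then show ?thesis
    by (rule finite_subset) (intro finite_imageI finite_lists_length_le, simp)
qed

section \<open>Types of exponent vectors\<close>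

definition exponent_type :: "nat \<Rightarrow> (nat \<Rightarrow> nat) \<Rightarrow> nat multiset" where
  "exponent_type N b = filter_mset (\<lambda>e. e \<noteq> 0) (image_mset b (mset_set {..<N}))"

definition exponents :: "nat \<Rightarrow> nat multiset \<Rightarrow> (nat \<Rightarrow> nat) set" where
  "exponents N l = {a \<in> {..<N} \<rightarrow>\<^sub>E {..sum_mset l}. exponent_type N a = l}"

lemma monomial_sym_exponents: "monomial_sym N l x = (\<Sum>a\<in>exponents N l. \<Prod>i<N. x i ^ a i)"
  by (simp add: monomial_sym_def exponents_def exponent_type_def)

lemma exponent_type_support:
  "exponent_type N b = image_mset b (mset_set {i. i < N \<and> b i \<noteq> 0})"
proof -
  have "{x \<in> {..<N}. b x \<noteq> 0} = {i. i < N \<and> b i \<noteq> 0}"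
    by auto
  then show ?thesis
    by (simp add: exponent_type_def filter_mset_image_mset)
qed

lemma exponent_type_cong:
  assumes "\<And>i. i < N \<Longrightarrow> a i = b i"
  shows "exponent_type N a = exponent_type N b"
  unfolding exponent_type_def using assms by (intro arg_cong[of _ _ "filter_mset _"] image_mset_cong) simp

lemma sum_mset_exponent_type: "sum_mset (exponent_type N b) = (\<Sum>i<N. b i)"
proof -
  have "sum_mset (filter_mset (\<lambda>e. e \<noteq> 0) M) = sum_mset M" for M :: "nat multiset"
    by (induction M) auto
  then show ?thesis
    by (simp add: exponent_type_def sum_unfold_sum_mset)
qed

lemma exponent_type_in_partitions: "exponent_type N b \<in> partitions_of (\<Sum>i<N. b i)"
  using sum_mset_exponent_type[of N b] by (simp add: partitions_of_def) (simp add: exponent_type_def)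

text \<open>The exponent vectors of total degree n in N variables; the extensional function space
  makes each vector a single function.\<close>

definition compositions :: "nat \<Rightarrow> nat \<Rightarrow> (nat \<Rightarrow> nat) set" where
  "compositions N n = {a \<in> {..<N} \<rightarrow>\<^sub>E {..n}. (\<Sum>i<N. a i) = n}"

lemma finite_compositions [simp]: "finite (compositions N n)"
  unfolding compositions_def by (rule finite_subset[OF _ finite_PiE[of "{..<N}" "\<lambda>_. {..n}"]]) auto

lemma sum_compositions:
  fixes f :: "(nat \<Rightarrow> nat) \<Rightarrow> 'a::comm_monoid_add"
  shows "(\<Sum>a\<in>compositions N n. f a) = (\<Sum>l\<in>partitions_of n. \<Sum>a\<in>exponents N l. f a)"
proof -
  have "(\<Sum>a\<in>compositions N n. f a) =
      (\<Sum>l\<in>partitions_of n. \<Sum>a\<in>{a \<in> compositions N n. exponent_type N a = l}. f a)"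
    using exponent_type_in_partitions[of N]
    by (intro sum.group[symmetric] finite_compositions finite_partitions_of)
       (auto simp: compositions_def)
  also have "\<dots> = (\<Sum>l\<in>partitions_of n. \<Sum>a\<in>exponents N l. f a)"
  proof (intro sum.cong refl)
    fix l assume "l \<in> partitions_of n"
    then show "{a \<in> compositions N n. exponent_type N a = l} = exponents N l"
      using sum_mset_exponent_type[of N] by (auto simp: compositions_def exponents_def partitions_of_def)
  qed
  finally show ?thesis .
qed

text \<open>The list and the nonzero values of b form the same multiset, so a permutation matches
  the list positions with the positions in the support.\<close>

lemma support_enumeration:
  assumes "mset ps = exponent_type N b"
  obtains h where "bij_betw h {..<length ps} {i. i < N \<and> b i \<noteq> 0}"
    and "\<And>j. j < length ps \<Longrightarrow> b (h j) = ps ! j"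
proof -
  define zs where "zs = sorted_list_of_set {i. i < N \<and> b i \<noteq> 0}"
  have zs: "distinct zs" "set zs = {i. i < N \<and> b i \<noteq> 0}"
    by (auto simp: zs_def)
  have "mset (map b zs) = mset ps"
    using assms zs mset_set_set[OF zs(1)] by (simp add: exponent_type_support)
  then obtain p where p: "p permutes {..<length ps}" "permute_list p (map b zs) = ps"
    using mset_eq_permutation[of ps "map b zs"] mset_eq_length by (metis length_permute_list)
  have len: "length zs = length ps"
    using p(2) by (metis length_map length_permute_list)
  show ?thesis
  proof (rule that)
    show "bij_betw (\<lambda>j. zs ! p j) {..<length ps} {i. i < N \<and> b i \<noteq> 0}"
      using bij_betw_trans[OF permutes_imp_bij[OF p(1)] bij_betw_nth[OF zs(1) _ zs(2)[symmetric]]] len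
      by (simp add: o_def)
    show "b (zs ! p j) = ps ! j" if "j < length ps" for j
      using that p len permutes_in_image[OF p(1), of j]
      by (metis length_map lessThan_iff nth_map permute_list_nth)
  qed
qed

text \<open>The number of ways to lower b depends on b only through its type: an enumeration of the
  support carries subsets of list positions to subsets of the support. Hence the coefficients in
  products of symmetric functions do not depend on the number N of variables.\<close>

lemma card_lowerings:
  assumes ps: "mset ps = exponent_type N b"
  shows "card {S. S \<subseteq> {i. i < N \<and> b i \<noteq> 0} \<and> card S = k \<and>
                  exponent_type N (\<lambda>i. b i - of_bool (i \<in> S)) = l}
       = card {S. S \<subseteq> {..<length ps} \<and> card S = k \<and>
                  exponent_type (length ps) (\<lambda>j. ps ! j - of_bool (j \<in> S)) = l}"
    (is "card ?B = card ?A")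
proof -
  obtain h where h: "bij_betw h {..<length ps} {i. i < N \<and> b i \<noteq> 0}"
    and b: "\<And>j. j < length ps \<Longrightarrow> b (h j) = ps ! j"
    using support_enumeration[OF ps] by blast
  let ?m = "length ps" and ?V = "{i. i < N \<and> b i \<noteq> 0}"
  have inj: "inj_on h {..<?m}" and img: "h ` {..<?m} = ?V"
    using h by (auto simp: bij_betw_def)
  have type: "exponent_type N (\<lambda>i. b i - of_bool (i \<in> h ` S))
      = exponent_type ?m (\<lambda>j. ps ! j - of_bool (j \<in> S))" if S: "S \<subseteq> {..<?m}" for S
  proof -
    let ?f = "\<lambda>i. b i - of_bool (i \<in> h ` S)" and ?g = "\<lambda>j. ps ! j - of_bool (j \<in> S)"
    have "h j \<in> h ` S \<longleftrightarrow> j \<in> S" if "j < ?m" for j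
      using inj_on_image_mem_iff[OF inj _ S] that by simp
    then have fg: "?f (h j) = ?g j" if "j < ?m" for j
      using b that by simp
    have "h ` {j. j < ?m \<and> ?g j \<noteq> 0} = {i. i < N \<and> ?f i \<noteq> 0}"
    proof (intro equalityI subsetI)
      fix i assume "i \<in> h ` {j. j < ?m \<and> ?g j \<noteq> 0}"
      then obtain j where j: "i = h j" "j < ?m" "?g j \<noteq> 0"
        by blast
      moreover have "h j \<in> ?V"
        using img j(2) by blast
      ultimately show "i \<in> {i. i < N \<and> ?f i \<noteq> 0}"
        using fg[of j] by (simp only: mem_Collect_eq simp_thms)
    next
      fix i assume i: "i \<in> {i. i < N \<and> ?f i \<noteq> 0}"
      then have "i \<in> ?V"
        by auto
      then obtain j where "j < ?m" "i = h j"
        using img by (metis (no_types, lifting) imageE lessThan_iff)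
      then show "i \<in> h ` {j. j < ?m \<and> ?g j \<noteq> 0}"
        using i fg[of j] by (intro image_eqI[of _ h j]) (simp_all only: mem_Collect_eq simp_thms)
    qed
    moreover have "inj_on h {j. j < ?m \<and> ?g j \<noteq> 0}"
      by (rule inj_on_subset[OF inj]) auto
    ultimately have "exponent_type N ?f
        = image_mset ?f (image_mset h (mset_set {j. j < ?m \<and> ?g j \<noteq> 0}))"
      by (simp only: exponent_type_support image_mset_mset_set)
    also have "\<dots> = image_mset ?g (mset_set {j. j < ?m \<and> ?g j \<noteq> 0})"
      unfolding multiset.map_comp o_def by (intro image_mset_cong) (use fg in auto)
    finally show ?thesis
      by (simp only: exponent_type_support)
  qed
  have "bij_betw (image h) ?A ?B"
  proof (rule bij_betwI')
    show "h ` S = h ` S' \<longleftrightarrow> S = S'" if "S \<in> ?A" "S' \<in> ?A" for S S'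
      using inj_on_image_eq_iff[OF inj] that by auto
    show "h ` S \<in> ?B" if "S \<in> ?A" for S
    proof -
      have "h ` S \<subseteq> ?V" "card (h ` S) = card S"
        using that img card_image[OF inj_on_subset[OF inj]] by auto
      then show ?thesis
        using type[of S] that by simp
    qed
    show "\<exists>S\<in>?A. T = h ` S" if T: "T \<in> ?B" for T
    proof -
      have "T \<subseteq> h ` {..<?m}"
        using T img by auto
      then obtain S where S: "S \<subseteq> {..<?m}" "T = h ` S"
        by (auto simp: subset_image_iff)
      then have "card S = card T"
        using card_image[OF inj_on_subset[OF inj]] by auto
      then show ?thesis
        using S T type[OF S(1)] by auto
    qed
  qed
  then show ?thesis
    by (rule bij_betw_same_card[symmetric])
qed

text \<open>The coefficient of the monomial function of r in the product of the k-th elementary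
  function with the monomial function of l. The list serves to tell equal parts apart.\<close>

definition lowering_count :: "nat \<Rightarrow> nat multiset \<Rightarrow> nat multiset \<Rightarrow> nat" where
  "lowering_count k l r = (let ps = sorted_list_of_multiset r in
     card {S. S \<subseteq> {..<length ps} \<and> card S = k \<and>
              exponent_type (length ps) (\<lambda>j. ps ! j - of_bool (j \<in> S)) = l})"

text \<open>A term of the product is a pair of a k-subset S and an exponent vector a. Grouping the
  pairs by the sum b of a and the indicator of S, the fibre over b consists of the S for which
  lowering b along S leaves type l.\<close>

lemma elementary_monomial_product:
  "elementary_sym N k x * monomial_sym N l x =
     (\<Sum>r\<in>partitions_of (k + sum_mset l). int (lowering_count k l r) * monomial_sym N r x)"
proof -
  let ?n = "k + sum_mset l"
  let ?Sk = "{S. S \<subseteq> {..<N} \<and> card S = k}"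
  let ?mon = "\<lambda>b :: nat \<Rightarrow> nat. \<Prod>i<N. x i ^ b i"
  define up where "up = (\<lambda>(S :: nat set, a :: nat \<Rightarrow> nat). \<lambda>i\<in>{..<N}. a i + of_bool (i \<in> S))"
  define P where "P = ?Sk \<times> exponents N l"
  have finE: "finite (exponents N l)"
    unfolding exponents_def by (rule finite_subset[OF _ finite_PiE[of "{..<N}" "\<lambda>_. {..sum_mset l}"]]) auto
  have finSk: "finite ?Sk"
    by (rule finite_subset[of _ "Pow {..<N}"]) auto
  have finP: "finite P"
    unfolding P_def using finE finSk by simp
  have mon: "(\<Prod>i\<in>S. x i) * ?mon a = ?mon (up (S, a))" if "S \<subseteq> {..<N}" for S a
  proof -
    have "(\<Prod>i\<in>S. x i) = (\<Prod>i<N. x i ^ of_bool (i \<in> S))"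
      using that by (intro prod.mono_neutral_cong_left) auto
    then show ?thesis
      by (simp add: up_def prod.distrib[symmetric] power_add mult.commute)
  qed
  have up_in: "up ` P \<subseteq> compositions N ?n"
  proof
    fix b assume "b \<in> up ` P"
    then obtain S a where b: "b = up (S, a)" and S: "S \<subseteq> {..<N}" "card S = k" and a: "a \<in> exponents N l"
      by (auto simp: P_def)
    have "(\<Sum>i<N. of_bool (i \<in> S)) = card S"
      using S(1) by (simp add: of_bool_def sum.If_cases Int_absorb1)
    moreover have "(\<Sum>i<N. a i) = sum_mset l"
      using a sum_mset_exponent_type[of N a] by (auto simp: exponents_def)
    ultimately have tot: "(\<Sum>i<N. b i) = ?n"
      using S(2) by (simp add: b up_def sum.distrib)
    moreover have "b i \<le> (\<Sum>i<N. b i)" if "i < N" for i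
      using that by (intro member_le_sum) auto
    ultimately show "b \<in> compositions N ?n"
      by (auto simp: compositions_def b up_def PiE_def)
  qed
  have card: "card {q \<in> P. up q = b} = lowering_count k l (exponent_type N b)"
    if b: "b \<in> compositions N ?n" for b
  proof -
    let ?L = "{S. S \<subseteq> {i. i < N \<and> b i \<noteq> 0} \<and> card S = k \<and>
                  exponent_type N (\<lambda>i. b i - of_bool (i \<in> S)) = l}"
    \<comment> \<open>S determines the pair, since a is b lowered along S; natural subtraction is
      exact because S lies in the support of b.\<close>
    have "bij_betw fst {q \<in> P. up q = b} ?L"
    proof (rule bij_betw_byWitness[where f' = "\<lambda>S. (S, \<lambda>i\<in>{..<N}. b i - of_bool (i \<in> S))"])
      show "\<forall>q\<in>{q \<in> P. up q = b}. (fst q, \<lambda>i\<in>{..<N}. b i - of_bool (i \<in> fst q)) = q"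
        by (auto simp: P_def up_def exponents_def PiE_def intro!: extensionalityI[where A = "{..<N}"])
      show "\<forall>S\<in>?L. fst (S, \<lambda>i\<in>{..<N}. b i - of_bool (i \<in> S)) = S"
        by simp
      show "fst ` {q \<in> P. up q = b} \<subseteq> ?L"
      proof (rule image_subsetI)
        fix q assume "q \<in> {q \<in> P. up q = b}"
        then obtain S a where q: "q = (S, a)" "(S, a) \<in> P" "b = up (S, a)"
          by (cases q) auto
        have "exponent_type N (\<lambda>i. b i - of_bool (i \<in> S)) = exponent_type N a"
          by (rule exponent_type_cong) (simp add: q up_def)
        moreover have "S \<subseteq> {i. i < N \<and> b i \<noteq> 0}"
          using q by (auto simp: P_def up_def)
        ultimately show "fst q \<in> ?L"
          using q(1,2) by (auto simp: P_def exponents_def)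
      qed
      show "(\<lambda>S. (S, \<lambda>i\<in>{..<N}. b i - of_bool (i \<in> S))) ` ?L \<subseteq> {q \<in> P. up q = b}"
      proof (rule image_subsetI)
        fix S assume "S \<in> ?L"
        then have S: "S \<subseteq> {i. i < N \<and> b i \<noteq> 0}" "card S = k"
          "exponent_type N (\<lambda>i. b i - of_bool (i \<in> S)) = l"
          by auto
        let ?a = "\<lambda>i\<in>{..<N}. b i - of_bool (i \<in> S)"
        have type: "exponent_type N ?a = l"
          unfolding S(3)[symmetric] by (rule exponent_type_cong) simp
        have "?a i \<le> sum_mset l" if "i < N" for i
          unfolding type[symmetric] sum_mset_exponent_type using that by (intro member_le_sum) auto
        then have "?a \<in> exponents N l"
          using type by (auto simp: exponents_def)
        moreover have "up (S, ?a) = b"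
          using b S(1) by (intro extensionalityI[where A = "{..<N}"])
            (auto simp: up_def compositions_def PiE_def)
        ultimately show "(S, ?a) \<in> {q \<in> P. up q = b}"
          using S by (auto simp: P_def)
      qed
    qed
    then have "card {q \<in> P. up q = b} = card ?L"
      by (rule bij_betw_same_card)
    also have "\<dots> = lowering_count k l (exponent_type N b)"
      unfolding lowering_count_def Let_def by (rule card_lowerings) simp
    finally show ?thesis .
  qed
  have "elementary_sym N k x * monomial_sym N l x = (\<Sum>q\<in>P. ?mon (up q))"
    unfolding elementary_sym_def monomial_sym_exponents sum_product P_def sum.cartesian_product
    by (intro sum.cong) (auto simp: mon)
  also have "\<dots> = (\<Sum>b\<in>compositions N ?n. \<Sum>q\<in>{q \<in> P. up q = b}. ?mon (up q))"
    using finP up_in by (intro sum.group[symmetric]) auto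
  also have "\<dots> = (\<Sum>b\<in>compositions N ?n. int (lowering_count k l (exponent_type N b)) * ?mon b)"
    by (intro sum.cong refl) (simp add: card)
  also have "\<dots> = (\<Sum>r\<in>partitions_of ?n. \<Sum>b\<in>exponents N r. int (lowering_count k l r) * ?mon b)"
    unfolding sum_compositions by (intro sum.cong refl) (simp add: exponents_def)
  finally show ?thesis
    by (simp add: monomial_sym_exponents sum_distrib_left)
qed

text \<open>If \<open>l\<close> has k parts, then the monomial function of \<open>l\<close> is the only term with at most k parts
  in the product of the k-th elementary function and the monomial function of the lowered partition.
  This gives the induction for expressing monomial functions by elementary ones.\<close>

definition lowered :: "nat multiset \<Rightarrow> nat multiset" where
  "lowered l = filter_mset (\<lambda>e. e \<noteq> 0) (image_mset (\<lambda>e. e - 1) l)"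

lemma sum_mset_lowered:
  assumes "0 \<notin># l"
  shows "size l + sum_mset (lowered l) = sum_mset l"
  using assms by (induction l) (auto simp: lowered_def)

lemma exponent_type_length: "exponent_type (length ps) ((!) ps) = filter_mset (\<lambda>e. e \<noteq> 0) (mset ps)"
proof -
  have "mset_set {..<length ps} = mset [0..<length ps]"
    by (simp add: lessThan_atLeast0)
  then have "image_mset ((!) ps) (mset_set {..<length ps}) = mset (map ((!) ps) [0..<length ps])"
    by (simp only: mset_map)
  then show ?thesis
    by (simp add: exponent_type_def map_nth)
qed

text \<open>With at most \<open>size l\<close> parts in r, a set of that many positions exhausts
  them, so all parts are lowered at once; and a partition is determined by its number of parts
  together with its lowered form.\<close>

lemma lowering_count_small:
  assumes "size r \<le> size l" "0 \<notin># r" "0 \<notin># l"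
  shows "lowering_count (size l) (lowered l) r = (if r = l then 1 else 0)"
proof -
  let ?ps = "sorted_list_of_multiset r"
  have len: "length ?ps = size r"
    by (metis mset_sorted_list_of_multiset size_mset)
  let ?A = "{S. S \<subseteq> {..<length ?ps} \<and> card S = size l \<and>
              exponent_type (length ?ps) (\<lambda>j. ?ps ! j - of_bool (j \<in> S)) = lowered l}"
  have type: "exponent_type (length ?ps) (\<lambda>j. ?ps ! j - of_bool (j \<in> {..<length ?ps})) = lowered r"
  proof -
    have "exponent_type (length ?ps) (\<lambda>j. ?ps ! j - of_bool (j \<in> {..<length ?ps}))
        = exponent_type (length (map (\<lambda>e. e - 1) ?ps)) ((!) (map (\<lambda>e. e - 1) ?ps))"
      by (simp, rule exponent_type_cong) simp
    then show ?thesis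
      unfolding exponent_type_length by (simp add: lowered_def)
  qed
  have full: "S = {..<length ?ps} \<and> size r = size l" if "S \<in> ?A" for S
  proof -
    have "card S \<le> length ?ps"
      using that card_mono[of "{..<length ?ps}" S] by auto
    then have "size r = size l" "card S = card {..<length ?ps}"
      using that assms len by auto
    then show ?thesis
      using that card_subset_eq[of "{..<length ?ps}" S] by auto
  qed
  show ?thesis
  proof (cases "r = l")
    case True
    then have "?A = {{..<length ?ps}}"
      using full type len by auto
    then show ?thesis
      using True by (simp add: lowering_count_def Let_def)
  next
    case False
    have "S \<notin> ?A" for S
    proof
      assume S: "S \<in> ?A"
      then have sz: "size r = size l" and low: "lowered r = lowered l"
        using full[OF S] type by auto
      \<comment> \<open>The parts equal to 1 disappear under \<open>lowered\<close>; their number is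
        recovered from the sizes.\<close>
      have split: "image_mset (\<lambda>e. e - 1) M = lowered M + replicate_mset (size M - size (lowered M)) 0"
        for M :: "nat multiset"
      proof -
        let ?I = "image_mset (\<lambda>e. e - 1) M"
        have "?I = lowered M + filter_mset (\<lambda>e. \<not> e \<noteq> 0) ?I"
          unfolding lowered_def by (rule multiset_partition)
        moreover have "filter_mset (\<lambda>e. \<not> e \<noteq> 0) ?I = replicate_mset (count ?I 0) 0"
          by (simp add: filter_eq_replicate_mset)
        moreover have "size ?I = size (lowered M) + count ?I 0"
          using arg_cong[OF calculation(1), of size] calculation(2) by simp
        ultimately show ?thesis
          by simp
      qed
      have "image_mset (\<lambda>e. e - 1) r = image_mset (\<lambda>e. e - 1) l"
        unfolding split using sz low by simp
      then have "image_mset Suc (image_mset (\<lambda>e. e - 1) r) = image_mset Suc (image_mset (\<lambda>e. e - 1) l)"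
        by simp
      moreover have "image_mset Suc (image_mset (\<lambda>e. e - 1) M) = M" if "0 \<notin># M" for M
        using that by (induction M) auto
      ultimately have "r = l"
        using assms by simp
      with False show False
        by simp
    qed
    then have "?A = {}"
      by blast
    then show ?thesis
      using False by (simp add: lowering_count_def Let_def)
  qed
qed

section \<open>Expression by elementary symmetric functions\<close>

definition elementary_expressible :: "nat \<Rightarrow> (nat \<Rightarrow> (nat \<Rightarrow> int) \<Rightarrow> int) \<Rightarrow> bool" where
  "elementary_expressible n F \<longleftrightarrow> (\<exists>q. \<forall>N x. F N x =
     (\<Sum>r\<in>partitions_of n. q r * (\<Prod>k\<in>#r. elementary_sym N k x)))"

lemma elementary_expressible_zero: "elementary_expressible n (\<lambda>_ _. 0)"
  unfolding elementary_expressible_def by (rule exI[of _ "\<lambda>_. 0"]) simp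

lemma elementary_expressible_add:
  assumes "elementary_expressible n F" "elementary_expressible n G"
  shows "elementary_expressible n (\<lambda>N x. F N x + a * G N x)"
proof -
  obtain p q where "\<And>N x. F N x = (\<Sum>r\<in>partitions_of n. p r * (\<Prod>k\<in>#r. elementary_sym N k x))"
    "\<And>N x. G N x = (\<Sum>r\<in>partitions_of n. q r * (\<Prod>k\<in>#r. elementary_sym N k x))"
    using assms by (auto simp: elementary_expressible_def)
  then show ?thesis
    unfolding elementary_expressible_def
    by (intro exI[of _ "\<lambda>r. p r + a * q r"]) (simp add: algebra_simps sum.distrib sum_distrib_left)
qed

lemma elementary_expressible_sum:
  assumes "finite A" "\<And>i. i \<in> A \<Longrightarrow> elementary_expressible n (F i)"
  shows "elementary_expressible n (\<lambda>N x. \<Sum>i\<in>A. a i * F i N x)"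
  using assms
proof (induction A rule: finite_induct)
  case (insert i A)
  then have "elementary_expressible n (\<lambda>N x. (\<Sum>i\<in>A. a i * F i N x) + a i * F i N x)"
    by (intro elementary_expressible_add) auto
  then show ?case
    using insert by (simp add: add.commute)
qed (simp add: elementary_expressible_zero)

text \<open>Adding the part k maps the partitions of n bijectively onto those partitions of k + n
  that contain k; k > 0 because parts are positive. The new coefficients depend on neither N nor x,
  as the choice in \<open>elementary_coeffs\<close> requires.\<close>

lemma elementary_expressible_mult:
  assumes "elementary_expressible n F" "k > 0"
  shows "elementary_expressible (k + n) (\<lambda>N x. elementary_sym N k x * F N x)"
proof -
  obtain q where q: "\<And>N x. F N x = (\<Sum>r\<in>partitions_of n. q r * (\<Prod>k\<in>#r. elementary_sym N k x))"
    using assms by (auto simp: elementary_expressible_def)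
  have "elementary_sym N k x * F N x = (\<Sum>r\<in>partitions_of (k + n).
      (if k \<in># r then q (r - {#k#}) else 0) * (\<Prod>k\<in>#r. elementary_sym N k x))" for N x
  proof -
    have "elementary_sym N k x * F N x
        = (\<Sum>r\<in>partitions_of n. q r * (\<Prod>k\<in>#add_mset k r. elementary_sym N k x))"
      by (simp add: q sum_distrib_left algebra_simps)
    also have "\<dots> = (\<Sum>r\<in>add_mset k ` partitions_of n.
        q (r - {#k#}) * (\<Prod>k\<in>#r. elementary_sym N k x))"
      by (subst sum.reindex) (auto simp: inj_on_def)
    also have "\<dots> = (\<Sum>r\<in>partitions_of (k + n).
      (if k \<in># r then q (r - {#k#}) else 0) * (\<Prod>k\<in>#r. elementary_sym N k x))"
    proof (rule sum.mono_neutral_cong_left)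
      show "add_mset k ` partitions_of n \<subseteq> partitions_of (k + n)"
        using assms(2) by (auto simp: partitions_of_def)
      show "\<forall>r\<in>partitions_of (k + n) - add_mset k ` partitions_of n.
          (if k \<in># r then q (r - {#k#}) else 0) * (\<Prod>k\<in>#r. elementary_sym N k x) = 0"
      proof
        fix r assume r: "r \<in> partitions_of (k + n) - add_mset k ` partitions_of n"
        have "k \<notin># r"
        proof
          assume "k \<in># r"
          then obtain s where "r = add_mset k s"
            by (metis insert_DiffM)
          then show False
            using r by (auto simp: partitions_of_def)
        qed
        then show "(if k \<in># r then q (r - {#k#}) else 0) * (\<Prod>k\<in>#r. elementary_sym N k x) = 0"
          by simp
      qed
    qed auto
    finally show ?thesis .
  qed
  then show ?thesis
    unfolding elementary_expressible_def
    by (intro exI[of _ "\<lambda>r. if k \<in># r then q (r - {#k#}) else 0"]) simp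
qed

lemma monomial_sym_empty: "monomial_sym N {#} x = 1"
proof -
  have "exponents N {#} = {\<lambda>i\<in>{..<N}. 0}"
    by (auto simp: exponents_def exponent_type_support mset_set_empty_iff PiE_def
        intro!: extensionalityI[where A = "{..<N}"])
  then show ?thesis
    by (simp add: monomial_sym_exponents)
qed

lemma monomial_sym_expressible:
  assumes "0 \<notin># l"
  shows "elementary_expressible (sum_mset l) (\<lambda>N x. monomial_sym N l x)"
proof -
  have "\<forall>l\<in>partitions_of n. elementary_expressible n (\<lambda>N x. monomial_sym N l x)" for n
  proof (induction n rule: less_induct)
    case (less n)
    note IH = less.IH
    have "elementary_expressible n (\<lambda>N x. monomial_sym N l x)" if "l \<in> partitions_of n" for l
      using that
    \<comment> \<open>Downwards on the number of parts, which is at most n: the terms to be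
      subtracted from the product have more parts, and the outer induction on the degree handles the
      lowered partition.\<close>
    proof (induction "n - size l" arbitrary: l rule: less_induct)
      case (less l)
      have l: "sum_mset l = n" "0 \<notin># l"
        using less.prems by (auto simp: partitions_of_def)
      show ?case
      proof (cases "l = {#}")
        case True
        have "partitions_of 0 = {{#}}"
          by (auto simp: partitions_of_def) (metis multiset_nonemptyE)
        then show ?thesis
          using True l unfolding elementary_expressible_def
          by (intro exI[of _ "\<lambda>_. 1"]) (auto simp: monomial_sym_empty)
      next
        case False
        define k where "k = size l"
        have k: "k > 0"
          using False by (simp add: k_def nonempty_has_size)
        have kn: "k + sum_mset (lowered l) = n"
          using sum_mset_lowered[OF l(2)] l(1) by (simp add: k_def)
        let ?c = "\<lambda>r. int (lowering_count k (lowered l) r)"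
        have "lowered l \<in> partitions_of (sum_mset (lowered l))"
          by (auto simp: partitions_of_def lowered_def)
        then have "elementary_expressible (k + sum_mset (lowered l))
            (\<lambda>N x. elementary_sym N k x * monomial_sym N (lowered l) x)"
          using k kn IH by (intro elementary_expressible_mult) auto
        then have prod: "elementary_expressible n
            (\<lambda>N x. \<Sum>r\<in>partitions_of n. ?c r * monomial_sym N r x)"
          by (simp add: elementary_monomial_product kn)
        let ?R = "{r \<in> partitions_of n. size r > k}"
        have "elementary_expressible n (\<lambda>N x. \<Sum>r\<in>?R. ?c r * monomial_sym N r x)"
        proof (intro elementary_expressible_sum)
          fix r assume r: "r \<in> ?R"
          have "size r \<le> sum_mset r"
            using sum_mset_lowered[of r] r by (simp add: partitions_of_def)
          then have "n - size r < n - size l"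
            using r by (auto simp: partitions_of_def k_def)
          then show "elementary_expressible n (\<lambda>N x. monomial_sym N r x)"
            using less.hyps r by auto
        qed auto
        then have "elementary_expressible n (\<lambda>N x. (\<Sum>r\<in>partitions_of n. ?c r * monomial_sym N r x)
            + (- 1) * (\<Sum>r\<in>?R. ?c r * monomial_sym N r x))"
          by (rule elementary_expressible_add[OF prod])
        moreover have "(\<Sum>r\<in>partitions_of n. ?c r * monomial_sym N r x)
            + (- 1) * (\<Sum>r\<in>?R. ?c r * monomial_sym N r x) = monomial_sym N l x" for N x
        proof -
          have "(\<Sum>r\<in>partitions_of n. ?c r * monomial_sym N r x)
             = (\<Sum>r\<in>partitions_of n. (if size r > k then ?c r * monomial_sym N r x else 0)
                 + (if r = l then monomial_sym N l x else 0))"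
          proof (intro sum.cong refl)
            fix r assume "r \<in> partitions_of n"
            then have "0 \<notin># r"
              by (simp add: partitions_of_def)
            then show "?c r * monomial_sym N r x = (if size r > k then ?c r * monomial_sym N r x else 0)
                 + (if r = l then monomial_sym N l x else 0)"
              using lowering_count_small[of r l] l(2) by (auto simp: k_def)
          qed
          also have "\<dots> = (\<Sum>r\<in>?R. ?c r * monomial_sym N r x) + monomial_sym N l x"
            using less.prems by (simp add: sum.distrib sum.inter_filter sum.delta)
          finally show ?thesis
            by simp
        qed
        ultimately show ?thesis
          by simp
      qed
    qed
    then show ?case
      by blast
  qed
  moreover have "l \<in> partitions_of (sum_mset l)"
    using assms by (simp add: partitions_of_def)
  ultimately show ?thesis
    by blast
qed

lemma elementary_coeffs:
  assumes "l \<in> partitions_of n"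
  shows "monomial_sym N l x =
     (\<Sum>r\<in>partitions_of n. elementary_coeffs l r * (\<Prod>k\<in>#r. elementary_sym N k x))"
proof -
  have l: "0 \<notin># l" "sum_mset l = n"
    using assms by (auto simp: partitions_of_def)
  have "\<exists>q. \<forall>N x. monomial_sym N l x =
     (\<Sum>r\<in>partitions_of (sum_mset l). q r * (\<Prod>k\<in>#r. elementary_sym N k x))"
    using monomial_sym_expressible[OF l(1)] by (simp add: elementary_expressible_def)
  from someI_ex[OF this] show ?thesis
    unfolding elementary_coeffs_def l(2) by blast
qed

section \<open>Chern polynomials when all classes are powers of one class\<close>

lemma fps_power_nth_compositions:
  fixes s :: "'a::comm_ring_1 fps"
  shows "fps_nth (s ^ N) n = (\<Sum>a\<in>compositions N n. \<Prod>i<N. fps_nth s (a i))"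
proof (induction N arbitrary: n)
  case 0
  have "compositions 0 n = (if n = 0 then {\<lambda>_. undefined} else {})"
    by (auto simp: compositions_def)
  then show ?case
    by simp
next
  case (Suc N)
  have "fps_nth (s ^ Suc N) n = (\<Sum>j=0..n. fps_nth (s ^ N) j * fps_nth s (n - j))"
    by (simp only: power_Suc2 fps_mult_nth)
  also have "\<dots> = (\<Sum>(j, a)\<in>Sigma {0..n} (compositions N). (\<Prod>i<N. fps_nth s (a i)) * fps_nth s (n - j))"
    by (simp add: Suc sum_distrib_right sum.Sigma)
  also have "\<dots> = (\<Sum>b\<in>compositions (Suc N) n. \<Prod>i<Suc N. fps_nth s (b i))"
  \<comment> \<open>The last entry of a composition is what the first N leave over, n - j.\<close>
  proof (rule sum.reindex_bij_witness[where i = "\<lambda>b. (\<Sum>i<N. b i, restrict b {..<N})"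
        and j = "\<lambda>(j, a). a(N := n - j)"])
    fix q assume "q \<in> Sigma {0..n} (compositions N)"
    then obtain j a where q: "q = (j, a)" "j \<le> n" "a \<in> compositions N j"
      by auto
    have eq: "(\<Sum>i<N. (a(N := n - j)) i) = (\<Sum>i<N. a i)"
      by (intro sum.cong) auto
    have "restrict (a(N := n - j)) {..<N} = a"
      using q(3) by (intro extensionalityI[where A = "{..<N}"]) (auto simp: compositions_def PiE_def)
    then show "(\<Sum>i<N. (case q of (j, a) \<Rightarrow> a(N := n - j)) i,
        restrict (case q of (j, a) \<Rightarrow> a(N := n - j)) {..<N}) = q"
      using q eq by (simp add: compositions_def)
    show "(case q of (j, a) \<Rightarrow> a(N := n - j)) \<in> compositions (Suc N) n"
      using q eq by (auto simp: compositions_def PiE_def extensional_def Pi_def less_Suc_eq)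
    show "(\<Prod>i<Suc N. fps_nth s ((case q of (j, a) \<Rightarrow> a(N := n - j)) i)) =
        (case q of (j, a) \<Rightarrow> (\<Prod>i<N. fps_nth s (a i)) * fps_nth s (n - j))"
      by (simp add: q)
  next
    fix b assume b: "b \<in> compositions (Suc N) n"
    then have tot: "(\<Sum>i<N. b i) + b N = n"
      by (simp add: compositions_def)
    have le: "b i \<le> (\<Sum>i<N. b i)" if "i < N" for i
      using that by (intro member_le_sum) auto
    show "(case (\<Sum>i<N. b i, restrict b {..<N}) of (j, a) \<Rightarrow> a(N := n - j)) = b"
      using tot b by (intro extensionalityI[where A = "{..<Suc N}"])
        (auto simp: compositions_def PiE_def extensional_def less_Suc_eq)
    show "(\<Sum>i<N. b i, restrict b {..<N}) \<in> Sigma {0..n} (compositions N)"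
      using tot b le by (auto simp: compositions_def)
  qed
  finally show ?case .
qed

text \<open>The monomial Chern polynomial as a function of the coefficients of the total Chern class,
  evaluated as if the cohomology ring were generated by one class.\<close>

definition chern_poly :: "(nat \<Rightarrow> int) \<Rightarrow> nat \<Rightarrow> int tpoly" where
  "chern_poly \<beta> n = (\<Sum>l\<in>partitions_of n.
     of_int (\<Sum>r\<in>partitions_of n. elementary_coeffs l r * (\<Prod>k\<in>#r. \<beta> k)) * (\<Prod>k\<in>#l. tvar k))"

lemma elementary_sym_one: "elementary_sym N k (\<lambda>_. 1) = int (N choose k)"
  by (simp add: elementary_sym_def n_subsets)

lemma prod_mset_exponent_type:
  "(\<Prod>k\<in>#exponent_type N a. tvar k) = (\<Prod>i<N. fps_nth tseries (a i))"
proof -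
  have "(\<Prod>k\<in>#filter_mset (\<lambda>e. e \<noteq> 0) M. tvar k) = (\<Prod>k\<in>#M. fps_nth tseries k)" for M
    by (induction M) (auto simp: tseries_nth)
  then show ?thesis
    by (simp add: exponent_type_def prod_unfold_prod_mset multiset.map_comp o_def)
qed

text \<open>The binomial coefficients are the elementary symmetric functions at N ones, where the
  monomial function of l counts the exponent vectors of type l. Summing these counts against the
  monomials in t expands the N-th power of T.\<close>

lemma chern_poly_binomial: "chern_poly (\<lambda>k. int (N choose k)) n = fps_nth (tseries ^ N) n"
proof -
  have "chern_poly (\<lambda>k. int (N choose k)) n
      = (\<Sum>l\<in>partitions_of n. of_int (monomial_sym N l (\<lambda>_. 1)) * (\<Prod>k\<in>#l. tvar k))"
    unfolding chern_poly_def
    by (intro sum.cong refl) (simp only: elementary_coeffs elementary_sym_one)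
  also have "\<dots> = (\<Sum>l\<in>partitions_of n. \<Sum>a\<in>exponents N l. \<Prod>k\<in>#l. tvar k)"
    by (simp add: monomial_sym_exponents)
  also have "\<dots> = (\<Sum>l\<in>partitions_of n. \<Sum>a\<in>exponents N l. \<Prod>i<N. fps_nth tseries (a i))"
    by (intro sum.cong refl) (auto simp: exponents_def prod_mset_exponent_type)
  finally show ?thesis
    by (simp only: sum_compositions[symmetric] fps_power_nth_compositions)
qed

section \<open>Congruences between Chern polynomials\<close>

lemma dvd_diff_prod_mset:
  fixes \<beta> \<gamma> :: "'b \<Rightarrow> 'a::comm_ring_1"
  assumes "\<And>k. k \<in># r \<Longrightarrow> K dvd \<beta> k - \<gamma> k"
  shows "K dvd (\<Prod>k\<in>#r. \<beta> k) - (\<Prod>k\<in>#r. \<gamma> k)"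
  using assms
proof (induction r)
  case (add k r)
  have "\<beta> k * (\<Prod>k\<in>#r. \<beta> k) - \<gamma> k * (\<Prod>k\<in>#r. \<gamma> k)
      = (\<beta> k - \<gamma> k) * (\<Prod>k\<in>#r. \<beta> k) + \<gamma> k * ((\<Prod>k\<in>#r. \<beta> k) - (\<Prod>k\<in>#r. \<gamma> k))"
    by (simp add: algebra_simps)
  moreover have "K dvd \<beta> k - \<gamma> k" "K dvd (\<Prod>k\<in>#r. \<beta> k) - (\<Prod>k\<in>#r. \<gamma> k)"
    using add by auto
  ultimately show ?case
    by simp
qed simp

lemma partitions_of_le:
  assumes "r \<in> partitions_of n" "k \<in># r"
  shows "k \<le> n"
  using assms by (auto simp: partitions_of_def dest: multi_member_split)

text \<open>The coefficients are integer polynomials in \<beta> 1, ..., \<beta> n, the parts of a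
  partition of n being at most n.\<close>

lemma chern_poly_cong_mod:
  assumes "\<And>k. k \<le> n \<Longrightarrow> K dvd \<beta> k - \<gamma> k"
  shows "of_int K dvd chern_poly \<beta> n - chern_poly \<gamma> n"
proof -
  have "chern_poly \<beta> n - chern_poly \<gamma> n = (\<Sum>l\<in>partitions_of n.
      of_int (\<Sum>r\<in>partitions_of n. elementary_coeffs l r * ((\<Prod>k\<in>#r. \<beta> k) - (\<Prod>k\<in>#r. \<gamma> k))) *
      (\<Prod>k\<in>#l. tvar k))"
    unfolding chern_poly_def
    by (simp add: sum_subtractf[symmetric] left_diff_distrib[symmetric] right_diff_distrib
        del: of_int_sum of_int_mult)
       (simp add: sum_subtractf left_diff_distrib)
  moreover have dvd: "K dvd (\<Sum>r\<in>partitions_of n. elementary_coeffs l r * ((\<Prod>k\<in>#r. \<beta> k) - (\<Prod>k\<in>#r. \<gamma> k)))" for l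
    using assms by (intro dvd_sum dvd_mult dvd_diff_prod_mset) (auto dest: partitions_of_le)
  then have "(of_int K :: int tpoly) dvd
      of_int (\<Sum>r\<in>partitions_of n. elementary_coeffs l r * ((\<Prod>k\<in>#r. \<beta> k) - (\<Prod>k\<in>#r. \<gamma> k)))" for l
  proof -
    obtain c where "(\<Sum>r\<in>partitions_of n. elementary_coeffs l r * ((\<Prod>k\<in>#r. \<beta> k) - (\<Prod>k\<in>#r. \<gamma> k))) = K * c"
      using dvd[of l] by (elim dvdE)
    then show ?thesis
      by (simp only: of_int_mult dvd_triv_left)
  qed
  ultimately show ?thesis
    by (simp only:) (intro dvd_sum dvd_mult2)
qed

text \<open>From k (M choose k) = M (M - 1 choose k - 1): as k divides n!, the factor k can be
  cancelled while K is kept. This is the reason for the factor n! in M.\<close>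

lemma dvd_choose_multiple_fact:
  assumes "0 < k" "k \<le> n"
  shows "K dvd (K * fact n choose k)"
proof (cases "K = 0")
  case True
  then show ?thesis
    using assms by simp
next
  case False
  define M where "M = K * (fact n :: nat)"
  have "k dvd fact n"
    using assms by (intro dvd_fact) auto
  then obtain c where c: "fact n = k * c"
    by (elim dvdE)
  have "M > 0"
    using False by (simp add: M_def)
  then obtain M' where M': "M = Suc M'"
    using gr0_implies_Suc by blast
  obtain k' where k': "k = Suc k'"
    using assms gr0_implies_Suc by blast
  have "k * (M choose k) = k * (K * c * (M' choose k'))"
  proof -
    have "k * (M choose k) = M * (M' choose k')"
      unfolding k' M' by (rule Suc_times_binomial)
    also have "\<dots> = k * (K * c * (M' choose k'))"
      unfolding M_def c by (simp only: mult_ac)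
    finally show ?thesis .
  qed
  then have "M choose k = K * (c * (M' choose k'))"
    using assms by simp
  then show ?thesis
    by (simp add: M_def)
qed

text \<open>An integer coefficient divisible by a number larger than its absolute value is
  0.\<close>

lemma int_tpoly_eq_0_if_divisible:
  fixes p :: "int tpoly"
  assumes "\<And>K. K \<ge> N \<Longrightarrow> of_int (int K) dvd p"
  shows "p = 0"
proof (rule poly_mapping_eqI)
  fix s
  let ?c = "Poly_Mapping.lookup p s"
  define K where "K = N + nat \<bar>?c\<bar> + 1"
  have "of_int (int K) dvd p"
    by (rule assms) (simp add: K_def)
  then obtain q where "p = of_int (int K) * q"
    by (elim dvdE)
  moreover have "Poly_Mapping.lookup (of_int z * q) s = z * Poly_Mapping.lookup q s" for z
  proof -
    have "of_int z = (Poly_Mapping.single 0 z :: int tpoly)"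
      by (metis of_int_eq_id id_apply single_of_int)
    then have "of_int z * q = Poly_Mapping.map ((*) z) q"
      by (simp only: mult_map_scale_conv_mult)
    then show ?thesis
      by (simp add: Poly_Mapping.map.rep_eq when_def)
  qed
  ultimately have "int K dvd ?c"
    by (metis dvd_triv_left)
  moreover have "\<bar>?c\<bar> < int K"
    by (simp add: K_def)
  ultimately show "Poly_Mapping.lookup p s = Poly_Mapping.lookup 0 s"
    using dvd_imp_le_int[of ?c "int K"] by (cases "?c = 0") auto
qed

text \<open>Modulo \<open>K\<close> and in degrees up to \<open>n\<close>, the series \<open>(1 + h)\<^sup>M\<close> with
  \<open>M = K n!\<close> is 1, so the inverse of \<open>(1 + h)\<^sup>N\<close> may be replaced by the honest
  power \<open>(1 + h)\<^sup>M\<^sup>-\<^sup>N\<close>.\<close>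

lemma chern_poly_inverse:
  assumes \<beta>: "\<And>k. (\<Sum>i\<le>k. int (N choose i) * \<beta> (k - i)) = of_bool (k = 0)"
  shows "chern_poly \<beta> n = fps_nth (tseries_inv ^ N) n"
proof -
  have "of_int (int K) dvd chern_poly \<beta> n - fps_nth (tseries_inv ^ N) n" if K: "K \<ge> N + 1" for K
  proof -
    define M where "M = K * (fact n :: nat)"
    have MN: "M \<ge> N"
      using K by (simp add: M_def trans_le_add1) (metis Suc_leD fact_ge_1 le_trans mult.right_neutral mult_le_mono2)
    define \<gamma> where "\<gamma> = (\<lambda>k. int (M - N choose k))"
    have M: "int K dvd int (M choose k) - int (0 choose k)" if "k \<le> n" for k
      using dvd_choose_multiple_fact[of k n K] that by (cases "k = 0") (auto simp: M_def binomial_eq_0)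
    have vandermonde: "int (M choose k) = (\<Sum>i\<le>k. int (N choose i) * \<gamma> (k - i))" for k
      using vandermonde[of N "M - N" k] MN by (simp add: \<gamma>_def) (simp add: of_nat_mult[symmetric] of_nat_sum[symmetric] del: of_nat_mult of_nat_sum)
    \<comment> \<open>Modulo K, both \<beta> and \<gamma> solve the same convolution equation, and
      its coefficient at i = 0 is 1, so it determines them degree by degree.\<close>
    have "int K dvd \<beta> k - \<gamma> k" if "k \<le> n" for k
      using that
    proof (induction k rule: less_induct)
      case (less k)
      have "(\<Sum>i\<le>k. int (N choose i) * (\<beta> (k - i) - \<gamma> (k - i))) = of_bool (k = 0) - int (M choose k)"
        by (simp add: right_diff_distrib sum_subtractf \<beta> vandermonde)
      then have "int K dvd (\<Sum>i\<le>k. int (N choose i) * (\<beta> (k - i) - \<gamma> (k - i)))"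
        using M[OF less.prems] by (cases "k = 0") (auto simp: binomial_eq_0)
      moreover have "(\<Sum>i\<le>k. int (N choose i) * (\<beta> (k - i) - \<gamma> (k - i)))
          = (\<beta> k - \<gamma> k) + (\<Sum>i\<in>{..k} - {0}. int (N choose i) * (\<beta> (k - i) - \<gamma> (k - i)))"
        by (subst sum.remove[of _ 0]) auto
      moreover have "int K dvd (\<Sum>i\<in>{..k} - {0}. int (N choose i) * (\<beta> (k - i) - \<gamma> (k - i)))"
        using less by (intro dvd_sum dvd_mult) auto
      ultimately show ?case
        by (simp add: dvd_add_left_iff)
    qed
    then have "of_int (int K) dvd chern_poly \<beta> n - chern_poly \<gamma> n"
      by (rule chern_poly_cong_mod)
    moreover have "chern_poly \<gamma> n = fps_nth (tseries ^ (M - N)) n"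
      unfolding \<gamma>_def by (rule chern_poly_binomial)
    moreover have "of_int (int K) dvd fps_nth (tseries ^ (M - N)) n - fps_nth (tseries_inv ^ N) n"
    proof -
      \<comment> \<open>The M-th power of T belongs to the classes M choose k, which agree modulo K
        with 0 choose k, and these belong to the zeroth power.\<close>
      have pow: "of_int (int K) dvd fps_nth (tseries ^ M) j - fps_nth 1 j" if "j \<le> n" for j
        using chern_poly_cong_mod[of j "int K" "\<lambda>k. int (M choose k)" "\<lambda>k. int (0 choose k)"] M that
        unfolding chern_poly_binomial by simp
      have "tseries ^ M = tseries ^ (M - N) * tseries ^ N"
        using MN by (simp add: power_add[symmetric])
      then have "tseries ^ M * tseries_inv ^ N = tseries ^ (M - N) * (tseries * tseries_inv) ^ N"
        by (simp add: power_mult_distrib mult.assoc)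
      then have "tseries ^ (M - N) - tseries_inv ^ N = (tseries ^ M - 1) * tseries_inv ^ N"
        by (simp add: tseries_mult_inv left_diff_distrib)
      then have "fps_nth (tseries ^ (M - N)) n - fps_nth (tseries_inv ^ N) n
          = fps_nth ((tseries ^ M - 1) * tseries_inv ^ N) n"
        by (metis fps_sub_nth)
      also have "\<dots> = (\<Sum>j=0..n. (fps_nth (tseries ^ M) j - fps_nth 1 j) * fps_nth (tseries_inv ^ N) (n - j))"
        by (simp only: fps_mult_nth fps_sub_nth)
      finally show ?thesis
        using pow by (simp only:) (intro dvd_sum dvd_mult2, simp)
    qed
    ultimately have "of_int (int K) dvd (chern_poly \<beta> n - chern_poly \<gamma> n)
        + (chern_poly \<gamma> n - fps_nth (tseries_inv ^ N) n)"
      by (simp only: dvd_add)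
    then show ?thesis
      by (simp only: diff_add_cancel add_diff_eq)
  qed
  then have "chern_poly \<beta> n - fps_nth (tseries_inv ^ N) n = 0"
    by (rule int_tpoly_eq_0_if_divisible)
  then show ?thesis
    by simp
qed

section \<open>Cup products of singular cochains\<close>

lemma cochain_eval_0 [simp]: "cochain_eval \<phi> 0 = 0"
  by (simp add: cochain_eval_def)

lemma cochain_eval_superset:
  assumes "finite S" "Poly_Mapping.keys c \<subseteq> S"
  shows "cochain_eval \<phi> c = (\<Sum>\<sigma>\<in>S. Poly_Mapping.lookup c \<sigma> * \<phi> \<sigma>)"
  unfolding cochain_eval_def using assms
  by (intro sum.mono_neutral_left) (auto simp: in_keys_iff)

lemma cochain_eval_add: "cochain_eval \<phi> (c + d) = cochain_eval \<phi> c + cochain_eval \<phi> d"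
proof -
  let ?S = "Poly_Mapping.keys c \<union> Poly_Mapping.keys d"
  have "finite ?S" "Poly_Mapping.keys (c + d) \<subseteq> ?S"
    using keys_add[of c d] by auto
  then show ?thesis
    using cochain_eval_superset[of ?S c \<phi>] cochain_eval_superset[of ?S d \<phi>]
      cochain_eval_superset[of ?S "c + d" \<phi>]
    by (simp add: lookup_add algebra_simps sum.distrib)
qed

lemma cochain_eval_cmul: "cochain_eval \<phi> (frag_cmul k c) = k * cochain_eval \<phi> c"
  using cochain_eval_superset[of "Poly_Mapping.keys c" "frag_cmul k c" \<phi>] keys_cmul[of k c]
  by (simp add: cochain_eval_def[of _ c] sum_distrib_left mult.assoc)

lemma cochain_eval_diff: "cochain_eval \<phi> (c - d) = cochain_eval \<phi> c - cochain_eval \<phi> d"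
proof -
  have "c - d = c + frag_cmul (- 1) d"
    by simp
  then show ?thesis
    by (simp only: cochain_eval_add cochain_eval_cmul)
qed

lemma cochain_eval_sum: "cochain_eval \<phi> (sum f A) = (\<Sum>i\<in>A. cochain_eval \<phi> (f i))"
  by (induction A rule: infinite_finite_induct) (auto simp: cochain_eval_add)

lemma cochain_eval_frag_of [simp]: "cochain_eval \<phi> (frag_of \<sigma>) = \<phi> \<sigma>"
  by (simp add: cochain_eval_def)

lemma cochain_eval_cong:
  assumes "\<And>\<sigma>. \<sigma> \<in> Poly_Mapping.keys c \<Longrightarrow> \<phi> \<sigma> = \<psi> \<sigma>"
  shows "cochain_eval \<phi> c = cochain_eval \<psi> c"
  using assms by (simp add: cochain_eval_def)

lemma cochain_eval_linear:
  "cochain_eval (\<lambda>\<sigma>. a * \<phi> \<sigma> + b * \<psi> \<sigma>) c = a * cochain_eval \<phi> c + b * cochain_eval \<psi> c"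
  by (simp add: cochain_eval_def algebra_simps sum.distrib sum_distrib_left)

text \<open>The index is the degree of the result, so the argument has degree p - 1. For p = 0 the
  result is 0, and cohomologous 0-cochains agree on all simplices.\<close>

definition coboundary :: "nat \<Rightarrow> 'p cochain \<Rightarrow> 'p cochain" where
  "coboundary p \<phi> \<sigma> = cochain_eval \<phi> (chain_boundary p (frag_of \<sigma>))"

lemma coboundary_0 [simp]: "coboundary 0 \<phi> \<sigma> = 0"
  by (simp add: coboundary_def chain_boundary_of)

lemma coboundary_Suc:
  "coboundary (Suc p) \<phi> \<sigma> = (\<Sum>k\<le>Suc p. (- 1) ^ k * \<phi> (singular_face (Suc p) k \<sigma>))"
  by (simp add: coboundary_def chain_boundary_of cochain_eval_sum cochain_eval_cmul cochain_eval_add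
      del: sum.atMost_Suc)

lemma coboundary_linear:
  "coboundary p (\<lambda>\<sigma>. a * \<phi> \<sigma> + b * \<psi> \<sigma>) \<sigma> = a * coboundary p \<phi> \<sigma> + b * coboundary p \<psi> \<sigma>"
  by (simp add: coboundary_def cochain_eval_linear)

lemma cocycle_coboundary:
  "cocycle p X \<phi> \<longleftrightarrow> (\<forall>\<sigma>. singular_simplex (Suc p) X \<sigma> \<longrightarrow> coboundary (Suc p) \<phi> \<sigma> = 0)"
  by (simp add: cocycle_def coboundary_def)

lemma cohomologous_coboundary:
  "cohomologous p X \<phi> \<psi> \<longleftrightarrow>
     (\<exists>\<theta>. \<forall>\<sigma>. singular_simplex p X \<sigma> \<longrightarrow> \<phi> \<sigma> - \<psi> \<sigma> = coboundary p \<theta> \<sigma>)"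
  by (simp add: cohomologous_def coboundary_def)

lemma cochain_eval_chain_boundary:
  "cochain_eval \<theta> (chain_boundary p c) = cochain_eval (coboundary p \<theta>) c"
proof -
  have "c \<in> UNIV \<Longrightarrow> ?thesis"
    using subset_UNIV
    by (induction c rule: frag_induction)
       (simp_all add: coboundary_def chain_boundary_diff cochain_eval_diff)
  then show ?thesis
    by simp
qed

text \<open>Evaluating a coboundary on a cycle means evaluating a cochain on its boundary, which is
  0.\<close>

lemma cochain_eval_cohomologous:
  assumes "cohomologous p X \<phi> \<psi>" "singular_relcycle p X {} c"
  shows "cochain_eval \<phi> c = cochain_eval \<psi> c"
proof -
  obtain \<theta> where \<theta>: "\<And>\<sigma>. singular_simplex p X \<sigma> \<Longrightarrow> \<phi> \<sigma> - \<psi> \<sigma> = coboundary p \<theta> \<sigma>"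
    using assms(1) by (auto simp: cohomologous_coboundary)
  have c: "singular_chain p X c" "chain_boundary p c = 0"
    using assms(2) by (auto simp: singular_cycle)
  have "cochain_eval \<phi> c - cochain_eval \<psi> c = cochain_eval (\<lambda>\<sigma>. \<phi> \<sigma> - \<psi> \<sigma>) c"
    using cochain_eval_linear[of 1 \<phi> "-1" \<psi> c] by simp
  also have "\<dots> = cochain_eval (coboundary p \<theta>) c"
    using c(1) \<theta> by (intro cochain_eval_cong) (auto simp: singular_chain_def)
  also have "\<dots> = 0"
    using c(2) by (simp flip: cochain_eval_chain_boundary)
  finally show ?thesis
    by simp
qed

lemma cohomologous_eqI:
  assumes "\<And>\<sigma>. singular_simplex p X \<sigma> \<Longrightarrow> \<phi> \<sigma> = \<psi> \<sigma>"
  shows "cohomologous p X \<phi> \<psi>"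
  unfolding cohomologous_coboundary using assms
  by (intro exI[of _ "\<lambda>_. 0"]) (simp add: coboundary_def cochain_eval_def)

lemma cohomologous_refl [simp]: "cohomologous p X \<phi> \<phi>"
  by (rule cohomologous_eqI) simp

lemma cohomologous_linear:
  assumes "cohomologous p X \<phi> \<phi>'" "cohomologous p X \<psi> \<psi>'"
  shows "cohomologous p X (\<lambda>\<sigma>. a * \<phi> \<sigma> + b * \<psi> \<sigma>) (\<lambda>\<sigma>. a * \<phi>' \<sigma> + b * \<psi>' \<sigma>)"
proof -
  obtain \<theta> where \<theta>: "\<And>\<sigma>. singular_simplex p X \<sigma> \<Longrightarrow> \<phi> \<sigma> - \<phi>' \<sigma> = coboundary p \<theta> \<sigma>"
    using assms(1) by (auto simp: cohomologous_coboundary)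
  obtain \<eta> where \<eta>: "\<And>\<sigma>. singular_simplex p X \<sigma> \<Longrightarrow> \<psi> \<sigma> - \<psi>' \<sigma> = coboundary p \<eta> \<sigma>"
    using assms(2) by (auto simp: cohomologous_coboundary)
  have "(a * \<phi> \<sigma> + b * \<psi> \<sigma>) - (a * \<phi>' \<sigma> + b * \<psi>' \<sigma>) = coboundary p (\<lambda>\<sigma>. a * \<theta> \<sigma> + b * \<eta> \<sigma>) \<sigma>"
    if "singular_simplex p X \<sigma>" for \<sigma>
    unfolding coboundary_linear \<theta>[OF that, symmetric] \<eta>[OF that, symmetric] by (simp add: algebra_simps)
  then show ?thesis
    unfolding cohomologous_coboundary by blast
qed

lemma cohomologous_trans:
  assumes "cohomologous p X \<phi> \<psi>" "cohomologous p X \<psi> \<xi>"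
  shows "cohomologous p X \<phi> \<xi>"
  using cohomologous_linear[OF assms, of 1 1] by (simp add: cohomologous_def)

lemma cohomologous_sym:
  assumes "cohomologous p X \<phi> \<psi>"
  shows "cohomologous p X \<psi> \<phi>"
  using cohomologous_linear[OF assms assms, of "- 1" 0] by (simp add: cohomologous_def)

lemma cohomologous_sum:
  assumes "finite A" "\<And>i. i \<in> A \<Longrightarrow> cohomologous p X (\<phi> i) (\<psi> i)"
  shows "cohomologous p X (\<lambda>\<sigma>. \<Sum>i\<in>A. a i * \<phi> i \<sigma>) (\<lambda>\<sigma>. \<Sum>i\<in>A. a i * \<psi> i \<sigma>)"
  using assms
proof (induction A rule: finite_induct)
  case (insert i A)
  then have "cohomologous p X (\<lambda>\<sigma>. a i * \<phi> i \<sigma> + 1 * (\<Sum>i\<in>A. a i * \<phi> i \<sigma>))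
      (\<lambda>\<sigma>. a i * \<psi> i \<sigma> + 1 * (\<Sum>i\<in>A. a i * \<psi> i \<sigma>))"
    by (intro cohomologous_linear) auto
  then show ?case
    using insert by simp
qed simp

lemma cocycle_scale:
  assumes "cocycle p X \<phi>"
  shows "cocycle p X (\<lambda>\<sigma>. a * \<phi> \<sigma>)"
  using assms coboundary_linear[of "Suc p" a \<phi> 0 \<phi>] by (simp add: cocycle_coboundary)

section \<open>Front and back faces of simplices\<close>

definition shift_simplex :: "nat \<Rightarrow> (nat \<Rightarrow> real) \<Rightarrow> nat \<Rightarrow> real" where
  "shift_simplex p x = (\<lambda>i. if i < p then 0 else x (i - p))"

lemma back_face_shift: "back_face p q \<sigma> = restrict (\<sigma> \<circ> shift_simplex p) (standard_simplex q)"
  by (simp add: back_face_def shift_simplex_def o_def)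

lemma shift_simplex_standard:
  assumes "x \<in> standard_simplex q"
  shows "shift_simplex p x \<in> standard_simplex (p + q)"
proof -
  have "(\<Sum>i\<le>p + q. shift_simplex p x i) = (\<Sum>i\<in>{p..p + q}. x (i - p))"
    by (rule sum.mono_neutral_cong_right) (auto simp: shift_simplex_def)
  also have "\<dots> = (\<Sum>i\<le>q. x i)"
    by (rule sum.reindex_bij_witness[of _ "\<lambda>i. i + p" "\<lambda>i. i - p"]) auto
  finally show ?thesis
    using assms by (auto simp: standard_simplex_def shift_simplex_def)
qed

lemma singular_simplex_front_face:
  assumes "singular_simplex (p + q) X \<sigma>"
  shows "singular_simplex p X (front_face p \<sigma>)"
  using assms standard_simplex_mono[of p "p + q"]
  by (auto simp: singular_simplex_def front_face_def subtopology_subtopology Int_absorb1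
      dest: continuous_map_from_subtopology[of _ _ _ "standard_simplex p"])

lemma singular_simplex_back_face:
  assumes "singular_simplex (p + q) X \<sigma>"
  shows "singular_simplex q X (back_face p q \<sigma>)"
proof -
  have "continuous_map (powertop_real UNIV) (powertop_real UNIV) (shift_simplex p)"
    unfolding continuous_map_componentwise_UNIV
  proof
    fix k
    show "continuous_map (powertop_real UNIV) euclideanreal (\<lambda>x. shift_simplex p x k)"
      by (cases "k < p") (auto simp: shift_simplex_def intro: continuous_map_product_projection)
  qed
  then have "continuous_map (subtopology (powertop_real UNIV) (standard_simplex q))
      (subtopology (powertop_real UNIV) (standard_simplex (p + q))) (shift_simplex p)"
    using shift_simplex_standard
    by (auto simp: continuous_map_in_subtopology continuous_map_from_subtopology)
  then have "continuous_map (subtopology (powertop_real UNIV) (standard_simplex q)) X (\<sigma> \<circ> shift_simplex p)"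
    using assms continuous_map_compose by (auto simp: singular_simplex_def)
  then show ?thesis
    by (simp add: singular_simplex_def back_face_shift)
qed

lemma front_face_singular_simplex:
  assumes "singular_simplex p X \<sigma>"
  shows "front_face p \<sigma> = \<sigma>"
  using assms by (simp add: singular_simplex_def front_face_def extensional_restrict)

lemma back_face_singular_simplex:
  assumes "singular_simplex p X \<sigma>"
  shows "back_face 0 p \<sigma> = \<sigma>"
  using assms by (simp add: singular_simplex_def back_face_def extensional_restrict)

lemma simplical_face_standard:
  assumes "x \<in> standard_simplex p" "k \<le> Suc p"
  shows "simplical_face k x \<in> standard_simplex (Suc p)"
  using simplical_face_in_standard_simplex[of "Suc p" k x] assms by simp

text \<open>Together with the next three identities this tells how deleting vertex k interacts with
  the front p-face and the back q-face. The cases overlap at k = p + 1 for the front and at k = p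
  for the back, and the overlaps produce the cancelling terms in the Leibniz rule.\<close>

lemma front_face_singular_face_le:
  assumes "k \<le> Suc p"
  shows "front_face p (singular_face (Suc (p + q)) k \<sigma>) = singular_face (Suc p) k (front_face (Suc p) \<sigma>)"
proof
  fix x
  show "front_face p (singular_face (Suc (p + q)) k \<sigma>) x = singular_face (Suc p) k (front_face (Suc p) \<sigma>) x"
  proof (cases "x \<in> standard_simplex p")
    case True
    then have "x \<in> standard_simplex (p + q)" "simplical_face k x \<in> standard_simplex (Suc p)"
      using standard_simplex_mono[of p "p + q"] simplical_face_standard assms by auto
    then show ?thesis
      using True by (simp add: front_face_def singular_face_def)
  qed (simp add: front_face_def singular_face_def)
qed

lemma front_face_singular_face_gt:
  assumes "p < k"
  shows "front_face p (singular_face (Suc (p + q)) k \<sigma>) = front_face p \<sigma>"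
proof
  fix x
  show "front_face p (singular_face (Suc (p + q)) k \<sigma>) x = front_face p \<sigma> x"
  proof (cases "x \<in> standard_simplex p")
    case True
    have "x i = 0" if "i > p" for i
      using True that by (simp add: standard_simplex_def)
    then have "simplical_face k x = x"
      using assms by (auto simp: simplical_face_def)
    moreover have "x \<in> standard_simplex (p + q)"
      using True standard_simplex_mono[of p "p + q"] by auto
    ultimately show ?thesis
      using True by (simp add: front_face_def singular_face_def)
  qed (simp add: front_face_def)
qed

lemma back_face_singular_face_le:
  assumes "k \<le> p"
  shows "back_face p q (singular_face (Suc (p + q)) k \<sigma>) = back_face (Suc p) q \<sigma>"
proof
  fix x
  have "simplical_face k (shift_simplex p x) = shift_simplex (Suc p) x"
    using assms by (auto simp: simplical_face_def shift_simplex_def fun_eq_iff)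
  then show "back_face p q (singular_face (Suc (p + q)) k \<sigma>) x = back_face (Suc p) q \<sigma> x"
    using shift_simplex_standard[of x q p] by (auto simp: back_face_shift singular_face_def)
qed

lemma back_face_singular_face_ge:
  assumes "j \<le> Suc q"
  shows "back_face p q (singular_face (Suc (p + q)) (p + j) \<sigma>) = singular_face (Suc q) j (back_face p (Suc q) \<sigma>)"
proof
  fix x
  have "simplical_face (p + j) (shift_simplex p x) = shift_simplex p (simplical_face j x)"
    by (auto simp: simplical_face_def shift_simplex_def fun_eq_iff)
  then show "back_face p q (singular_face (Suc (p + q)) (p + j) \<sigma>) x
      = singular_face (Suc q) j (back_face p (Suc q) \<sigma>) x"
    using shift_simplex_standard[of x q p] simplical_face_standard[of x q j] assms
    by (auto simp: back_face_shift singular_face_def)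
qed

text \<open>The faces up to p act on the front, the others on the back. The last face in the
  coboundary of \<phi> and the first one in that of \<psi> both contribute
  \<open>\<phi> ?F * \<psi> ?B\<close>, with opposite signs.\<close>

lemma coboundary_cup:
  "coboundary (Suc (p + q)) (cup p q \<phi> \<psi>) \<sigma>
     = cup (Suc p) q (coboundary (Suc p) \<phi>) \<psi> \<sigma>
       + (- 1) ^ p * cup p (Suc q) \<phi> (coboundary (Suc q) \<psi>) \<sigma>"
proof -
  let ?n = "Suc (p + q)"
  let ?F = "front_face p \<sigma>" and ?F' = "front_face (Suc p) \<sigma>"
    and ?B = "back_face (Suc p) q \<sigma>" and ?B' = "back_face p (Suc q) \<sigma>"
  let ?c = "\<lambda>k. (- 1) ^ k * cup p q \<phi> \<psi> (singular_face ?n k \<sigma>)"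
  have split: "{..?n} = {..p} \<union> (\<lambda>j. p + Suc j) ` {..q}"
  proof -
    have "k \<in> (\<lambda>j. p + Suc j) ` {..q}" if "p < k" "k \<le> ?n" for k
      using that by (intro image_eqI[of _ _ "k - Suc p"]) auto
    then have "{..?n} \<subseteq> {..p} \<union> (\<lambda>j. p + Suc j) ` {..q}"
      by (meson UnI1 UnI2 atMost_iff linorder_not_less subsetI)
    then show ?thesis
      by auto
  qed
  have "coboundary ?n (cup p q \<phi> \<psi>) \<sigma> = (\<Sum>k\<le>p. ?c k) + (\<Sum>j\<le>q. ?c (p + Suc j))"
    unfolding coboundary_Suc split
    by (subst sum.union_disjoint) (auto simp: sum.reindex inj_on_def)
  also have "(\<Sum>k\<le>p. ?c k) = (\<Sum>k\<le>p. (- 1) ^ k * \<phi> (singular_face (Suc p) k ?F')) * \<psi> ?B"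
    unfolding sum_distrib_right
    by (intro sum.cong refl) (simp add: cup_def front_face_singular_face_le back_face_singular_face_le)
  also have "(\<Sum>k\<le>p. (- 1) ^ k * \<phi> (singular_face (Suc p) k ?F'))
      = coboundary (Suc p) \<phi> ?F' + (- 1) ^ p * \<phi> ?F"
    using front_face_singular_face_le[of "Suc p" p q \<sigma>] front_face_singular_face_gt[of p "Suc p" q \<sigma>]
    by (simp add: coboundary_Suc)
  also have "(\<Sum>j\<le>q. ?c (p + Suc j))
      = (- 1) ^ p * \<phi> ?F * (\<Sum>j\<le>q. (- 1) ^ Suc j * \<psi> (singular_face (Suc q) (Suc j) ?B'))"
    unfolding sum_distrib_left
  proof (intro sum.cong refl)
    fix j assume "j \<in> {..q}"
    then show "?c (p + Suc j) = (- 1) ^ p * \<phi> ?F * ((- 1) ^ Suc j * \<psi> (singular_face (Suc q) (Suc j) ?B'))"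
      unfolding cup_def using back_face_singular_face_ge[of "Suc j" q p \<sigma>]
        front_face_singular_face_gt[of p "p + Suc j" q \<sigma>]
      by (simp only: power_add) simp
  qed
  also have "(\<Sum>j\<le>q. (- 1) ^ Suc j * \<psi> (singular_face (Suc q) (Suc j) ?B'))
      = coboundary (Suc q) \<psi> ?B' - \<psi> ?B"
    using back_face_singular_face_ge[of 0 q p \<sigma>] back_face_singular_face_le[of p p q \<sigma>]
    unfolding coboundary_Suc sum.atMost_Suc_shift by simp
  finally show ?thesis
    by (simp add: cup_def[of "Suc p" q] cup_def[of p "Suc q"] algebra_simps)
qed

lemma cocycle_cup:
  assumes "cocycle p X \<phi>" "cocycle q X \<psi>"
  shows "cocycle (p + q) X (cup p q \<phi> \<psi>)"
  unfolding cocycle_coboundary coboundary_cup cup_def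
  using assms singular_simplex_front_face[of "Suc p" q X] singular_simplex_back_face[of p "Suc q" X]
  by (simp add: cocycle_coboundary)

text \<open>By the Leibniz rule the product of the bounding cochain with \<psi> bounds the
  difference; in degree 0 there is nothing to bound, since \<phi> and \<phi>' agree on
  simplices.\<close>

lemma cohomologous_cup_left:
  assumes \<phi>: "cohomologous p X \<phi> \<phi>'" and \<psi>: "cocycle q X \<psi>"
  shows "cohomologous (p + q) X (cup p q \<phi> \<psi>) (cup p q \<phi>' \<psi>)"
proof -
  obtain \<theta> where \<theta>: "\<And>\<sigma>. singular_simplex p X \<sigma> \<Longrightarrow> \<phi> \<sigma> - \<phi>' \<sigma> = coboundary p \<theta> \<sigma>"
    using \<phi> by (auto simp: cohomologous_coboundary)
  have diff: "cup p q \<phi> \<psi> \<sigma> - cup p q \<phi>' \<psi> \<sigma> = cup p q (coboundary p \<theta>) \<psi> \<sigma>"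
    if "singular_simplex (p + q) X \<sigma>" for \<sigma>
    using \<theta>[OF singular_simplex_front_face[OF that]] by (simp add: cup_def left_diff_distrib[symmetric])
  show ?thesis
  proof (cases p)
    case 0
    then show ?thesis
      using diff by (intro cohomologous_eqI) (auto simp: cup_def)
  next
    case (Suc p')
    have "cup p q (coboundary p \<theta>) \<psi> \<sigma> = coboundary (p + q) (cup p' q \<theta> \<psi>) \<sigma>"
      if \<sigma>: "singular_simplex (p + q) X \<sigma>" for \<sigma>
    proof -
      have "coboundary (Suc q) \<psi> (back_face p' (Suc q) \<sigma>) = 0"
        using \<psi> \<sigma> singular_simplex_back_face[of p' "Suc q" X \<sigma>] by (simp add: cocycle_coboundary Suc)
      then show ?thesis
        using coboundary_cup[of p' q \<theta> \<psi> \<sigma>] by (simp add: Suc cup_def)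
    qed
    then show ?thesis
      using diff unfolding cohomologous_coboundary by auto
  qed
qed

lemma cohomologous_cup_right:
  assumes \<phi>: "cocycle p X \<phi>" and \<psi>: "cohomologous q X \<psi> \<psi>'"
  shows "cohomologous (p + q) X (cup p q \<phi> \<psi>) (cup p q \<phi> \<psi>')"
proof -
  obtain \<theta> where \<theta>: "\<And>\<sigma>. singular_simplex q X \<sigma> \<Longrightarrow> \<psi> \<sigma> - \<psi>' \<sigma> = coboundary q \<theta> \<sigma>"
    using \<psi> by (auto simp: cohomologous_coboundary)
  have diff: "cup p q \<phi> \<psi> \<sigma> - cup p q \<phi> \<psi>' \<sigma> = cup p q \<phi> (coboundary q \<theta>) \<sigma>"
    if "singular_simplex (p + q) X \<sigma>" for \<sigma>
    using \<theta>[OF singular_simplex_back_face[OF that]] by (simp add: cup_def right_diff_distrib[symmetric])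
  show ?thesis
  proof (cases q)
    case 0
    then show ?thesis
      using diff by (intro cohomologous_eqI) (auto simp: cup_def)
  next
    case (Suc q')
    \<comment> \<open>The bounding cochain is the product of \<phi> and \<theta> with the sign of
      the Leibniz rule; the summand with factor 0 only puts it into the form of
      \<open>coboundary_linear\<close>.\<close>
    have "cup p q \<phi> (coboundary q \<theta>) \<sigma>
        = coboundary (p + q) (\<lambda>\<sigma>. (- 1) ^ p * cup p q' \<phi> \<theta> \<sigma> + 0 * cup p q' \<phi> \<theta> \<sigma>) \<sigma>"
      if \<sigma>: "singular_simplex (p + q) X \<sigma>" for \<sigma>
    proof -
      have "coboundary (Suc p) \<phi> (front_face (Suc p) \<sigma>) = 0"
        using \<phi> \<sigma> singular_simplex_front_face[of "Suc p" q' X \<sigma>] by (simp add: cocycle_coboundary Suc)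
      then show ?thesis
        unfolding coboundary_linear using coboundary_cup[of p q' \<phi> \<theta> \<sigma>]
        by (simp add: Suc cup_def[of "Suc p"] cup_def[of p "Suc q'"] mult.assoc[symmetric]
            power_add[symmetric] mult_2[symmetric])
    qed
    then show ?thesis
      using diff unfolding cohomologous_coboundary by (metis (no_types, lifting))
  qed
qed

text \<open>Holds for the cochains themselves: both sides evaluate the factors on the same front,
  middle and back faces.\<close>

lemma cup_assoc:
  "cup (p + q) r (cup p q \<phi> \<psi>) \<xi> \<sigma> = cup p (q + r) \<phi> (cup q r \<psi> \<xi>) \<sigma>"
proof -
  have "front_face p (front_face (p + q) \<sigma>) = front_face p \<sigma>"
    using standard_simplex_mono[of p "p + q"] by (auto simp: front_face_def fun_eq_iff restrict_def)
  moreover have "back_face p q (front_face (p + q) \<sigma>) = front_face q (back_face p (q + r) \<sigma>)"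
    using standard_simplex_mono[of q "q + r"] shift_simplex_standard[of _ q p]
    by (auto simp: front_face_def back_face_shift fun_eq_iff restrict_def)
  moreover have "back_face (p + q) r \<sigma> = back_face q r (back_face p (q + r) \<sigma>)"
  proof
    fix x
    have "shift_simplex (p + q) x = shift_simplex p (shift_simplex q x)"
      by (auto simp: shift_simplex_def fun_eq_iff)
    then have "\<sigma> (shift_simplex (p + q) x) = \<sigma> (shift_simplex p (shift_simplex q x))"
      by (rule arg_cong)
    then show "back_face (p + q) r \<sigma> x = back_face q r (back_face p (q + r) \<sigma>) x"
      using shift_simplex_standard[of x r q] by (simp add: back_face_shift restrict_def)
  qed
  ultimately show ?thesis
    by (simp add: cup_def)
qed

section \<open>Powers of a class of degree 2\<close>

fun cup_power :: "'p cochain \<Rightarrow> nat \<Rightarrow> 'p cochain" where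
  "cup_power h 0 = (\<lambda>_. 1)"
| "cup_power h (Suc k) = cup (2 * k) 2 (cup_power h k) h"

lemma cocycle_one: "cocycle 0 X (\<lambda>_. 1)"
  by (simp add: cocycle_coboundary coboundary_Suc)

lemma cocycle_cup_power:
  assumes "cocycle 2 X h"
  shows "cocycle (2 * k) X (cup_power h k)"
proof (induction k)
  case (Suc k)
  show ?case
    using cocycle_cup[OF Suc assms] by (simp add: add.commute)
qed (simp add: cocycle_one)

text \<open>An equality of values, by associativity on cochains. It is stated on simplices because
  for these the front face of full dimension is the simplex itself, as the unit law
  requires.\<close>

lemma cup_cup_power:
  assumes "singular_simplex (2 * (a + b)) X \<sigma>"
  shows "cup (2 * a) (2 * b) (cup_power h a) (cup_power h b) \<sigma> = cup_power h (a + b) \<sigma>"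
  using assms
proof (induction b arbitrary: \<sigma>)
  case 0
  then show ?case
    by (simp add: cup_def front_face_singular_simplex)
next
  case (Suc b)
  have \<sigma>: "singular_simplex (2 * (a + b)) X (front_face (2 * (a + b)) \<sigma>)"
    using Suc.prems by (intro singular_simplex_front_face[of _ 2]) (simp add: algebra_simps)
  have "cup (2 * a) (2 * Suc b) (cup_power h a) (cup_power h (Suc b)) \<sigma>
      = cup (2 * a + 2 * b) 2 (cup (2 * a) (2 * b) (cup_power h a) (cup_power h b)) h \<sigma>"
    unfolding cup_assoc by (simp add: add.commute)
  also have "\<dots> = cup (2 * (a + b)) 2 (cup_power h (a + b)) h \<sigma>"
    using Suc.IH[OF \<sigma>] by (simp add: cup_def[of _ 2] distrib_left)
  finally show ?case
    by simp
qed

text \<open>The total class is represented by the series in h with coefficients \<alpha>. The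
  cocycle condition is included since replacing one factor of a cup product by a cohomologous one
  presupposes that the other is a cocycle.\<close>

definition chern_multiples ::
  "'p topology \<Rightarrow> 'p cochain \<Rightarrow> (nat \<Rightarrow> 'p cochain) \<Rightarrow> (nat \<Rightarrow> int) \<Rightarrow> bool" where
  "chern_multiples X h ch \<alpha> \<longleftrightarrow>
     (\<forall>k. cocycle (2 * k) X (ch k) \<and>
          cohomologous (2 * k) X (ch k) (\<lambda>\<sigma>. \<alpha> k * cup_power h k \<sigma>))"

text \<open>The factors are replaced one after the other: the left one next to \<psi>, then the
  right one next to a multiple of a power of h, so that the factor kept is a cocycle each
  time.\<close>

lemma cohomologous_cup_multiples:
  assumes h: "cocycle 2 X h" and \<psi>: "cocycle (2 * b) X \<psi>"
    and 1: "cohomologous (2 * a) X \<phi> (\<lambda>\<sigma>. x * cup_power h a \<sigma>)"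
    and 2: "cohomologous (2 * b) X \<psi> (\<lambda>\<sigma>. y * cup_power h b \<sigma>)"
  shows "cohomologous (2 * (a + b)) X (cup (2 * a) (2 * b) \<phi> \<psi>) (\<lambda>\<sigma>. (x * y) * cup_power h (a + b) \<sigma>)"
proof -
  let ?\<phi>' = "\<lambda>\<sigma>. x * cup_power h a \<sigma>" and ?\<psi>' = "\<lambda>\<sigma>. y * cup_power h b \<sigma>"
  have s1: "cohomologous (2 * a + 2 * b) X (cup (2 * a) (2 * b) \<phi> \<psi>) (cup (2 * a) (2 * b) ?\<phi>' \<psi>)"
    by (rule cohomologous_cup_left[OF 1 \<psi>])
  have s2: "cohomologous (2 * a + 2 * b) X (cup (2 * a) (2 * b) ?\<phi>' \<psi>) (cup (2 * a) (2 * b) ?\<phi>' ?\<psi>')"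
    by (rule cohomologous_cup_right[OF cocycle_scale[OF cocycle_cup_power[OF h]] 2])
  have s3: "cohomologous (2 * a + 2 * b) X (cup (2 * a) (2 * b) ?\<phi>' ?\<psi>')
      (\<lambda>\<sigma>. (x * y) * cup_power h (a + b) \<sigma>)"
  proof (rule cohomologous_eqI)
    fix \<sigma> assume "singular_simplex (2 * a + 2 * b) X \<sigma>"
    then show "cup (2 * a) (2 * b) ?\<phi>' ?\<psi>' \<sigma> = (x * y) * cup_power h (a + b) \<sigma>"
      using cup_cup_power[of a b X \<sigma> h] by (simp add: cup_def algebra_simps)
  qed
  show ?thesis
    using cohomologous_trans[OF cohomologous_trans[OF s1 s2] s3] by (simp only: distrib_left)
qed

lemma chern_multiples_product:
  assumes h: "cocycle 2 X h" and A: "chern_multiples X h A \<alpha>" and B: "chern_multiples X h B \<beta>"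
  shows "cohomologous (2 * k) X (\<lambda>\<sigma>. \<Sum>i\<le>k. cup (2 * i) (2 * (k - i)) (A i) (B (k - i)) \<sigma>)
      (\<lambda>\<sigma>. (\<Sum>i\<le>k. \<alpha> i * \<beta> (k - i)) * cup_power h k \<sigma>)"
proof -
  have "cohomologous (2 * k) X (cup (2 * i) (2 * (k - i)) (A i) (B (k - i)))
      (\<lambda>\<sigma>. (\<alpha> i * \<beta> (k - i)) * cup_power h k \<sigma>)" if "i \<le> k" for i
    using cohomologous_cup_multiples[OF h, of "k - i" "B (k - i)" i "A i" "\<alpha> i" "\<beta> (k - i)"] A B that
    by (simp add: chern_multiples_def)
  then have "cohomologous (2 * k) X (\<lambda>\<sigma>. \<Sum>i\<le>k. 1 * cup (2 * i) (2 * (k - i)) (A i) (B (k - i)) \<sigma>)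
      (\<lambda>\<sigma>. \<Sum>i\<le>k. 1 * ((\<alpha> i * \<beta> (k - i)) * cup_power h k \<sigma>))"
    by (intro cohomologous_sum) auto
  then show ?thesis
    by (simp add: sum_distrib_right)
qed

lemma cup_chern_multiples:
  assumes h: "cocycle 2 X h" and A: "chern_multiples X h A \<alpha>"
  shows "cocycle (2 * sum_list ks) X (cup_chern A ks) \<and>
    cohomologous (2 * sum_list ks) X (cup_chern A ks)
      (\<lambda>\<sigma>. (\<Prod>k\<leftarrow>ks. \<alpha> k) * cup_power h (sum_list ks) \<sigma>)"
proof (induction ks)
  case Nil
  show ?case
    by (simp add: cocycle_one)
next
  case (Cons k ks)
  have "cocycle (2 * k + 2 * sum_list ks) X (cup_chern A (k # ks))"
    using A Cons unfolding cup_chern.simps by (intro cocycle_cup) (auto simp: chern_multiples_def)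
  then show ?case
    using cohomologous_cup_multiples[OF h, of "sum_list ks" "cup_chern A ks" k "A k" "\<alpha> k"] A Cons
    by (simp add: chern_multiples_def)
qed

lemma monomial_class_multiples:
  assumes h: "cocycle 2 X h" and A: "chern_multiples X h A \<alpha>"
  shows "cohomologous (2 * sum_mset l) X (monomial_class A l)
     (\<lambda>\<sigma>. (\<Sum>r\<in>partitions_of (sum_mset l). elementary_coeffs l r * (\<Prod>k\<in>#r. \<alpha> k))
             * cup_power h (sum_mset l) \<sigma>)"
proof -
  let ?n = "sum_mset l"
  have "cohomologous (2 * ?n) X (cup_chern A (sorted_list_of_multiset r))
      (\<lambda>\<sigma>. (\<Prod>k\<in>#r. \<alpha> k) * cup_power h ?n \<sigma>)" if "r \<in> partitions_of ?n" for r
  proof -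
    let ?ks = "sorted_list_of_multiset r"
    have "sum_list ?ks = ?n"
      using that by (simp add: partitions_of_def flip: sum_mset_sum_list)
    moreover have "(\<Prod>k\<leftarrow>?ks. \<alpha> k) = (\<Prod>k\<in>#r. \<alpha> k)"
      by (simp flip: prod_mset_prod_list)
    ultimately show ?thesis
      using cup_chern_multiples[OF h A, of ?ks] by simp
  qed
  then have "cohomologous (2 * ?n) X (\<lambda>\<sigma>. \<Sum>r\<in>partitions_of ?n.
      elementary_coeffs l r * cup_chern A (sorted_list_of_multiset r) \<sigma>)
      (\<lambda>\<sigma>. \<Sum>r\<in>partitions_of ?n. elementary_coeffs l r * ((\<Prod>k\<in>#r. \<alpha> k) * cup_power h ?n \<sigma>))"
    by (intro cohomologous_sum) auto
  then show ?thesis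
    by (simp add: monomial_class_def[abs_def] sum_distrib_right mult.assoc)
qed

text \<open>Every monomial class of top degree is an integer multiple of h^n, whose value on the
  fundamental cycle is 1, so the Chern numbers are these integers.\<close>

lemma chern_number_poly_multiples:
  assumes h: "cocycle 2 (cbase M) h" and A: "chern_multiples (cbase M) h (c (cbase M) E) \<alpha>"
    and \<mu>: "singular_relcycle (2 * cdim M) (cbase M) {} (\<mu> M)"
    and 1: "cochain_eval (cup_power h (cdim M)) (\<mu> M) = 1"
  shows "chern_number_poly c \<mu> M E = chern_poly \<alpha> (cdim M)"
  unfolding chern_number_poly_def chern_poly_def
proof (intro sum.cong refl)
  fix l assume "l \<in> partitions_of (cdim M)"
  then have l: "sum_mset l = cdim M"
    by (simp add: partitions_of_def)
  let ?s = "\<Sum>r\<in>partitions_of (cdim M). elementary_coeffs l r * (\<Prod>k\<in>#r. \<alpha> k)"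
  have "cochain_eval (monomial_class (c (cbase M) E) l) (\<mu> M)
      = cochain_eval (\<lambda>\<sigma>. ?s * cup_power h (cdim M) \<sigma>) (\<mu> M)"
    using monomial_class_multiples[OF h A, of l] \<mu> by (intro cochain_eval_cohomologous) (simp_all add: l)
  also have "\<dots> = ?s"
    using cochain_eval_linear[of ?s "cup_power h (cdim M)" 0 "cup_power h (cdim M)" "\<mu> M"] 1 by simp
  finally show "of_int (cochain_eval (monomial_class (c (cbase M) E) l) (\<mu> M)) * (\<Prod>k\<in>#l. tvar k)
      = of_int ?s * (\<Prod>k\<in>#l. tvar k)"
    by simp
qed

section \<open>Complex projective space\<close>

lemma continuous_map_mult [continuous_intros]:
  fixes f g :: "'a \<Rightarrow> 'b::real_normed_algebra"
  shows "\<lbrakk>continuous_map X euclidean f; continuous_map X euclidean g\<rbrakk>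
    \<Longrightarrow> continuous_map X euclidean (\<lambda>x. f x * g x)"
  by (simp add: continuous_map_atin tendsto_mult)

lemma continuous_map_divide [continuous_intros]:
  fixes f g :: "'a \<Rightarrow> 'b::real_normed_field"
  shows "\<lbrakk>continuous_map X euclidean f; continuous_map X euclidean g; \<And>x. x \<in> topspace X \<Longrightarrow> g x \<noteq> 0\<rbrakk>
    \<Longrightarrow> continuous_map X euclidean (\<lambda>x. f x / g x)"
  by (simp add: continuous_map_atin tendsto_divide)

lemma continuous_map_cnj [continuous_intros]:
  "continuous_map X euclidean f \<Longrightarrow> continuous_map X euclidean (\<lambda>x. cnj (f x))"
  by (simp add: continuous_map_atin tendsto_cnj)

lemma topspace_cspace: "topspace (cspace n) = {z. \<forall>k\<ge>n. z k = 0}"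
  by (simp add: cspace_def)

lemma continuous_map_into_cspace:
  "continuous_map X (cspace n) f \<longleftrightarrow>
     (\<forall>k. continuous_map X euclidean (\<lambda>x. f x k)) \<and> f ` topspace X \<subseteq> topspace (cspace n)"
  by (auto simp: cspace_def continuous_map_in_subtopology continuous_map_componentwise_UNIV)

lemma continuous_map_cspace_coord: "continuous_map (cspace n) euclidean (\<lambda>z. z k)"
  unfolding cspace_def by (intro continuous_map_from_subtopology continuous_map_product_projection) simp

lemma Hausdorff_cspace: "Hausdorff_space (cspace n)"
  unfolding cspace_def by (intro Hausdorff_space_subtopology) (simp add: Hausdorff_space_product_topology)

section \<open>Lines and the quotient topology\<close>

definition cvecs :: "nat \<Rightarrow> (nat \<Rightarrow> complex) set" where
  "cvecs n = topspace (cspace (Suc n)) - {\<lambda>_. 0}"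

lemma cvecs_iff: "v \<in> cvecs n \<longleftrightarrow> (\<forall>k>n. v k = 0) \<and> (\<exists>k\<le>n. v k \<noteq> 0)"
proof -
  have "(\<exists>k. v k \<noteq> 0) \<longleftrightarrow> (\<exists>k\<le>n. v k \<noteq> 0)" if "\<forall>k>n. v k = 0"
    using that by (meson not_le)
  then show ?thesis
    by (auto simp: cvecs_def topspace_cspace Suc_le_eq fun_eq_iff)
qed

lemma openin_cvecs: "openin (cspace (Suc n)) (cvecs n)"
proof -
  have "(\<lambda>_. 0) \<in> topspace (cspace (Suc n))"
    by (simp add: topspace_cspace)
  then show ?thesis
    unfolding cvecs_def using closedin_Hausdorff_singleton[OF Hausdorff_cspace] by blast
qed

lemma openin_cp_topology_cvecs:
  "openin (cp_topology n) U \<longleftrightarrow> U \<subseteq> cp_points n \<and>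
     openin (cspace (Suc n)) {v \<in> cvecs n. cline v \<in> U}"
  by (simp add: openin_cp_topology cvecs_def)

lemma cp_points_cvecs: "cp_points n = cline ` cvecs n"
  by (simp add: cp_points_def cvecs_def)

lemma topspace_cp_topology [simp]: "topspace (cp_topology n) = cp_points n"
proof
  have "{v \<in> cvecs n. cline v \<in> cp_points n} = cvecs n"
    by (auto simp: cp_points_cvecs)
  then have "openin (cp_topology n) (cp_points n)"
    using openin_cvecs by (simp add: openin_cp_topology_cvecs)
  then show "cp_points n \<subseteq> topspace (cp_topology n)"
    by (rule openin_subset)
  show "topspace (cp_topology n) \<subseteq> cp_points n"
    using openin_topspace[of "cp_topology n"] by (simp only: openin_cp_topology_cvecs)
qed

abbreviation cpunctured :: "nat \<Rightarrow> (nat \<Rightarrow> complex) topology" where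
  "cpunctured n \<equiv> subtopology (cspace (Suc n)) (cvecs n)"

lemma topspace_cpunctured [simp]: "topspace (cpunctured n) = cvecs n"
  by (auto simp: cvecs_def)

text \<open>Continuity of maps out of projective space can then be checked on nonzero
  vectors.\<close>

lemma quotient_map_cline: "quotient_map (cpunctured n) (cp_topology n) cline"
  unfolding quotient_map_def topspace_cpunctured topspace_cp_topology
proof (intro conjI allI impI)
  show "cline ` cvecs n = cp_points n"
    by (simp add: cp_points_cvecs)
  show "openin (cpunctured n) {v \<in> cvecs n. cline v \<in> U} \<longleftrightarrow> openin (cp_topology n) U"
    if "U \<subseteq> cp_points n" for U
    using that openin_cvecs[of n] by (auto simp: openin_cp_topology_cvecs openin_open_subtopology)
qed

lemma self_in_cline: "v \<in> cline v"
  unfolding cline_def by (rule CollectI, rule exI[of _ 1]) simp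

lemma cline_scale:
  assumes "a \<noteq> 0"
  shows "cline (\<lambda>k. a * v k) = cline v"
proof -
  have "\<exists>c. (\<lambda>k. b * v k) = (\<lambda>k. c * (a * v k))" for b
    using assms by (intro exI[of _ "b / a"]) simp
  moreover have "\<exists>c. (\<lambda>k. b * (a * v k)) = (\<lambda>k. c * v k)" for b
    by (intro exI[of _ "b * a"]) (simp add: mult.assoc)
  ultimately show ?thesis
    by (auto simp: cline_def)
qed

lemma cline_eq_iff:
  assumes "v \<in> cvecs n" "w \<in> cvecs n"
  shows "cline v = cline w \<longleftrightarrow> (\<exists>a. a \<noteq> 0 \<and> v = (\<lambda>k. a * w k))"
proof
  assume "cline v = cline w"
  then obtain a where "v = (\<lambda>k. a * w k)"
    using self_in_cline[of v] by (auto simp: cline_def)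
  moreover from this have "a \<noteq> 0"
    using assms(1) by (auto simp: cvecs_iff)
  ultimately show "\<exists>a. a \<noteq> 0 \<and> v = (\<lambda>k. a * w k)"
    by blast
qed (auto simp: cline_scale)

lemma normal_rep_cline:
  assumes "v i \<noteq> 0"
  shows "normal_rep i (cline v) = (\<lambda>k. v k / v i)"
  unfolding normal_rep_def
proof (rule the_equality)
  have "\<exists>a. (\<lambda>k. v k / v i) = (\<lambda>k. a * v k)"
    by (intro exI[of _ "1 / v i"]) simp
  then show "(\<lambda>k. v k / v i) \<in> cline v \<and> v i / v i = 1"
    using assms by (auto simp: cline_def)
  fix w assume "w \<in> cline v \<and> w i = 1"
  then obtain a where "w = (\<lambda>k. a * v k)" "a * v i = 1"
    by (auto simp: cline_def)
  then show "w = (\<lambda>k. v k / v i)"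
    using assms by (auto simp: field_simps)
qed

lemma cline_in_cp_dom:
  assumes "v \<in> cvecs n"
  shows "cline v \<in> cp_dom n i \<longleftrightarrow> v i \<noteq> 0"
proof
  assume "v i \<noteq> 0"
  then show "cline v \<in> cp_dom n i"
    using assms self_in_cline by (auto simp: cp_dom_def cp_points_cvecs)
qed (auto simp: cp_dom_def cline_def)

lemma cp_dom_cases:
  assumes "L \<in> cp_dom n i"
  obtains v where "v \<in> cvecs n" "v i = 1" "L = cline v" "normal_rep i L = v"
proof -
  obtain v where v: "v \<in> cvecs n" "L = cline v"
    using assms by (auto simp: cp_dom_def cp_points_cvecs)
  then have vi: "v i \<noteq> 0"
    using assms cline_in_cp_dom by simp
  let ?w = "\<lambda>k. v k / v i"
  have "?w \<in> cvecs n"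
    using v(1) vi by (auto simp: cvecs_iff)
  moreover have "cline ?w = L"
    using cline_scale[of "1 / v i" v] vi v(2) by simp
  ultimately show ?thesis
    using that[of ?w] vi normal_rep_cline[of v i] v(2) by simp
qed

lemma cp_dom_index:
  assumes "L \<in> cp_dom n i"
  shows "i \<le> n"
  using assms by (elim cp_dom_cases) (auto simp: cvecs_iff intro: leI)

lemma normal_rep_change:
  assumes "L \<in> cp_dom n i" "L \<in> cp_dom n j"
  shows "normal_rep j L k = normal_rep i L k / normal_rep i L j" "normal_rep i L j \<noteq> 0"
proof -
  obtain v where v: "v \<in> cvecs n" "L = cline v" "normal_rep i L = v"
    using assms(1) by (rule cp_dom_cases)
  then show "normal_rep i L j \<noteq> 0"
    using assms(2) cline_in_cp_dom by simp
  then show "normal_rep j L k = normal_rep i L k / normal_rep i L j"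
    using v normal_rep_cline[of v j] by simp
qed

lemma normal_rep_self:
  assumes "L \<in> cp_dom n i"
  shows "normal_rep i L i = 1"
  using assms by (elim cp_dom_cases) simp

lemma cp_dom_covers: "(\<Union>i\<in>{..n}. cp_dom n i) = cp_points n"
proof
  show "cp_points n \<subseteq> (\<Union>i\<in>{..n}. cp_dom n i)"
  proof
    fix L assume "L \<in> cp_points n"
    then obtain v where v: "v \<in> cvecs n" "L = cline v"
      by (auto simp: cp_points_cvecs)
    then obtain i where "i \<le> n" "v i \<noteq> 0"
      by (auto simp: cvecs_iff)
    then show "L \<in> (\<Union>i\<in>{..n}. cp_dom n i)"
      using v cline_in_cp_dom by auto
  qed
qed (auto simp: cp_dom_def)

lemma openin_cp_dom: "openin (cp_topology n) (cp_dom n i)"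
proof -
  have "openin (cspace (Suc n)) {v \<in> topspace (cspace (Suc n)). v i \<in> - {0}}"
    by (rule openin_continuous_map_preimage[OF continuous_map_cspace_coord]) auto
  then have "openin (cspace (Suc n)) ({v \<in> topspace (cspace (Suc n)). v i \<in> - {0}} \<inter> cvecs n)"
    using openin_cvecs by blast
  moreover have "{v \<in> topspace (cspace (Suc n)). v i \<in> - {0}} \<inter> cvecs n = {v \<in> cvecs n. cline v \<in> cp_dom n i}"
  proof -
    have "v \<in> topspace (cspace (Suc n))" if "v \<in> cvecs n" for v
      using that by (simp add: cvecs_def)
    then show ?thesis
      using cline_in_cp_dom by blast
  qed
  ultimately show ?thesis
    by (auto simp: openin_cp_topology_cvecs cp_dom_def)
qed

text \<open>A quotient map restricted over an open set is again a quotient map, so continuity on a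
  chart domain is tested on the vectors with nonzero i-th coordinate.\<close>

lemma continuous_map_on_cp_dom:
  assumes "continuous_map (subtopology (cspace (Suc n)) {v \<in> cvecs n. v i \<noteq> 0}) Y (f \<circ> cline)"
  shows "continuous_map (subtopology (cp_topology n) (cp_dom n i)) Y f"
proof -
  have "{v \<in> topspace (cpunctured n). cline v \<in> cp_dom n i} = {v \<in> cvecs n. v i \<noteq> 0}"
    unfolding topspace_cpunctured using cline_in_cp_dom by blast
  then have "quotient_map (subtopology (cpunctured n) {v \<in> cvecs n. v i \<noteq> 0})
      (subtopology (cp_topology n) (cp_dom n i)) cline"
    by (intro quotient_map_restriction[OF quotient_map_cline] disjI1 openin_cp_dom)
  moreover have "cvecs n \<inter> {v \<in> cvecs n. v i \<noteq> 0} = {v \<in> cvecs n. v i \<noteq> 0}"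
    by auto
  ultimately have "quotient_map (subtopology (cspace (Suc n)) {v \<in> cvecs n. v i \<noteq> 0})
      (subtopology (cp_topology n) (cp_dom n i)) cline"
    by (simp only: subtopology_subtopology)
  then show ?thesis
    using assms by (rule continuous_compose_quotient_map)
qed

lemma continuous_normal_rep:
  "continuous_map (subtopology (cp_topology n) (cp_dom n i)) euclidean (\<lambda>L. normal_rep i L k)"
proof (rule continuous_map_on_cp_dom)
  let ?X = "subtopology (cspace (Suc n)) {v \<in> cvecs n. v i \<noteq> 0}"
  have "continuous_map ?X euclidean (\<lambda>v. v k / v i)"
    by (intro continuous_map_divide continuous_map_from_subtopology continuous_map_cspace_coord) auto
  then show "continuous_map ?X euclidean ((\<lambda>L. normal_rep i L k) \<circ> cline)"
    by (rule continuous_map_eq) (auto simp: normal_rep_cline)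
qed

lemma continuous_normal_rep_subset:
  assumes "U \<subseteq> cp_dom n i"
  shows "continuous_map (subtopology (cp_topology n) U) euclidean (\<lambda>L. normal_rep i L k)"
  using continuous_map_from_subtopology_mono[OF continuous_normal_rep assms] .

text \<open>After division by a coordinate of largest modulus, every line is spanned by a vector in
  one of the compact sets \<open>K i\<close>, products of unit discs with i-th coordinate 1.\<close>

lemma compact_cp_topology: "compact_space (cp_topology n)"
proof -
  define K where "K = (\<lambda>i. PiE UNIV (\<lambda>k. if k = i then {1 :: complex} else if k \<le> n then cball 0 1 else {0}))"
  have "compactin (cp_topology n) (cline ` K i)" if i: "i \<le> n" for i
  proof (rule image_compactin[OF _ quotient_imp_continuous_map[OF quotient_map_cline]])
    have "compactin (product_topology (\<lambda>_. euclidean) UNIV) (K i)"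
      unfolding K_def compactin_PiE by auto
    moreover have "K i \<subseteq> cvecs n"
    proof
      fix v assume v: "v \<in> K i"
      have "v k \<in> (if k = i then {1} else if k \<le> n then cball 0 1 else {0})" for k
        using v unfolding K_def by (rule PiE_mem) simp
      from this[of i] this show "v \<in> cvecs n"
        using i by (auto simp: cvecs_iff split: if_splits) (metis leD order_less_irrefl empty_iff insert_iff)
    qed
    ultimately show "compactin (cpunctured n) (K i)"
      by (auto simp: cspace_def compactin_subtopology cvecs_def)
  qed
  then have "compactin (cp_topology n) (\<Union>i\<le>n. cline ` K i)"
    by (intro compactin_Union) auto
  moreover have "(\<Union>i\<le>n. cline ` K i) = cp_points n"
  proof (intro equalityI)
    show "(\<Union>i\<le>n. cline ` K i) \<subseteq> cp_points n"
      using calculation compactin_subset_topspace by fastforce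
    show "cp_points n \<subseteq> (\<Union>i\<le>n. cline ` K i)"
    proof
      fix L assume "L \<in> cp_points n"
      then obtain v where v: "v \<in> cvecs n" "L = cline v"
        by (auto simp: cp_points_cvecs)
      have "Max ((\<lambda>k. cmod (v k)) ` {..n}) \<in> (\<lambda>k. cmod (v k)) ` {..n}"
        by (intro Max_in) auto
      then obtain i where i: "i \<le> n" "Max ((\<lambda>k. cmod (v k)) ` {..n}) = cmod (v i)"
        by (metis (no_types, lifting) atMost_iff imageE)
      then have max: "cmod (v k) \<le> cmod (v i)" if "k \<le> n" for k
        using that Max_ge[of "(\<lambda>k. cmod (v k)) ` {..n}" "cmod (v k)"] by auto
      then have vi: "v i \<noteq> 0"
        using v(1) by (auto simp: cvecs_iff)
      have "(\<lambda>k. v k / v i) \<in> K i"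
        using v(1) vi max by (auto simp: K_def cvecs_iff norm_divide divide_le_eq_1)
      moreover have "cline (\<lambda>k. v k / v i) = L"
        using cline_scale[of "1 / v i" v] vi v(2) by simp
      ultimately show "L \<in> (\<Union>i\<le>n. cline ` K i)"
        using i(1) by blast
    qed
  qed
  ultimately show ?thesis
    by (simp add: compact_space_def)
qed

text \<open>The squared Hermitian norm, kept as a complex number because it is a denominator of
  complex matrix entries.\<close>

definition hnorm :: "nat \<Rightarrow> (nat \<Rightarrow> complex) \<Rightarrow> complex" where
  "hnorm n v = (\<Sum>k\<le>n. v k * cnj (v k))"

lemma hnorm_nonzero:
  assumes "v \<in> cvecs n"
  shows "hnorm n v \<noteq> 0"
proof -
  have "hnorm n v = complex_of_real (\<Sum>k\<le>n. (cmod (v k))\<^sup>2)"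
    by (simp add: hnorm_def complex_mult_cnj cmod_def)
  moreover have "(\<Sum>k\<le>n. (cmod (v k))\<^sup>2) \<noteq> 0"
    using assms by (auto simp: cvecs_iff sum_nonneg_eq_0_iff)
  ultimately show ?thesis
    by (simp only: of_real_eq_0_iff not_False_eq_True)
qed

text \<open>The entries of the orthogonal projection onto a line separate lines.\<close>

lemma Hausdorff_cp_topology: "Hausdorff_space (cp_topology n)"
proof -
  define G where "G = (\<lambda>v (a, b). v a * cnj (v b) / hnorm n v)"
  \<comment> \<open>The entries of the projection do not change when the vector is scaled, so any
    representative of the line may be chosen.\<close>
  define F where "F = (\<lambda>L. G (SOME v. v \<in> cvecs n \<and> cline v = L))"
  have G_scale: "G (\<lambda>k. a * v k) = G v" if "a \<noteq> 0" for a v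
  proof -
    have "hnorm n (\<lambda>k. a * v k) = (a * cnj a) * hnorm n v"
      by (simp add: hnorm_def sum_distrib_left algebra_simps)
    then show ?thesis
      using that by (auto simp: G_def field_simps)
  qed
  have F: "F (cline v) = G v" if v: "v \<in> cvecs n" for v
  proof -
    define w where "w = (SOME w. w \<in> cvecs n \<and> cline w = cline v)"
    have "w \<in> cvecs n \<and> cline w = cline v"
      unfolding w_def by (rule someI[of _ v]) (simp add: v)
    then obtain a where "a \<noteq> 0" "w = (\<lambda>k. a * v k)"
      using cline_eq_iff[of w n v] v by blast
    then show ?thesis
      unfolding F_def w_def[symmetric] using G_scale by simp
  qed
  have "continuous_map (cp_topology n) (product_topology (\<lambda>_. euclidean) UNIV) F"
  proof (rule continuous_compose_quotient_map[OF quotient_map_cline])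
    have "continuous_map (cpunctured n) euclidean (\<lambda>v. v a * cnj (v b) / hnorm n v)" for a b
      unfolding hnorm_def
      by (intro continuous_intros continuous_map_from_subtopology continuous_map_cspace_coord)
         (use hnorm_nonzero in \<open>auto simp: hnorm_def\<close>)
    then have "continuous_map (cpunctured n) (product_topology (\<lambda>_. euclidean) UNIV) G"
      by (auto simp: continuous_map_componentwise_UNIV G_def)
    then show "continuous_map (cpunctured n) (product_topology (\<lambda>_. euclidean) UNIV) (F \<circ> cline)"
      by (rule continuous_map_eq) (simp add: F)
  qed
  moreover have "inj_on F (cp_points n)"
  proof (rule inj_onI)
    fix L L' assume L: "L \<in> cp_points n" "L' \<in> cp_points n" "F L = F L'"
    then obtain v w where v: "v \<in> cvecs n" "L = cline v" and w: "w \<in> cvecs n" "L' = cline w"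
      by (auto simp: cp_points_cvecs)
    have GG: "G v = G w"
      using L(3) F v w by simp
    obtain b where b: "v b \<noteq> 0"
      using v(1) by (auto simp: cvecs_iff)
    \<comment> \<open>Solved from the equality of the b-th columns of the two projections, which are
      multiples of v and of w.\<close>
    define a where "a = cnj (w b) * hnorm n v / (cnj (v b) * hnorm n w)"
    have "v k = a * w k" for k
    proof -
      have "v k * cnj (v b) / hnorm n v = w k * cnj (w b) / hnorm n w"
        using fun_cong[OF GG, of "(k, b)"] by (simp add: G_def)
      then show ?thesis
        using b hnorm_nonzero[OF v(1)] hnorm_nonzero[OF w(1)]
        by (simp add: a_def field_simps)
    qed
    moreover from this have "a \<noteq> 0"
      using b by auto
    ultimately show "L = L'"
      using cline_eq_iff[OF v(1) w(1)] v w by blast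
  qed
  ultimately show ?thesis
    by (intro Hausdorff_space_injective_preimage[of "product_topology (\<lambda>_. euclidean) UNIV" _ F])
       (simp_all add: Hausdorff_space_product_topology)
qed

section \<open>Affine charts and transition functions\<close>

definition skip_index :: "nat \<Rightarrow> nat \<Rightarrow> nat" where
  "skip_index i k = (if k < i then k else Suc k)"

text \<open>The vector with i-th coordinate 1 over the point z of the i-th affine chart;
  \<open>skip_index\<close> enumerates the remaining homogeneous coordinates in order.\<close>

definition insert_one :: "nat \<Rightarrow> (nat \<Rightarrow> complex) \<Rightarrow> nat \<Rightarrow> complex" where
  "insert_one i z k = (if k < i then z k else if k = i then 1 else z (k - 1))"

lemma insert_one_skip [simp]: "insert_one i z (skip_index i k) = z k"
  by (simp add: insert_one_def skip_index_def)

lemma insert_one_same [simp]: "insert_one i z i = 1"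
  by (simp add: insert_one_def)

lemma skip_index_neq [simp]: "skip_index i k \<noteq> i" "i \<noteq> skip_index i k"
  by (auto simp: skip_index_def)

lemma skip_index_inject [simp]: "skip_index i k = skip_index i l \<longleftrightarrow> k = l"
  by (auto simp: skip_index_def)

lemma skip_index_image: "i \<le> n \<Longrightarrow> skip_index i ` {..<n} = {..n} - {i}"
proof (intro equalityI subsetI)
  fix k assume "i \<le> n" "k \<in> {..n} - {i}"
  then show "k \<in> skip_index i ` {..<n}"
    by (intro image_eqI[of _ _ "if k < i then k else k - 1"]) (auto simp: skip_index_def)
qed (auto simp: skip_index_def)

lemma skip_index_cases:
  obtains "k = i" | l where "k = skip_index i l"
  by (metis Suc_pred' bot_nat_0.not_eq_extremum less_Suc_eq less_nat_zero_code linorder_neqE_nat not_less_eq skip_index_def)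

lemma insert_one_cvecs:
  assumes "z \<in> topspace (cspace n)" "i \<le> n"
  shows "insert_one i z \<in> cvecs n"
  using assms by (auto simp: cvecs_iff topspace_cspace insert_one_def intro!: exI[of _ i])

abbreviation CP :: "nat \<Rightarrow> point cmanifold" where
  "CP \<equiv> complex_projective_space"

lemma cchart_cp:
  "cchart (CP n) i L k = (if k < n then normal_rep i L (skip_index i k) else 0)"
  by (simp add: complex_projective_space_def skip_index_def)

lemma cp_simps [simp]:
  "cbase (CP n) = cp_topology n"
  "cdim (CP n) = n"
  "cidx (CP n) = {..n}"
  "cdom (CP n) = cp_dom n"
  by (simp_all add: complex_projective_space_def)

lemma cchart_cp_cline:
  assumes "z \<in> topspace (cspace n)"
  shows "cchart (CP n) i (cline (insert_one i z)) = z"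
  using assms by (auto simp: cchart_cp normal_rep_cline topspace_cspace fun_eq_iff)

lemma insert_one_cchart:
  assumes "L \<in> cp_dom n i"
  shows "insert_one i (cchart (CP n) i L) = normal_rep i L"
proof
  fix k
  obtain v where v: "v \<in> cvecs n" "v i = 1" "normal_rep i L = v"
    using assms by (rule cp_dom_cases)
  show "insert_one i (cchart (CP n) i L) k = normal_rep i L k"
  proof (cases k i rule: skip_index_cases)
    case (2 l)
    have "v (skip_index i l) = 0" if "\<not> l < n"
      using that v(1) cp_dom_index[OF assms] by (auto simp: cvecs_iff skip_index_def)
    then show ?thesis
      using 2 v by (auto simp: cchart_cp)
  qed (simp add: v)
qed

lemma cline_normal_rep:
  assumes "L \<in> cp_dom n i"
  shows "cline (normal_rep i L) = L"
  using assms by (elim cp_dom_cases) simp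

lemma cchart_cp_in_cspace: "cchart (CP n) i L \<in> topspace (cspace n)"
  by (simp add: topspace_cspace cchart_cp)

lemma cchart_cp_image:
  assumes "i \<le> n"
  shows "cchart (CP n) i ` cp_dom n i = topspace (cspace n)"
proof (intro equalityI subsetI)
  fix z assume z: "z \<in> topspace (cspace n)"
  then have "cline (insert_one i z) \<in> cp_dom n i"
    using assms cline_in_cp_dom[OF insert_one_cvecs] by simp
  then show "z \<in> cchart (CP n) i ` cp_dom n i"
    using cchart_cp_cline[OF z] by (metis imageI)
qed (auto simp: cchart_cp_in_cspace)

lemma homeomorphic_maps_cchart_cp:
  assumes i: "i \<le> n"
  shows "homeomorphic_maps (subtopology (cp_topology n) (cp_dom n i)) (cspace n)
    (cchart (CP n) i) (\<lambda>z. cline (insert_one i z))"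
  unfolding homeomorphic_maps_def
proof (intro conjI ballI)
  let ?X = "subtopology (cp_topology n) (cp_dom n i)"
  have "continuous_map ?X euclidean (\<lambda>L. cchart (CP n) i L k)" for k
    using continuous_normal_rep[of n i "skip_index i k"] by (cases "k < n") (auto simp: cchart_cp)
  then show "continuous_map ?X (cspace n) (cchart (CP n) i)"
    by (auto simp: continuous_map_into_cspace cchart_cp_in_cspace)
  have "continuous_map (cspace n) euclidean (\<lambda>z. insert_one i z k)" for k
    by (cases k i rule: linorder_cases) (auto simp: insert_one_def continuous_map_cspace_coord)
  then have "continuous_map (cspace n) (cpunctured n) (insert_one i)"
    using insert_one_cvecs[OF _ i]
    by (auto simp: continuous_map_in_subtopology continuous_map_into_cspace cvecs_def)
  then have "continuous_map (cspace n) (cp_topology n) (cline \<circ> insert_one i)"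
    using continuous_map_compose quotient_imp_continuous_map[OF quotient_map_cline] by blast
  then show "continuous_map (cspace n) ?X (\<lambda>z. cline (insert_one i z))"
    using cline_in_cp_dom[OF insert_one_cvecs[OF _ i]]
    by (auto simp: continuous_map_in_subtopology o_def)
  show "cline (insert_one i (cchart (CP n) i L)) = L" if "L \<in> topspace ?X" for L
    using that insert_one_cchart[of L n i] cline_normal_rep[of L n i] by simp
  show "cchart (CP n) i (cline (insert_one i z)) = z" if "z \<in> topspace (cspace n)" for z
    using that by (rule cchart_cp_cline)
qed

lemma chart_inv_cp:
  assumes i: "i \<le> n" and z: "z \<in> topspace (cspace n)"
  shows "chart_inv (CP n) i z = cline (insert_one i z)"
  unfolding chart_inv_def cp_simps
proof (rule inv_into_f_eq)
  show "inj_on (cchart (CP n) i) (cp_dom n i)"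
    by (rule inj_on_inverseI[where g = "\<lambda>z. cline (insert_one i z)"])
       (simp add: insert_one_cchart cline_normal_rep)
  show "cline (insert_one i z) \<in> cp_dom n i"
    using i z cline_in_cp_dom[OF insert_one_cvecs] by simp
qed (rule cchart_cp_cline[OF z])

lemma cp_transition:
  assumes "j \<le> n" "z \<in> topspace (cspace n)" "insert_one j z i \<noteq> 0" "k < n"
  shows "cchart (CP n) i (chart_inv (CP n) j z) k
    = insert_one j z (skip_index i k) / insert_one j z i"
  using assms by (simp add: cchart_cp chart_inv_cp normal_rep_cline)

lemma cp_overlap:
  assumes z: "z \<in> cchart (CP n) j ` (cp_dom n i \<inter> cp_dom n j)"
  shows "z \<in> topspace (cspace n)" "insert_one j z i \<noteq> 0" "j \<le> n"
proof -
  obtain L where L: "z = cchart (CP n) j L" "L \<in> cp_dom n i" "L \<in> cp_dom n j"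
    using z by auto
  then show "z \<in> topspace (cspace n)" "j \<le> n"
    using cchart_cp_in_cspace cp_dom_index by auto
  show "insert_one j z i \<noteq> 0"
    using normal_rep_change(2)[OF L(3,2)] by (simp add: L(1) insert_one_cchart[OF L(3)])
qed

lemma insert_one_upd:
  "insert_one j (z(l := w)) k = (if k = skip_index j l then w else insert_one j z k)"
  by (cases k j rule: skip_index_cases) auto

lemma upd_in_cspace:
  assumes "z \<in> topspace (cspace n)" "l < n"
  shows "z(l := w) \<in> topspace (cspace n)"
  using assms by (auto simp: topspace_cspace)

lemma eventually_upd_nonzero:
  assumes "insert_one j z i \<noteq> 0"
  shows "\<forall>\<^sub>F w in nhds (z l). insert_one j (z(l := w)) i \<noteq> 0"
proof (cases "i = skip_index j l")
  case True
  then have "z l \<noteq> 0"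
    using assms by simp
  then have "\<forall>\<^sub>F w in nhds (z l). w \<noteq> 0"
    by (rule t1_space_nhds)
  then show ?thesis
    using True by (simp add: insert_one_upd)
qed (use assms in \<open>simp add: insert_one_upd\<close>)

text \<open>Each homogeneous coordinate either does not depend on w or is w itself, and the
  transition function is a quotient of two of them.\<close>

lemma cp_transition_derivative:
  assumes j: "j \<le> n" and z: "z \<in> topspace (cspace n)" and nz: "insert_one j z i \<noteq> 0"
    and k: "k < n" and l: "l < n"
  shows "((\<lambda>w. cchart (CP n) i (chart_inv (CP n) j (z(l := w))) k)
    has_field_derivative
      (of_bool (skip_index i k = skip_index j l) * insert_one j z i
        - insert_one j z (skip_index i k) * of_bool (i = skip_index j l)) / (insert_one j z i)\<^sup>2) (at (z l))"
proof -
  let ?a = "\<lambda>m w. insert_one j (z(l := w)) m"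
  have d: "(?a m has_field_derivative of_bool (m = skip_index j l)) (at (z l))" for m
    by (auto simp: insert_one_upd)
  have "((\<lambda>w. ?a (skip_index i k) w / ?a i w) has_field_derivative
      (of_bool (skip_index i k = skip_index j l) * ?a i (z l)
        - ?a (skip_index i k) (z l) * of_bool (i = skip_index j l)) / (?a i (z l) * ?a i (z l))) (at (z l))"
    using nz by (intro DERIV_divide d) simp
  \<comment> \<open>The quotient formula is available where the denominator is nonzero, which holds
    near \<open>z l\<close>.\<close>
  moreover have "\<forall>\<^sub>F w in nhds (z l). cchart (CP n) i
      (chart_inv (CP n) j (z(l := w))) k = ?a (skip_index i k) w / ?a i w"
    using eventually_upd_nonzero[OF nz, of l]
    by eventually_elim (use cp_transition j k upd_in_cspace[OF z l] in auto)
  ultimately show ?thesis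
    by (subst DERIV_cong_ev[OF refl _ refl]) (auto simp: power2_eq_square)
qed

lemma compact_complex_manifold_cp: "compact_complex_manifold (CP n)"
  unfolding compact_complex_manifold_def cp_simps
proof (intro conjI ballI allI impI)
  show "compact_space (cp_topology n)" "Hausdorff_space (cp_topology n)"
    by (rule compact_cp_topology Hausdorff_cp_topology)+
  show "(\<Union>i\<in>{..n}. cp_dom n i) = topspace (cp_topology n)"
    by (simp only: cp_dom_covers topspace_cp_topology)
  fix i assume i: "i \<in> {..n}"
  show "openin (cp_topology n) (cp_dom n i)"
    by (rule openin_cp_dom)
  have img: "cchart (CP n) i ` cp_dom n i = topspace (cspace n)"
    using i by (intro cchart_cp_image) simp
  show "openin (cspace n) (cchart (CP n) i ` cp_dom n i)"
    unfolding img by simp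
  show "homeomorphic_map (subtopology (cp_topology n) (cp_dom n i))
      (subtopology (cspace n) (cchart (CP n) i ` cp_dom n i))
      (cchart (CP n) i)"
    unfolding img subtopology_topspace homeomorphic_map_maps
    using homeomorphic_maps_cchart_cp i by blast
next
  fix i j k assume ijk: "i \<in> {..n}" "j \<in> {..n}" "k < n"
  let ?U = "cchart (CP n) j ` (cp_dom n i \<inter> cp_dom n j)"
  let ?F = "\<lambda>z. cchart (CP n) i (chart_inv (CP n) j z) k"
  have U: "z \<in> topspace (cspace n)" "insert_one j z i \<noteq> 0" if "z \<in> topspace (subtopology (cspace n) ?U)" for z
    using that cp_overlap(1,2)[of z n j i] by auto
  have coord: "continuous_map (subtopology (cspace n) ?U) euclidean (\<lambda>z. insert_one j z m)" for m
    by (cases m j rule: linorder_cases)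
       (auto simp: insert_one_def intro!: continuous_map_from_subtopology continuous_map_cspace_coord)
  have "continuous_map (subtopology (cspace n) ?U) euclidean
      (\<lambda>z. insert_one j z (skip_index i k) / insert_one j z i)"
    using U(2) by (intro continuous_map_divide coord)
  then have "continuous_map (subtopology (cspace n) ?U) euclidean ?F"
    by (rule continuous_map_eq) (use ijk U cp_transition in simp)
  moreover have "(\<lambda>w. ?F (z(l := w))) field_differentiable (at (z l))" if "z \<in> ?U" "l < n" for z l
    using cp_transition_derivative[OF _ cp_overlap(1,2)[OF that(1)] ijk(3) that(2)] ijk(2)
    by (auto simp: field_differentiable_def)
  ultimately show "holomorphic_cn n ?U ?F"
    by (simp add: holomorphic_cn_def)
qed

section \<open>Bundles over complex projective space\<close>

declare diag_block_mat.simps [simp del]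

lemma smult_smult_mat: "x \<cdot>\<^sub>m (y \<cdot>\<^sub>m A) = (x * y) \<cdot>\<^sub>m (A :: 'a::semigroup_mult mat)"
  by (rule eq_matI) (auto simp: mult.assoc)

lemma one_smult_mat [simp]: "1 \<cdot>\<^sub>m A = (A :: 'a::monoid_mult mat)"
  by (rule eq_matI) auto

lemma invertible_matI:
  fixes A :: "'a::field mat"
  assumes "A \<in> carrier_mat n n" "B \<in> carrier_mat n n" "A * B = 1\<^sub>m n"
  shows "invertible_mat A"
  using assms mat_mult_left_right_inverse[OF assms]
  by (auto simp: invertible_mat_def inverts_mat_def intro!: exI[of _ B])

lemma invertible_smult_mat:
  fixes A :: "'a::field mat"
  assumes "A \<in> carrier_mat n n" "B \<in> carrier_mat n n" "A * B = 1\<^sub>m n" "x \<noteq> 0"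
  shows "invertible_mat (x \<cdot>\<^sub>m A)"
proof (rule invertible_matI[of _ n "(1 / x) \<cdot>\<^sub>m B"])
  have "(x \<cdot>\<^sub>m A) * ((1 / x) \<cdot>\<^sub>m B) = (x * (1 / x)) \<cdot>\<^sub>m (A * B)"
    using assms by (simp add: mult_smult_assoc_mat[of _ n n _ n] mult_smult_distrib[of _ n n _ n] smult_smult_mat)
  then show "(x \<cdot>\<^sub>m A) * ((1 / x) \<cdot>\<^sub>m B) = 1\<^sub>m n"
    using assms by (auto intro!: eq_matI)
qed (use assms in auto)

lemma index_mult_mat_sum:
  assumes "A \<in> carrier_mat m n" "B \<in> carrier_mat n p" "k < m" "l < p"
  shows "(A * B) $$ (k, l) = (\<Sum>i<n. A $$ (k, i) * B $$ (i, l))"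
  using assms by (auto simp: scalar_prod_def lessThan_atLeast0)

lemma diag_block_mat_pair:
  assumes "A \<in> carrier_mat a a" "B \<in> carrier_mat b b"
  shows "diag_block_mat [A, B] = four_block_mat A (0\<^sub>m a b) (0\<^sub>m b a) B"
  using assms unfolding diag_block_mat.simps(2)[of A] diag_block_mat_singleton Let_def by simp

lemma diag_block_mat_pair_carrier:
  assumes "A \<in> carrier_mat a a" "B \<in> carrier_mat b b"
  shows "diag_block_mat [A, B] \<in> carrier_mat (a + b) (a + b)"
  using assms by (simp add: diag_block_mat_pair[OF assms])

lemma diag_block_mat_pair_index:
  assumes "A \<in> carrier_mat a a" "B \<in> carrier_mat b b" "k < a + b" "l < a + b"
  shows "diag_block_mat [A, B] $$ (k, l) =
    (if k < a then if l < a then A $$ (k, l) else 0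
     else if l < a then 0 else B $$ (k - a, l - a))"
  using assms by (simp add: diag_block_mat_pair[OF assms(1,2)])

lemma diag_block_mat_pair_mult:
  assumes "A \<in> carrier_mat a a" "B \<in> carrier_mat b b" "A' \<in> carrier_mat a a" "B' \<in> carrier_mat b b"
  shows "diag_block_mat [A, B] * diag_block_mat [A', B'] = diag_block_mat [A * A', B * B']"
proof -
  have "diag_block_mat [A * A', B * B'] = four_block_mat (A * A') (0\<^sub>m a b) (0\<^sub>m b a) (B * B')"
    using assms by (intro diag_block_mat_pair) auto
  then show ?thesis
    unfolding diag_block_mat_pair[OF assms(1,2)] diag_block_mat_pair[OF assms(3,4)]
    by (subst mult_four_block_mat[of _ a a _ b _ b _ _ a _ b]) (use assms in auto)
qed

lemma diag_block_mat_pair_one: "diag_block_mat [1\<^sub>m a, 1\<^sub>m b] = 1\<^sub>m (a + b)"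
  by (subst diag_block_mat_pair[of _ a _ b]) auto

lemma diag_block_mat_pair_scalar:
  fixes x :: "'a::comm_ring_1"
  shows "diag_block_mat [x \<cdot>\<^sub>m 1\<^sub>m a, x \<cdot>\<^sub>m 1\<^sub>m b] = x \<cdot>\<^sub>m 1\<^sub>m (a + b)"
  by (rule eq_matI) (auto simp: diag_block_mat_pair[of _ a _ b])

lemma scalar_mat_mult:
  fixes x y :: "'a::comm_ring_1"
  shows "(x \<cdot>\<^sub>m 1\<^sub>m n) * (y \<cdot>\<^sub>m 1\<^sub>m n) = (x * y) \<cdot>\<^sub>m 1\<^sub>m n"
  by (simp add: mult_smult_assoc_mat[of _ n n _ n] mult_smult_distrib[of _ n n _ n] smult_smult_mat
      mult.commute)

section \<open>Continuous matrix functions and direct sums of bundles\<close>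

lemma continuous_matrix_subset:
  assumes "continuous_matrix X V r g" "U \<subseteq> V"
  shows "continuous_matrix X U r g"
  using assms continuous_map_from_subtopology_mono[OF _ assms(2)]
  unfolding continuous_matrix_def by blast

lemma continuous_matrix_scalar:
  assumes "continuous_map (subtopology X U) euclidean f"
  shows "continuous_matrix X U r (\<lambda>x. f x \<cdot>\<^sub>m 1\<^sub>m r)"
proof -
  have "continuous_map (subtopology X U) euclidean (\<lambda>x. (f x \<cdot>\<^sub>m 1\<^sub>m r) $$ (k, l))"
    if "k < r" "l < r" for k l
    using that assms by (cases "k = l") auto
  then show ?thesis
    by (simp add: continuous_matrix_def)
qed

lemma continuous_matrix_diag:
  assumes A: "continuous_matrix X U a A" and B: "continuous_matrix X U b B"
  shows "continuous_matrix X U (a + b) (\<lambda>x. diag_block_mat [A x, B x])"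
  unfolding continuous_matrix_def
proof (intro conjI ballI allI impI)
  have dim: "A x \<in> carrier_mat a a" "B x \<in> carrier_mat b b" if "x \<in> U" for x
    using A B that by (auto simp: continuous_matrix_def)
  show "diag_block_mat [A x, B x] \<in> carrier_mat (a + b) (a + b)" if "x \<in> U" for x
    using dim[OF that] by (rule diag_block_mat_pair_carrier)
  fix k l assume kl: "k < a + b" "l < a + b"
  have "continuous_map (subtopology X U) euclidean (\<lambda>x. if k < a then if l < a then A x $$ (k, l) else 0
     else if l < a then 0 else B x $$ (k - a, l - a))"
    using A B kl by (auto simp: continuous_matrix_def)
  then show "continuous_map (subtopology X U) euclidean (\<lambda>x. diag_block_mat [A x, B x] $$ (k, l))"
    by (rule continuous_map_eq) (use dim kl in \<open>simp add: diag_block_mat_pair_index[of _ a _ b]\<close>)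
qed

lemma direct_sum_bundle_simps [simp]:
  "brank (direct_sum_bundle E F) = brank E + brank F"
  "bidx (direct_sum_bundle E F) = prod_encode ` (bidx E \<times> bidx F)"
  "bdom (direct_sum_bundle E F) (prod_encode (i, k)) = bdom E i \<inter> bdom F k"
  "btrans (direct_sum_bundle E F) (prod_encode (i, k)) (prod_encode (j, l)) x
     = diag_block_mat [btrans E i j x, btrans F k l x]"
  by (simp_all add: direct_sum_bundle_def)

lemma complex_vector_bundle_direct_sum:
  assumes E: "complex_vector_bundle X E" and F: "complex_vector_bundle X F"
  shows "complex_vector_bundle X (direct_sum_bundle E F)"
proof -
  have cE: "continuous_matrix X (bdom E i \<inter> bdom E j) (brank E) (btrans E i j)"
    if "i \<in> bidx E" "j \<in> bidx E" for i j
    using E that by (simp add: complex_vector_bundle_def)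
  have cF: "continuous_matrix X (bdom F i \<inter> bdom F j) (brank F) (btrans F i j)"
    if "i \<in> bidx F" "j \<in> bidx F" for i j
    using F that by (simp add: complex_vector_bundle_def)
  have dE: "btrans E i j x \<in> carrier_mat (brank E) (brank E)"
    if "i \<in> bidx E" "j \<in> bidx E" "x \<in> bdom E i" "x \<in> bdom E j" for i j x
    using cE[of i j] that by (simp add: continuous_matrix_def)
  have dF: "btrans F i j x \<in> carrier_mat (brank F) (brank F)"
    if "i \<in> bidx F" "j \<in> bidx F" "x \<in> bdom F i" "x \<in> bdom F j" for i j x
    using cF[of i j] that by (simp add: continuous_matrix_def)
  have "continuous_matrix X ((bdom E i \<inter> bdom F k) \<inter> (bdom E j \<inter> bdom F l)) (brank E + brank F)
      (btrans (direct_sum_bundle E F) (prod_encode (i, k)) (prod_encode (j, l)))"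
    if "i \<in> bidx E" "j \<in> bidx E" "k \<in> bidx F" "l \<in> bidx F" for i j k l
  proof -
    have "continuous_matrix X ((bdom E i \<inter> bdom F k) \<inter> (bdom E j \<inter> bdom F l)) (brank E + brank F)
      (\<lambda>x. diag_block_mat [btrans E i j x, btrans F k l x])"
      by (intro continuous_matrix_diag continuous_matrix_subset[OF cE[OF that(1,2)]]
          continuous_matrix_subset[OF cF[OF that(3,4)]]) auto
    then show ?thesis
      by (simp add: direct_sum_bundle_def)
  qed
  moreover have "diag_block_mat [btrans E i j x, btrans F k l x] * diag_block_mat [btrans E j m x, btrans F l p x]
      = diag_block_mat [btrans E i m x, btrans F k p x]"
    if "i \<in> bidx E" "j \<in> bidx E" "m \<in> bidx E" "k \<in> bidx F" "l \<in> bidx F" "p \<in> bidx F"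
      "x \<in> bdom E i" "x \<in> bdom E j" "x \<in> bdom E m" "x \<in> bdom F k" "x \<in> bdom F l" "x \<in> bdom F p"
    for i j m k l p x
    using that E F diag_block_mat_pair_mult[OF dE[of i j x] dF[of k l x] dE[of j m x] dF[of l p x]]
    by (simp add: complex_vector_bundle_def)
  moreover have "(\<Union>q\<in>bidx (direct_sum_bundle E F). bdom (direct_sum_bundle E F) q) = topspace X"
  proof -
    have "(\<Union>q\<in>bidx (direct_sum_bundle E F). bdom (direct_sum_bundle E F) q)
        = (\<Union>i\<in>bidx E. bdom E i) \<inter> (\<Union>i\<in>bidx F. bdom F i)"
      by auto
    then show ?thesis
      using E F by (simp add: complex_vector_bundle_def)
  qed
  ultimately show ?thesis
    using E F unfolding complex_vector_bundle_def
    by (auto simp: diag_block_mat_pair_one)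
qed

lemma complex_vector_bundle_trivial: "complex_vector_bundle X (trivial_bundle X r)"
proof -
  have "continuous_matrix X (topspace X) r (\<lambda>x. 1\<^sub>m r)"
    by (simp add: continuous_matrix_def)
  then show ?thesis
    by (simp add: complex_vector_bundle_def trivial_bundle_def)
qed

text \<open>The m-fold sum of the hyperplane bundle over the standard cover, with scalar transition
  matrices; an iterated \<open>direct_sum_bundle\<close> would live over iterated refinements of the
  cover.\<close>

definition hyperplane_multiple :: "nat \<Rightarrow> nat \<Rightarrow> point cbundle" where
  "hyperplane_multiple n m =
     \<lparr>brank = m, bidx = {..n}, bdom = cp_dom n, btrans = (\<lambda>i j L. normal_rep i L j \<cdot>\<^sub>m 1\<^sub>m m)\<rparr>"

lemma hyperplane_multiple_simps [simp]:
  "brank (hyperplane_multiple n m) = m"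
  "bidx (hyperplane_multiple n m) = {..n}"
  "bdom (hyperplane_multiple n m) = cp_dom n"
  "btrans (hyperplane_multiple n m) i j L = normal_rep i L j \<cdot>\<^sub>m 1\<^sub>m m"
  by (simp_all add: hyperplane_multiple_def)

lemma hyperplane_bundle_multiple: "hyperplane_bundle n = hyperplane_multiple n 1"
proof -
  have "mat 1 1 (\<lambda>_. x) = x \<cdot>\<^sub>m 1\<^sub>m 1" for x :: complex
    by (rule eq_matI) auto
  then show ?thesis
    by (simp add: hyperplane_bundle_def hyperplane_multiple_def)
qed

lemma normal_rep_mult:
  assumes "L \<in> cp_dom n i" "L \<in> cp_dom n j"
  shows "normal_rep i L j * normal_rep j L k = normal_rep i L k"
  using normal_rep_change[OF assms] by simp

lemma complex_vector_bundle_hyperplane_multiple: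
  "complex_vector_bundle (cp_topology n) (hyperplane_multiple n m)"
  unfolding complex_vector_bundle_def
proof (intro conjI ballI)
  show "openin (cp_topology n) (bdom (hyperplane_multiple n m) i)" for i
    by (simp add: openin_cp_dom)
  show "(\<Union>i\<in>bidx (hyperplane_multiple n m). bdom (hyperplane_multiple n m) i) = topspace (cp_topology n)"
    using cp_dom_covers by simp
  show "continuous_matrix (cp_topology n)
      (bdom (hyperplane_multiple n m) i \<inter> bdom (hyperplane_multiple n m) j)
      (brank (hyperplane_multiple n m)) (btrans (hyperplane_multiple n m) i j)" for i j
    using continuous_matrix_scalar[OF continuous_normal_rep_subset[of "cp_dom n i \<inter> cp_dom n j" n i j]]
    by (simp add: hyperplane_multiple_def)
qed (auto simp: scalar_mat_mult normal_rep_mult normal_rep_self)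

lemma bundle_iso_hyperplane_sum:
  "bundle_iso (cp_topology n) (direct_sum_bundle (hyperplane_bundle n) (hyperplane_multiple n m))
     (hyperplane_multiple n (1 + m))"
proof -
  \<comment> \<open>The pair coded by q consists of the charts of the two summands; each block
    rescales its summand to the common chart a.\<close>
  define h where "h = (\<lambda>a q L. diag_block_mat
    [normal_rep a L (fst (prod_decode q)) \<cdot>\<^sub>m 1\<^sub>m 1, normal_rep a L (snd (prod_decode q)) \<cdot>\<^sub>m 1\<^sub>m m])"
  let ?E = "direct_sum_bundle (hyperplane_multiple n 1) (hyperplane_multiple n m)"
  let ?F = "hyperplane_multiple n (1 + m)"
  have "continuous_matrix (cp_topology n) (cp_dom n a \<inter> (cp_dom n i \<inter> cp_dom n k)) (1 + m)
      (h a (prod_encode (i, k)))" for a i k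
    unfolding h_def prod_encode_inverse fst_conv snd_conv
    by (intro continuous_matrix_diag continuous_matrix_scalar continuous_normal_rep_subset) auto
  moreover have "invertible_mat (h a (prod_encode (i, k)) L)"
    if L: "L \<in> cp_dom n a" "L \<in> cp_dom n i" "L \<in> cp_dom n k" for a i k L
  proof (rule invertible_matI)
    let ?x = "normal_rep a L i" and ?y = "normal_rep a L k"
    let ?B = "diag_block_mat [(1 / ?x) \<cdot>\<^sub>m 1\<^sub>m 1, (1 / ?y) \<cdot>\<^sub>m 1\<^sub>m m]"
    show "h a (prod_encode (i, k)) L \<in> carrier_mat (1 + m) (1 + m)" "?B \<in> carrier_mat (1 + m) (1 + m)"
      unfolding h_def by (intro diag_block_mat_pair_carrier; simp)+
    have "?x \<noteq> 0" "?y \<noteq> 0"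
      using normal_rep_change(2) L by auto
    then show "h a (prod_encode (i, k)) L * ?B = 1\<^sub>m (1 + m)"
      unfolding h_def prod_encode_inverse fst_conv snd_conv
      by (subst diag_block_mat_pair_mult[of _ 1 _ m])
         (simp_all add: scalar_mat_mult diag_block_mat_pair_one)
  qed
  moreover have "h a (prod_encode (i, k)) L * btrans ?E (prod_encode (i, k)) (prod_encode (j, l)) L
      = btrans ?F a b L * h b (prod_encode (j, l)) L"
    if L: "L \<in> cp_dom n a" "L \<in> cp_dom n b" "L \<in> cp_dom n i" "L \<in> cp_dom n k"
      "L \<in> cp_dom n j" "L \<in> cp_dom n l" for a b i k j l L
  proof -
    have "h a (prod_encode (i, k)) L * btrans ?E (prod_encode (i, k)) (prod_encode (j, l)) L
        = diag_block_mat [normal_rep a L j \<cdot>\<^sub>m 1\<^sub>m 1, normal_rep a L l \<cdot>\<^sub>m 1\<^sub>m m]"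
      unfolding h_def prod_encode_inverse fst_conv snd_conv direct_sum_bundle_simps hyperplane_multiple_simps
      by (subst diag_block_mat_pair_mult[of _ 1 _ m])
         (simp_all add: scalar_mat_mult normal_rep_mult[OF L(1,3)] normal_rep_mult[OF L(1,4)]
          )
    also have "\<dots> = btrans ?F a b L * h b (prod_encode (j, l)) L"
      unfolding h_def prod_encode_inverse fst_conv snd_conv hyperplane_multiple_simps
        diag_block_mat_pair_scalar[symmetric]
      by (subst diag_block_mat_pair_mult[of _ 1 _ m])
         (simp_all add: scalar_mat_mult normal_rep_mult[OF L(1,2)])
    finally show ?thesis .
  qed
  ultimately show ?thesis
    unfolding bundle_iso_def hyperplane_bundle_multiple
    by (intro conjI exI[of _ h]) auto
qed

section \<open>Restriction to a hyperplane\<close>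

lemma cvecs_Suc: "cvecs n \<subseteq> cvecs (Suc n)"
proof
  fix v assume v: "v \<in> cvecs n"
  then obtain k where "k \<le> n" "v k \<noteq> 0"
    by (auto simp: cvecs_iff)
  then have "\<exists>k\<le>Suc n. v k \<noteq> 0"
    using le_SucI by blast
  then show "v \<in> cvecs (Suc n)"
    using v by (simp add: cvecs_iff)
qed

lemma cp_points_Suc: "cp_points n \<subseteq> cp_points (Suc n)"
  unfolding cp_points_cvecs by (intro image_mono cvecs_Suc)

lemma cp_dom_Suc: "L \<in> cp_points n \<Longrightarrow> L \<in> cp_dom (Suc n) i \<longleftrightarrow> L \<in> cp_dom n i"
  using cp_points_Suc by (auto simp: cp_dom_def)

lemma continuous_map_cp_inclusion: "continuous_map (cp_topology n) (cp_topology (Suc n)) (\<lambda>L. L)"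
proof (rule continuous_compose_quotient_map[OF quotient_map_cline])
  have "continuous_map (cpunctured n) (cpunctured (Suc n)) (\<lambda>v. v)"
    using cvecs_Suc[of n]
    by (auto simp: continuous_map_in_subtopology continuous_map_into_cspace topspace_cspace
        intro!: continuous_map_from_subtopology continuous_map_cspace_coord)
  then show "continuous_map (cpunctured n) (cp_topology (Suc n)) ((\<lambda>L. L) \<circ> cline)"
    using continuous_map_compose quotient_imp_continuous_map[OF quotient_map_cline]
    by (fastforce simp: o_def)
qed

text \<open>Both bundles have the transition functions z_j / z_i. The pulled back cover has one more
  index, whose domain contains no line of CP^n because the last coordinate vanishes there.\<close>

lemma bundle_iso_hyperplane_restrict:
  "bundle_iso (cp_topology n) (pullback_bundle (cp_topology n) (\<lambda>L. L) (hyperplane_bundle (Suc n)))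
     (hyperplane_bundle n)"
proof -
  define h where "h = (\<lambda>a i L. normal_rep a L i \<cdot>\<^sub>m (1\<^sub>m 1 :: complex mat))"
  let ?E = "pullback_bundle (cp_topology n) (\<lambda>L. L) (hyperplane_multiple (Suc n) 1)"
  have dom: "L \<in> bdom ?E i \<longleftrightarrow> L \<in> cp_dom n i" for L i
    using cp_dom_Suc[of L n i] by (auto simp: pullback_bundle_def cp_dom_def)
  have "continuous_matrix (cp_topology n) (cp_dom n a \<inter> bdom ?E i) 1 (h a i)" for a i
    unfolding h_def by (intro continuous_matrix_scalar continuous_normal_rep_subset) auto
  moreover have "invertible_mat (h a i L)" if "L \<in> cp_dom n a" "L \<in> bdom ?E i" for a i L
    unfolding h_def using normal_rep_change(2)[of L n a i] that dom
    by (intro invertible_smult_mat[of _ 1 "1\<^sub>m 1"]) auto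
  moreover have "h a i L * btrans ?E i j L = btrans (hyperplane_multiple n 1) a b L * h b j L"
    if "L \<in> cp_dom n a" "L \<in> cp_dom n b" "L \<in> bdom ?E i" "L \<in> bdom ?E j" for a b i j L
    using that dom normal_rep_mult[of L n a i j] normal_rep_mult[of L n a b j]
    by (simp add: h_def pullback_bundle_def scalar_mat_mult)
  ultimately show ?thesis
    unfolding bundle_iso_def hyperplane_bundle_multiple
    by (intro conjI exI[of _ h]) (auto simp: pullback_bundle_def)
qed

text \<open>The two matrices implement the splitting of the Euler sequence by the Hermitian metric: a
  tangent vector at a line is a homomorphism to the orthogonal complement of the line, and the
  trivial summand is spanned by the inclusion of the line.\<close>

definition euler_mat :: "nat \<Rightarrow> nat \<Rightarrow> (nat \<Rightarrow> complex) \<Rightarrow> complex mat" where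
  "euler_mat n i w = mat (Suc n) (Suc n) (\<lambda>(k, c).
     if k < n then of_bool (skip_index i k = c) - w (skip_index i k) * of_bool (i = c)
     else cnj (w c) / hnorm n w)"

definition euler_inv :: "nat \<Rightarrow> nat \<Rightarrow> (nat \<Rightarrow> complex) \<Rightarrow> complex mat" where
  "euler_inv n i w = mat (Suc n) (Suc n) (\<lambda>(c, l).
     if l < n then of_bool (c = skip_index i l) - cnj (w (skip_index i l)) * w c / hnorm n w else w c)"

lemma euler_mat_carrier [simp]:
  "euler_mat n i w \<in> carrier_mat (Suc n) (Suc n)" "euler_inv n i w \<in> carrier_mat (Suc n) (Suc n)"
  by (simp_all add: euler_mat_def euler_inv_def)

lemma euler_mat_dim [simp]: "dim_row (euler_mat n i w) = Suc n" "dim_col (euler_mat n i w) = Suc n"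
  by (simp_all add: euler_mat_def)

lemma sum_of_bool_mult:
  fixes X :: "nat \<Rightarrow> 'a::comm_ring_1"
  shows "A \<le> n \<Longrightarrow> (\<Sum>b\<le>n. of_bool (A = b) * X b) = X A"
    and "A \<le> n \<Longrightarrow> (\<Sum>b\<le>n. X b * of_bool (b = A)) = X A"
  by (simp_all add: of_bool_def mult_delta_left mult_delta_right)

lemma skip_index_le: "k < n \<Longrightarrow> skip_index i k \<le> n"
  by (simp add: skip_index_def)

text \<open>The first n rows of \<open>euler_mat\<close> are the differentials at w of the affine
  coordinates of chart i and annihilate w; its last row is the normalised Hermitian product with w.
  The columns of \<open>euler_inv\<close> are the standard vectors other than the i-th, projected
  orthogonally to w, followed by w itself.\<close>

lemma euler_mat_inverse:
  assumes w: "w \<in> cvecs n" "w i = 1"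
  shows "euler_mat n i w * euler_inv n i w = 1\<^sub>m (Suc n)"
proof (rule eq_matI)
  fix k l assume kl: "k < dim_row (1\<^sub>m (Suc n))" "l < dim_col (1\<^sub>m (Suc n))"
  have i: "i \<le> n"
    using w by (auto simp: cvecs_iff intro: leI)
  let ?Z = "\<lambda>c. if l < n then of_bool (c = skip_index i l) - cnj (w (skip_index i l)) * w c / hnorm n w else w c"
  have prod: "(euler_mat n i w * euler_inv n i w) $$ (k, l)
      = (\<Sum>c\<le>n. (if k < n then of_bool (skip_index i k = c) - w (skip_index i k) * of_bool (i = c)
          else cnj (w c) / hnorm n w) * ?Z c)"
    using kl by (subst index_mult_mat_sum[of _ "Suc n" "Suc n" _ "Suc n"])
      (auto simp: euler_mat_def euler_inv_def lessThan_Suc_atMost)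
  show "(euler_mat n i w * euler_inv n i w) $$ (k, l) = 1\<^sub>m (Suc n) $$ (k, l)"
  proof (cases "k < n")
    case True
    have "(euler_mat n i w * euler_inv n i w) $$ (k, l)
        = (\<Sum>c\<le>n. of_bool (skip_index i k = c) * ?Z c) - w (skip_index i k) * (\<Sum>c\<le>n. of_bool (i = c) * ?Z c)"
      unfolding prod using True
      by (simp only: if_True left_diff_distrib sum_subtractf sum_distrib_left mult.assoc)
    also have "\<dots> = ?Z (skip_index i k) - w (skip_index i k) * ?Z i"
      by (simp only: sum_of_bool_mult(1)[OF skip_index_le[OF True]] sum_of_bool_mult(1)[OF i])
    finally show ?thesis
      using True kl w by auto
  next
    case False
    then have "(euler_mat n i w * euler_inv n i w) $$ (k, l) = (\<Sum>c\<le>n. cnj (w c) * ?Z c) / hnorm n w"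
      unfolding prod by (simp add: sum_divide_distrib)
    also have "\<dots> = (if l < n then 0 else 1)"
    proof (cases "l < n")
      case True
      have "(\<Sum>c\<le>n. cnj (w c) * ?Z c) = (\<Sum>c\<le>n. cnj (w c) * of_bool (c = skip_index i l))
          - (cnj (w (skip_index i l)) / hnorm n w) * hnorm n w"
        using True by (simp add: right_diff_distrib sum_subtractf hnorm_def[of n w] sum_distrib_left
            sum_divide_distrib mult_ac)
      also have "\<dots> = 0"
        using hnorm_nonzero[OF w(1)] by (simp add: sum_of_bool_mult(2)[OF skip_index_le[OF True]])
      finally show ?thesis
        using True by simp
    next
      case False
      then show ?thesis
        using hnorm_nonzero[OF w(1)] by (simp add: hnorm_def mult.commute)
    qed
    finally show ?thesis
      using False kl by auto
  qed
qed (simp_all add: euler_mat_def euler_inv_def)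

text \<open>The Jacobian of the change from chart j to chart i in terms of the vector w normalised
  at i. The reciprocal of the i-th coordinate of the vector normalised at j is \<open>w j\<close>,
  so no division occurs.\<close>

definition tangent_transition :: "nat \<Rightarrow> nat \<Rightarrow> nat \<Rightarrow> (nat \<Rightarrow> complex) \<Rightarrow> complex mat" where
  "tangent_transition n i j w = mat n n (\<lambda>(k, l).
     w j * (of_bool (skip_index i k = skip_index j l) - w (skip_index i k) * of_bool (i = skip_index j l)))"

lemma tangent_bundle_cp_simps [simp]:
  "brank (tangent_bundle (CP n)) = n"
  "bidx (tangent_bundle (CP n)) = {..n}"
  "bdom (tangent_bundle (CP n)) = cp_dom n"
  by (simp_all add: tangent_bundle_def)

lemma tangent_bundle_cp_btrans:
  assumes L: "L \<in> cp_dom n i" "L \<in> cp_dom n j"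
  shows "btrans (tangent_bundle (CP n)) i j L
    = tangent_transition n i j (normal_rep i L)"
proof (rule eq_matI)
  let ?z = "cchart (CP n) j L"
  let ?w = "normal_rep j L" and ?v = "normal_rep i L"
  fix k l assume "k < dim_row (tangent_transition n i j ?v)" "l < dim_col (tangent_transition n i j ?v)"
  then have kl: "k < n" "l < n"
    by (simp_all add: tangent_transition_def)
  have w: "insert_one j ?z = ?w"
    by (rule insert_one_cchart[OF L(2)])
  have wi: "?w i \<noteq> 0"
    by (rule normal_rep_change(2)[OF L(2,1)])
  have v: "?v m = ?w m / ?w i" for m
    by (rule normal_rep_change(1)[OF L(2,1)])
  have "btrans (tangent_bundle (CP n)) i j L $$ (k, l)
      = (of_bool (skip_index i k = skip_index j l) * ?w i
        - ?w (skip_index i k) * of_bool (i = skip_index j l)) / (?w i)\<^sup>2"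
    using kl DERIV_imp_deriv[OF cp_transition_derivative[OF cp_dom_index[OF L(2)] cchart_cp_in_cspace, of j L i k l]]
      wi by (simp add: tangent_bundle_def cpartial_def w)
  also have "\<dots> = tangent_transition n i j ?v $$ (k, l)"
    using kl wi by (simp add: tangent_transition_def v normal_rep_self[OF L(2)] power2_eq_square field_simps)
  finally show "btrans (tangent_bundle (CP n)) i j L $$ (k, l)
      = tangent_transition n i j ?v $$ (k, l)" .
qed (simp_all add: tangent_bundle_def tangent_transition_def)

text \<open>As X vanishes at the omitted index j, the sum over chart coordinates extends to all
  homogeneous indices, where each Kronecker symbol picks one value.\<close>

lemma tangent_transition_row:
  fixes X :: "nat \<Rightarrow> complex"
  assumes "j \<le> n" "i \<le> n" "A \<le> n" "X j = 0"
  shows "(\<Sum>l<n. (of_bool (A = skip_index j l) - p * of_bool (i = skip_index j l)) * X (skip_index j l))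
    = X A - p * X i"
proof -
  let ?f = "\<lambda>b. (of_bool (A = b) - p * of_bool (i = b)) * X b"
  have "(\<Sum>l<n. ?f (skip_index j l)) = sum ?f (skip_index j ` {..<n})"
    by (subst sum.reindex) (auto simp: inj_on_def)
  also have "\<dots> = sum ?f {..n}"
    unfolding skip_index_image[OF assms(1)] using assms(4)
    by (intro sum.mono_neutral_left) auto
  also have "\<dots> = (\<Sum>b\<le>n. of_bool (A = b) * X b) - p * (\<Sum>b\<le>n. of_bool (i = b) * X b)"
    by (simp only: left_diff_distrib sum_subtractf sum_distrib_left mult.assoc)
  finally show ?thesis
    by (simp only: sum_of_bool_mult(1)[OF assms(3)] sum_of_bool_mult(1)[OF assms(2)])
qed

text \<open>The same sum occurs in the cocycle condition and in the comparison with hyperplane bundles.\<close>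

lemma tangent_transition_sum:
  assumes L: "L \<in> cp_dom n i" "L \<in> cp_dom n j" and k: "k < n"
  shows "(\<Sum>l<n. tangent_transition n i j (normal_rep i L) $$ (k, l) *
      (of_bool (skip_index j l = c) - normal_rep j L (skip_index j l) * of_bool (j = c)))
    = normal_rep i L j * (of_bool (skip_index i k = c) - normal_rep i L (skip_index i k) * of_bool (i = c))"
proof -
  let ?v = "normal_rep i L" and ?w = "normal_rep j L"
  \<comment> \<open>Vanishes at j because \<open>?w j\<close> is 1, as
    \<open>tangent_transition_row\<close> requires.\<close>
  let ?X = "\<lambda>b. of_bool (b = c) - ?w b * of_bool (j = c)"
  have "(\<Sum>l<n. tangent_transition n i j ?v $$ (k, l) * ?X (skip_index j l))
      = (\<Sum>l<n. ?v j * ((of_bool (skip_index i k = skip_index j l)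
          - ?v (skip_index i k) * of_bool (i = skip_index j l)) * ?X (skip_index j l)))"
    using k by (intro sum.cong refl) (simp add: tangent_transition_def mult.assoc)
  also have "\<dots> = ?v j * (?X (skip_index i k) - ?v (skip_index i k) * ?X i)"
    unfolding sum_distrib_left[symmetric]
    using cp_dom_index[OF L(1)] cp_dom_index[OF L(2)] skip_index_le[OF k] normal_rep_self[OF L(2)]
    by (subst tangent_transition_row) auto
  also have "?X (skip_index i k) - ?v (skip_index i k) * ?X i
      = of_bool (skip_index i k = c) - ?v (skip_index i k) * of_bool (i = c)"
    using normal_rep_change[OF L(2,1)] by (simp add: algebra_simps)
  finally show ?thesis .
qed

lemma tangent_transition_carrier [simp]: "tangent_transition n i j w \<in> carrier_mat n n"
  by (simp add: tangent_transition_def)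

text \<open>The chain rule for the charts, read off from \<open>tangent_transition_sum\<close> at c
  = \<open>skip_index m p\<close>.\<close>

lemma tangent_transition_mult:
  assumes L: "L \<in> cp_dom n i" "L \<in> cp_dom n j" "L \<in> cp_dom n m"
  shows "tangent_transition n i j (normal_rep i L) * tangent_transition n j m (normal_rep j L)
    = tangent_transition n i m (normal_rep i L)"
proof (rule eq_matI)
  let ?v = "normal_rep i L" and ?w = "normal_rep j L"
  fix k p assume "k < dim_row (tangent_transition n i m ?v)" "p < dim_col (tangent_transition n i m ?v)"
  then have kp: "k < n" "p < n"
    by (simp_all add: tangent_transition_def)
  have "(tangent_transition n i j ?v * tangent_transition n j m ?w) $$ (k, p)
      = (\<Sum>l<n. tangent_transition n i j ?v $$ (k, l) * (?w m *
        (of_bool (skip_index j l = skip_index m p) - ?w (skip_index j l) * of_bool (j = skip_index m p))))"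
    using kp by (subst index_mult_mat_sum[of _ n n _ n])
      (auto simp: tangent_transition_def intro!: sum.cong)
  also have "\<dots> = ?w m * (\<Sum>l<n. tangent_transition n i j ?v $$ (k, l) *
        (of_bool (skip_index j l = skip_index m p) - ?w (skip_index j l) * of_bool (j = skip_index m p)))"
    by (simp only: sum_distrib_left mult.left_commute)
  also have "\<dots> = (?v j * ?w m) * (of_bool (skip_index i k = skip_index m p)
      - ?v (skip_index i k) * of_bool (i = skip_index m p))"
    unfolding tangent_transition_sum[OF L(1,2) kp(1)] by (simp only: mult_ac)
  also have "\<dots> = tangent_transition n i m ?v $$ (k, p)"
    unfolding normal_rep_mult[OF L(1,2)] using kp by (simp add: tangent_transition_def)
  finally show "(tangent_transition n i j ?v * tangent_transition n j m ?w) $$ (k, p)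
      = tangent_transition n i m ?v $$ (k, p)" .
qed (simp_all add: tangent_transition_def)

lemma continuous_matrix_cong:
  assumes "continuous_matrix X U r g" "\<And>x. x \<in> U \<Longrightarrow> g x = h x"
  shows "continuous_matrix X U r h"
  unfolding continuous_matrix_def
proof (intro conjI ballI allI impI)
  show "h x \<in> carrier_mat r r" if "x \<in> U" for x
    using assms that by (metis continuous_matrix_def)
  show "continuous_map (subtopology X U) euclidean (\<lambda>x. h x $$ (k, l))" if "k < r" "l < r" for k l
    by (rule continuous_map_eq[of _ _ "\<lambda>x. g x $$ (k, l)"])
       (use assms that in \<open>auto simp: continuous_matrix_def\<close>)
qed

lemma complex_vector_bundle_tangent_cp:
  "complex_vector_bundle (cp_topology n) (tangent_bundle (CP n))"
proof -
  let ?T = "tangent_bundle (CP n)"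
  have cont: "continuous_matrix (cp_topology n) (cp_dom n i \<inter> cp_dom n j) n (btrans ?T i j)" for i j
  proof (rule continuous_matrix_cong)
    have "continuous_map (subtopology (cp_topology n) (cp_dom n i \<inter> cp_dom n j)) euclidean
        (\<lambda>L. tangent_transition n i j (normal_rep i L) $$ (k, l))" if "k < n" "l < n" for k l
      using that unfolding tangent_transition_def
      by (auto intro!: continuous_intros continuous_normal_rep_subset)
    then show "continuous_matrix (cp_topology n) (cp_dom n i \<inter> cp_dom n j) n
        (\<lambda>L. tangent_transition n i j (normal_rep i L))"
      by (simp add: continuous_matrix_def)
  qed (simp add: tangent_bundle_cp_btrans)
  have "tangent_transition n i i (normal_rep i L) = 1\<^sub>m n" if "L \<in> cp_dom n i" for i L
    by (rule eq_matI) (auto simp: tangent_transition_def normal_rep_self[OF that])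
  then show ?thesis
    unfolding complex_vector_bundle_def
    using cont openin_cp_dom cp_dom_covers
    by (auto simp: tangent_bundle_cp_btrans tangent_transition_mult)
qed

text \<open>The splitting matrices intertwine the cocycle of the tangent bundle plus a trivial line
  with the scalar cocycle of the hyperplane bundle. In the tangent rows this is
  \<open>tangent_transition_sum\<close>; the last row, the conjugate vector over its squared norm,
  is divided by x when the vector is multiplied by x.\<close>

lemma euler_mat_transition:
  assumes L: "L \<in> cp_dom n a" "L \<in> cp_dom n b"
  shows "diag_block_mat [tangent_transition n a b (normal_rep a L), 1\<^sub>m 1] * euler_mat n b (normal_rep b L)
    = normal_rep a L b \<cdot>\<^sub>m euler_mat n a (normal_rep a L)"
proof (rule eq_matI)
  let ?v = "normal_rep a L" and ?w = "normal_rep b L"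
  define D where "D = diag_block_mat [tangent_transition n a b ?v, 1\<^sub>m 1]"
  fix k c assume "k < dim_row (?v b \<cdot>\<^sub>m euler_mat n a ?v)" "c < dim_col (?v b \<cdot>\<^sub>m euler_mat n a ?v)"
  then have kc: "k < Suc n" "c < Suc n"
    by (simp_all add: euler_mat_def)
  have D: "D \<in> carrier_mat (Suc n) (Suc n)"
    unfolding D_def using diag_block_mat_pair_carrier[of "tangent_transition n a b ?v" n "1\<^sub>m 1" 1] by simp
  have Dkl: "D $$ (k, l) = (if k < n then if l < n then tangent_transition n a b ?v $$ (k, l) else 0
      else if l < n then 0 else 1)" if "l < Suc n" for l
    unfolding D_def using that kc by (subst diag_block_mat_pair_index[of _ n _ 1]) auto
  have prod: "(D * euler_mat n b ?w) $$ (k, c) = (\<Sum>l<n. D $$ (k, l) * euler_mat n b ?w $$ (l, c))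
      + D $$ (k, n) * euler_mat n b ?w $$ (n, c)"
    by (subst index_mult_mat_sum[OF D euler_mat_carrier(1) kc]) (simp)
  have "(D * euler_mat n b ?w) $$ (k, c) = ?v b * euler_mat n a ?v $$ (k, c)"
  proof (cases "k < n")
    case True
    have "(\<Sum>l<n. D $$ (k, l) * euler_mat n b ?w $$ (l, c)) =
        (\<Sum>l<n. tangent_transition n a b ?v $$ (k, l) *
          (of_bool (skip_index b l = c) - ?w (skip_index b l) * of_bool (b = c)))"
      using kc True by (intro sum.cong refl) (simp add: Dkl euler_mat_def)
    then show ?thesis
      using True kc unfolding prod
      by (simp add: Dkl tangent_transition_sum[OF L True]) (simp add: euler_mat_def)
  next
    case False
    have v: "?v m = ?v b * ?w m" for m
      by (rule normal_rep_mult[OF L, symmetric])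
    have vb: "?v b \<noteq> 0"
      by (rule normal_rep_change(2)[OF L])
    have "hnorm n ?v = ?v b * cnj (?v b) * hnorm n ?w"
      unfolding hnorm_def sum_distrib_left by (intro sum.cong refl) (subst (1 2) v, simp)
    then have "cnj (?w c) / hnorm n ?w = ?v b * (cnj (?v c) / hnorm n ?v)"
      using vb by (subst v) (simp add: field_simps)
    then show ?thesis
      using False kc unfolding prod by (simp add: Dkl euler_mat_def)
  qed
  then show "(diag_block_mat [tangent_transition n a b ?v, 1\<^sub>m 1] * euler_mat n b ?w) $$ (k, c) = (?v b \<cdot>\<^sub>m euler_mat n a ?v) $$ (k, c)"
    unfolding D_def[symmetric] using kc by (simp add: euler_mat_def)
qed (simp_all add: dim_diag_block_mat euler_mat_def tangent_transition_def)

lemma bundle_iso_euler: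
  "bundle_iso (cp_topology n) (hyperplane_multiple n (Suc n))
     (direct_sum_bundle (tangent_bundle (CP n)) (trivial_bundle (cp_topology n) 1))"
proof -
  let ?E = "hyperplane_multiple n (Suc n)" and ?T = "tangent_bundle (CP n)"
  let ?F = "direct_sum_bundle ?T (trivial_bundle (cp_topology n) 1)"
  \<comment> \<open>The scalar carries the multiple of the hyperplane bundle from chart i to the
    chart of the tangent bundle that is the first entry of q; the second entry is 0, the only index
    of the trivial bundle.\<close>
  define h where "h = (\<lambda>q i L. normal_rep (fst (prod_decode q)) L i \<cdot>\<^sub>m
    euler_mat n (fst (prod_decode q)) (normal_rep (fst (prod_decode q)) L))"
  have rep: "normal_rep a L \<in> cvecs n" if "L \<in> cp_dom n a" for a L
    using that by (elim cp_dom_cases) simp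
  have "continuous_matrix (cp_topology n) (cp_dom n a \<inter> cp_dom n i) (Suc n) (h (prod_encode (a, 0)) i)" for a i
  proof -
    have "continuous_map (subtopology (cp_topology n) (cp_dom n a \<inter> cp_dom n i)) euclidean
        (\<lambda>L. euler_mat n a (normal_rep a L) $$ (k, c))" if "k < Suc n" "c < Suc n" for k c
      using that hnorm_nonzero[OF rep] unfolding euler_mat_def hnorm_def
      by (cases "k < n") (auto intro!: continuous_intros continuous_normal_rep_subset)
    moreover have "continuous_map (subtopology (cp_topology n) (cp_dom n a \<inter> cp_dom n i)) euclidean
        (\<lambda>L. normal_rep a L i)"
      by (rule continuous_normal_rep_subset) auto
    ultimately have "continuous_map (subtopology (cp_topology n) (cp_dom n a \<inter> cp_dom n i)) euclidean
        (\<lambda>L. normal_rep a L i * euler_mat n a (normal_rep a L) $$ (k, c))" if "k < Suc n" "c < Suc n" for k c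
      using that by (intro continuous_map_mult) auto
    then have "continuous_matrix (cp_topology n) (cp_dom n a \<inter> cp_dom n i) (Suc n)
        (\<lambda>L. normal_rep a L i \<cdot>\<^sub>m euler_mat n a (normal_rep a L))"
      by (simp add: continuous_matrix_def)
    then show ?thesis
      by (simp add: h_def[abs_def])
  qed
  moreover have "invertible_mat (h (prod_encode (a, 0)) i L)" if "L \<in> cp_dom n a" "L \<in> cp_dom n i" for a i L
    unfolding h_def prod_encode_inverse fst_conv
    by (rule invertible_smult_mat[OF euler_mat_carrier euler_mat_inverse[OF rep[OF that(1)] normal_rep_self[OF that(1)]]
          normal_rep_change(2)[OF that]])
  moreover have "h (prod_encode (a, 0)) i L * btrans ?E i j L
      = btrans ?F (prod_encode (a, 0)) (prod_encode (b, 0)) L * h (prod_encode (b, 0)) j L"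
    if L: "L \<in> cp_dom n a" "L \<in> cp_dom n b" "L \<in> cp_dom n i" "L \<in> cp_dom n j" for a b i j L
  proof -
    let ?A = "euler_mat n a (normal_rep a L)" and ?B = "euler_mat n b (normal_rep b L)"
    have "h (prod_encode (a, 0)) i L * btrans ?E i j L = (normal_rep a L i * normal_rep i L j) \<cdot>\<^sub>m ?A"
      by (simp add: h_def mult_smult_assoc_mat[of _ "Suc n" "Suc n" _ "Suc n"]
          mult_smult_distrib[of _ "Suc n" "Suc n" _ "Suc n"] smult_smult_mat mult.commute
          right_mult_one_mat[of _ "Suc n"])
    also have "\<dots> = (normal_rep b L j * normal_rep a L b) \<cdot>\<^sub>m ?A"
      using normal_rep_mult[OF L(1,3), of j] normal_rep_mult[OF L(1,2), of j] by (simp add: mult.commute)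
    also have "\<dots> = normal_rep b L j \<cdot>\<^sub>m
        (diag_block_mat [tangent_transition n a b (normal_rep a L), 1\<^sub>m 1] * ?B)"
      unfolding euler_mat_transition[OF L(1,2)] by (simp add: smult_smult_mat)
    also have "\<dots> = diag_block_mat [tangent_transition n a b (normal_rep a L), 1\<^sub>m 1] * (normal_rep b L j \<cdot>\<^sub>m ?B)"
      using diag_block_mat_pair_carrier[of "tangent_transition n a b (normal_rep a L)" n "1\<^sub>m 1" 1]
      by (subst mult_smult_distrib[of _ "Suc n" "Suc n" _ "Suc n"]) (simp_all)
    finally show ?thesis
      by (simp add: h_def tangent_bundle_cp_btrans[OF L(1,2)] trivial_bundle_def)
  qed
  moreover have "bidx ?F = (\<lambda>a. prod_encode (a, 0)) ` {..n}"
    "bdom ?F (prod_encode (a, 0)) = cp_dom n a" for a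
    by (auto simp: trivial_bundle_def cp_dom_def)
  ultimately show ?thesis
    unfolding bundle_iso_def
    by (intro conjI exI[of _ h]) (auto simp: trivial_bundle_def simp del: direct_sum_bundle_simps(2,3,4))
qed

section \<open>Chern numbers of complex projective space\<close>

lemma complex_vector_bundle_pullback:
  assumes f: "continuous_map X Y f" and E: "complex_vector_bundle Y E"
  shows "complex_vector_bundle X (pullback_bundle X f E)"
proof -
  have "continuous_matrix X ({x \<in> topspace X. f x \<in> bdom E i} \<inter> {x \<in> topspace X. f x \<in> bdom E j})
      (brank E) (\<lambda>x. btrans E i j (f x))" if "i \<in> bidx E" "j \<in> bidx E" for i j
  proof -
    let ?U = "{x \<in> topspace X. f x \<in> bdom E i} \<inter> {x \<in> topspace X. f x \<in> bdom E j}"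
    have g: "continuous_matrix Y (bdom E i \<inter> bdom E j) (brank E) (btrans E i j)"
      using E that by (simp add: complex_vector_bundle_def)
    have "continuous_map (subtopology X ?U) (subtopology Y (bdom E i \<inter> bdom E j)) f"
      using f by (auto simp: continuous_map_in_subtopology continuous_map_from_subtopology)
    then have "continuous_map (subtopology X ?U) euclidean (\<lambda>x. btrans E i j (f x) $$ (k, l))"
      if "k < brank E" "l < brank E" for k l
      using g that continuous_map_compose[of _ _ f euclidean "\<lambda>y. btrans E i j y $$ (k, l)"]
      by (auto simp: continuous_matrix_def o_def)
    then show ?thesis
      using g by (auto simp: continuous_matrix_def)
  qed
  moreover have "openin X {x \<in> topspace X. f x \<in> bdom E i}" if "i \<in> bidx E" for i
    using E that openin_continuous_map_preimage[OF f] by (auto simp: complex_vector_bundle_def)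
  moreover have "(\<Union>i\<in>bidx E. {x \<in> topspace X. f x \<in> bdom E i}) = topspace X"
    using E f by (auto simp: complex_vector_bundle_def continuous_map_def Pi_iff)
  ultimately show ?thesis
    using E by (auto simp: complex_vector_bundle_def pullback_bundle_def)
qed

lemma cohomologous_pullback:
  assumes f: "continuous_map X Y f" and \<phi>: "cohomologous p Y \<phi> \<psi>"
  shows "cohomologous p X (cochain_pullback p f \<phi>) (cochain_pullback p f \<psi>)"
proof -
  obtain \<theta> where \<theta>: "\<And>\<sigma>. singular_simplex p Y \<sigma> \<Longrightarrow> \<phi> \<sigma> - \<psi> \<sigma> = coboundary p \<theta> \<sigma>"
    using \<phi> by (auto simp: cohomologous_coboundary)
  \<comment> \<open>The bounding cochain is pulled back in its own degree p - 1; taking faces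
    commutes with composing with f.\<close>
  have "coboundary p \<theta> (simplex_map p f \<sigma>) = coboundary p (cochain_pullback (p - 1) f \<theta>) \<sigma>" for \<sigma>
  proof (cases p)
    case (Suc q)
    have "singular_face (Suc q) k (simplex_map (Suc q) f \<sigma>) = simplex_map q f (singular_face (Suc q) k \<sigma>)"
      if "k \<le> Suc q" for k
      using that singular_face_simplex_map[of "Suc q" k f \<sigma>]
      by (auto simp: simplex_map_def singular_face_def fun_eq_iff)
    then show ?thesis
      by (simp add: Suc coboundary_Suc cochain_pullback_def del: sum.atMost_Suc)
  qed simp
  then show ?thesis
    using \<theta>[OF singular_simplex_simplex_map[OF _ f]]
    unfolding cohomologous_coboundary cochain_pullback_def by auto
qed

text \<open>A point has one simplex in each degree. In positive even degree it has an odd number of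
  faces, all equal, whose signs sum to 1, so every cochain of such a degree is the coboundary of a
  constant one.\<close>

lemma cohomologous_zero_singleton:
  fixes Y :: "'p topology"
  assumes "topspace Y = {a}" "p > 0"
  shows "cohomologous (2 * p) Y \<phi> (\<lambda>_. 0)"
proof -
  obtain q where q: "2 * p = Suc q" "even (Suc q)"
    using assms(2) by (metis dvd_triv_left gr0_implies_Suc nat_0_less_mult_iff pos2)
  let ?z = "\<phi> (restrict (\<lambda>x. a) (standard_simplex (Suc q)))"
  have alt: "(\<Sum>k\<le>n. (- 1) ^ k * z) = (if even n then z else 0)" for n and z :: int
    by (induction n) auto
  have "coboundary (Suc q) (\<lambda>_. ?z) \<sigma> = ?z" for \<sigma> :: "(nat \<Rightarrow> real) \<Rightarrow> 'p"
    unfolding coboundary_Suc alt using q(2) by simp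
  then show ?thesis
    unfolding cohomologous_coboundary q(1) singular_simplex_singleton[OF assms(1)]
    by (intro exI[of _ "\<lambda>_. ?z"]) simp
qed

lemma cohomologous_cup_power:
  assumes "cocycle 2 X h" "cocycle 2 X h'" "cohomologous 2 X h h'"
  shows "cohomologous (2 * k) X (cup_power h k) (cup_power h' k)"
proof (induction k)
  case (Suc k)
  have "cohomologous (2 * k + 2) X (cup (2 * k) 2 (cup_power h k) h) (cup (2 * k) 2 (cup_power h' k) h)"
    by (rule cohomologous_cup_left[OF Suc assms(1)])
  moreover have "cohomologous (2 * k + 2) X (cup (2 * k) 2 (cup_power h' k) h) (cup (2 * k) 2 (cup_power h' k) h')"
    by (rule cohomologous_cup_right[OF cocycle_cup_power[OF assms(2)] assms(3)])
  ultimately show ?case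
    using cohomologous_trans by (fastforce simp: add.commute)
qed simp

text \<open>Cochains are functions on all maps into the type of points, so one cochain can be read
  on a subspace without pulling it back.\<close>

lemma cocycle_continuous_inclusion:
  assumes "continuous_map X Y (\<lambda>x. x)" "cocycle p Y \<phi>"
  shows "cocycle p X \<phi>"
proof -
  have "singular_simplex q Y \<sigma>" if "singular_simplex q X \<sigma>" for q \<sigma>
    using that assms(1) continuous_map_compose[of _ X \<sigma> Y "\<lambda>x. x"]
    by (auto simp: singular_simplex_def o_def)
  then show ?thesis
    using assms(2) by (simp add: cocycle_def)
qed

lemma cup_one_left:
  assumes "singular_simplex q X \<sigma>"
  shows "cup 0 q (\<lambda>_. 1) \<psi> \<sigma> = \<psi> \<sigma>"
  by (simp add: cup_def back_face_singular_simplex[OF assms])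

lemma cup_one_right:
  assumes "singular_simplex p X \<sigma>"
  shows "cup p 0 \<phi> (\<lambda>_. 1) \<sigma> = \<phi> \<sigma>"
  by (simp add: cup_def front_face_singular_simplex[OF assms])

locale chern_theory =
  fixes \<mu> :: "point cmanifold \<Rightarrow> point chain"
    and c :: "point topology \<Rightarrow> point cbundle \<Rightarrow> nat \<Rightarrow> point cochain"
  assumes fundamental: "\<And>M. compact_complex_manifold M \<Longrightarrow> fundamental_cycle M (\<mu> M)"
    and chern: "chern_classes \<mu> c"
begin

section \<open>Formal consequences of the axioms for Chern classes\<close>

lemma chern_cocycle:
  "\<lbrakk>compact_space X; Hausdorff_space X; complex_vector_bundle X E\<rbrakk> \<Longrightarrow> cocycle (2 * k) X (c X E k)"
  and chern_zero:
  "\<lbrakk>compact_space X; Hausdorff_space X; complex_vector_bundle X E\<rbrakk> \<Longrightarrow> cohomologous 0 X (c X E 0) (\<lambda>_. 1)"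
  and chern_rank:
  "\<lbrakk>compact_space X; Hausdorff_space X; complex_vector_bundle X E; k > brank E\<rbrakk>
    \<Longrightarrow> cohomologous (2 * k) X (c X E k) (\<lambda>_. 0)"
  using conjunct1[OF chern[unfolded chern_classes_def]] by auto

lemma chern_iso:
  "\<lbrakk>compact_space X; Hausdorff_space X; complex_vector_bundle X E; complex_vector_bundle X F;
    bundle_iso X E F\<rbrakk> \<Longrightarrow> cohomologous (2 * k) X (c X E k) (c X F k)"
  using conjunct1[OF conjunct2[OF chern[unfolded chern_classes_def]]] by blast

lemma chern_pullback:
  "\<lbrakk>compact_space X; Hausdorff_space X; compact_space Y; Hausdorff_space Y; continuous_map X Y f;
    complex_vector_bundle Y E\<rbrakk>
    \<Longrightarrow> cohomologous (2 * k) X (c X (pullback_bundle X f E) k) (cochain_pullback (2 * k) f (c Y E k))"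
  using conjunct1[OF conjunct2[OF conjunct2[OF chern[unfolded chern_classes_def]]]] by blast

lemma chern_sum:
  "\<lbrakk>compact_space X; Hausdorff_space X; complex_vector_bundle X E; complex_vector_bundle X F\<rbrakk>
    \<Longrightarrow> cohomologous (2 * k) X (c X (direct_sum_bundle E F) k)
      (\<lambda>\<sigma>. \<Sum>i\<le>k. cup (2 * i) (2 * (k - i)) (c X E i) (c X F (k - i)) \<sigma>)"
  using conjunct1[OF conjunct2[OF conjunct2[OF conjunct2[OF chern[unfolded chern_classes_def]]]]] by blast

text \<open>A trivial bundle is pulled back from a one-point space, where cochains of positive even
  degree are coboundaries.\<close>

lemma chern_trivial:
  assumes X: "compact_space X" "Hausdorff_space X" and k: "k > 0"
  shows "cohomologous (2 * k) X (c X (trivial_bundle X r) k) (\<lambda>_. 0)"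
proof -
  \<comment> \<open>The axioms speak of spaces over the type \<open>point\<close>, so the one-point
    space consists of an element of that type, here the empty set.\<close>
  define Y :: "point topology" where "Y = discrete_topology {{}}"
  have Y: "compact_space Y" "Hausdorff_space Y" "topspace Y = {{}}"
    by (auto simp: Y_def compact_space_discrete_topology)
  have f: "continuous_map X Y (\<lambda>_. {})"
    using Y(3) by simp
  have "pullback_bundle X (\<lambda>_. {}) (trivial_bundle Y r) = trivial_bundle X r"
    by (simp add: pullback_bundle_def trivial_bundle_def Y(3))
  then have "cohomologous (2 * k) X (c X (trivial_bundle X r) k)
      (cochain_pullback (2 * k) (\<lambda>_. {}) (c Y (trivial_bundle Y r) k))"
    using chern_pullback[OF X Y(1,2) f complex_vector_bundle_trivial[of Y r], of k] by simp
  moreover have "cohomologous (2 * k) X (cochain_pullback (2 * k) (\<lambda>_. {}) (c Y (trivial_bundle Y r) k))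
      (cochain_pullback (2 * k) (\<lambda>_. {} :: point) (\<lambda>_. 0))"
    by (rule cohomologous_pullback[OF f cohomologous_zero_singleton[OF Y(3) k]])
  ultimately show ?thesis
    using cohomologous_trans by (fastforce simp: cochain_pullback_def[abs_def])
qed

text \<open>In the Whitney formula only the product of the k-th class of E with the unit
  survives.\<close>

lemma chern_sum_trivial:
  assumes X: "compact_space X" "Hausdorff_space X" and E: "complex_vector_bundle X E"
  shows "cohomologous (2 * k) X (c X (direct_sum_bundle E (trivial_bundle X r)) k) (c X E k)"
proof -
  let ?F = "trivial_bundle X r"
  have coc: "cocycle (2 * i) X (c X E i)" for i
    by (rule chern_cocycle[OF X E])
  have "cohomologous (2 * k) X (cup (2 * i) (2 * (k - i)) (c X E i) (c X ?F (k - i)))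
      (\<lambda>\<sigma>. of_bool (i = k) * c X E k \<sigma>)" if i: "i \<le> k" for i
  proof (cases "i = k")
    case True
    have "cohomologous (2 * k + 0) X (cup (2 * k) 0 (c X E k) (c X ?F 0)) (cup (2 * k) 0 (c X E k) (\<lambda>_. 1))"
      by (rule cohomologous_cup_right[OF coc chern_zero[OF X complex_vector_bundle_trivial]])
    moreover have "cohomologous (2 * k) X (cup (2 * k) 0 (c X E k) (\<lambda>_. 1)) (c X E k)"
      by (intro cohomologous_eqI cup_one_right)
    ultimately show ?thesis
      using True cohomologous_trans by fastforce
  next
    case False
    have "cohomologous (2 * i + 2 * (k - i)) X (cup (2 * i) (2 * (k - i)) (c X E i) (c X ?F (k - i)))
        (cup (2 * i) (2 * (k - i)) (c X E i) (\<lambda>_. 0))"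
      using False i by (intro cohomologous_cup_right[OF coc] chern_trivial[OF X]) simp
    then show ?thesis
      using False i by (simp add: cup_def[abs_def] flip: distrib_left)
  qed
  then have "cohomologous (2 * k) X
      (\<lambda>\<sigma>. \<Sum>i\<le>k. 1 * cup (2 * i) (2 * (k - i)) (c X E i) (c X ?F (k - i)) \<sigma>)
      (\<lambda>\<sigma>. \<Sum>i\<le>k. 1 * (of_bool (i = k) * c X E k \<sigma>))"
    by (intro cohomologous_sum) auto
  moreover have "(\<lambda>\<sigma>. \<Sum>i\<le>k. 1 * (of_bool (i = k) * c X E k \<sigma>)) = c X E k"
    by (simp add: of_bool_def mult_delta_left)
  ultimately show ?thesis
    using cohomologous_trans[OF chern_sum[OF X E complex_vector_bundle_trivial]] by simp
qed

text \<open>The Whitney formula can be solved for the second summand because all classes involved are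
  multiples of powers of one class.\<close>

lemma chern_multiples_complement:
  assumes X: "compact_space X" "Hausdorff_space X"
    and E: "complex_vector_bundle X E" and F: "complex_vector_bundle X F"
    and h: "cocycle 2 X h" and \<alpha>: "chern_multiples X h (c X E) \<alpha>"
    and \<gamma>: "\<And>k. cohomologous (2 * k) X (c X (direct_sum_bundle E F) k) (\<lambda>\<sigma>. \<gamma> k * cup_power h k \<sigma>)"
    and \<alpha>0: "\<alpha> 0 = 1" and conv: "\<And>k. (\<Sum>i\<le>k. \<alpha> i * \<beta> (k - i)) = \<gamma> k"
  shows "chern_multiples X h (c X F) \<beta>"
proof -
  have coc: "cocycle (2 * k) X (c X F k)" for k
    by (rule chern_cocycle[OF X F])
  have "cohomologous (2 * k) X (c X F k) (\<lambda>\<sigma>. \<beta> k * cup_power h k \<sigma>)" for k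
  proof (induction k rule: less_induct)
    case (less k)
    let ?t = "\<lambda>i. cup (2 * i) (2 * (k - i)) (c X E i) (c X F (k - i))"
    let ?m = "\<lambda>z \<sigma>. z * cup_power h k \<sigma>"
    let ?I = "{..k} - {0}"
    have "cohomologous (2 * k) X (?t i) (?m (\<alpha> i * \<beta> (k - i)))" if "i \<in> ?I" for i
    proof -
      have i: "i \<le> k" "k - i < k"
        using that by auto
      have "cohomologous (2 * i) X (c X E i) (\<lambda>\<sigma>. \<alpha> i * cup_power h i \<sigma>)"
        using \<alpha> by (simp add: chern_multiples_def)
      from cohomologous_cup_multiples[OF h coc[of "k - i"] this less[OF i(2)]] show ?thesis
        by (simp only: le_add_diff_inverse[OF i(1)])
    qed
    then have I: "cohomologous (2 * k) X (\<lambda>\<sigma>. \<Sum>i\<in>?I. 1 * ?t i \<sigma>) (\<lambda>\<sigma>. \<Sum>i\<in>?I. 1 * ?m (\<alpha> i * \<beta> (k - i)) \<sigma>)"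
      by (intro cohomologous_sum) auto
    have "cohomologous (0 + 2 * k) X (cup 0 (2 * k) (c X E 0) (c X F k)) (cup 0 (2 * k) (\<lambda>_. 1) (c X F k))"
      by (rule cohomologous_cup_left[OF chern_zero[OF X E] coc])
    moreover have "cohomologous (2 * k) X (cup 0 (2 * k) (\<lambda>_. 1) (c X F k)) (c X F k)"
      by (intro cohomologous_eqI cup_one_left)
    ultimately have 0: "cohomologous (2 * k) X (c X F k) (?t 0)"
      using cohomologous_trans cohomologous_sym by fastforce
    \<comment> \<open>The Whitney sum is solved for its term i = 0, in which the class of E is the
      unit; the factors 1 fit the forms of \<open>cohomologous_linear\<close> and
      \<open>cohomologous_sum\<close>.\<close>
    have t0: "?t 0 = (\<lambda>\<sigma>. 1 * (\<Sum>i\<le>k. ?t i \<sigma>) + (- 1) * (\<Sum>i\<in>?I. 1 * ?t i \<sigma>))"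
      by (subst sum.remove[of _ 0]) auto
    have "\<gamma> k = \<beta> k + (\<Sum>i\<in>?I. \<alpha> i * \<beta> (k - i))"
      unfolding conv[symmetric] by (subst sum.remove[of _ 0]) (auto simp: \<alpha>0)
    then have mk: "(\<lambda>\<sigma>. 1 * ?m (\<gamma> k) \<sigma> + (- 1) * (\<Sum>i\<in>?I. 1 * ?m (\<alpha> i * \<beta> (k - i)) \<sigma>)) = ?m (\<beta> k)"
      by (simp add: distrib_right sum_distrib_right)
    have "cohomologous (2 * k) X (\<lambda>\<sigma>. 1 * (\<Sum>i\<le>k. ?t i \<sigma>) + (- 1) * (\<Sum>i\<in>?I. 1 * ?t i \<sigma>))
        (\<lambda>\<sigma>. 1 * ?m (\<gamma> k) \<sigma> + (- 1) * (\<Sum>i\<in>?I. 1 * ?m (\<alpha> i * \<beta> (k - i)) \<sigma>))"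
      using cohomologous_trans[OF cohomologous_sym[OF chern_sum[OF X E F]] \<gamma>]
      by (intro cohomologous_linear I) simp
    then have "cohomologous (2 * k) X (?t 0) (?m (\<beta> k))"
      by (simp only: t0[symmetric] mk)
    then show ?case
      using 0 cohomologous_trans by blast
  qed
  then show ?thesis
    using coc by (simp add: chern_multiples_def)
qed

lemma chern_multiples_iso:
  assumes X: "compact_space X" "Hausdorff_space X"
    and E: "complex_vector_bundle X E" and F: "complex_vector_bundle X F" and iso: "bundle_iso X E F"
    and \<alpha>: "chern_multiples X h (c X E) \<alpha>"
  shows "chern_multiples X h (c X F) \<alpha>"
  using \<alpha> cohomologous_trans[OF cohomologous_sym[OF chern_iso[OF X E F iso]]] chern_cocycle[OF X F]
  by (simp add: chern_multiples_def)

section \<open>Chern classes of bundles on projective space\<close>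

abbreviation hclass :: "nat \<Rightarrow> point cochain" where
  "hclass n \<equiv> c (cp_topology n) (hyperplane_bundle n) 1"

lemma complex_vector_bundle_hyperplane: "complex_vector_bundle (cp_topology n) (hyperplane_bundle n)"
  unfolding hyperplane_bundle_multiple by (rule complex_vector_bundle_hyperplane_multiple)

lemma cocycle_hclass: "cocycle 2 (cp_topology n) (hclass n)"
  using chern_cocycle[OF compact_cp_topology[of n] Hausdorff_cp_topology[of n]
      complex_vector_bundle_hyperplane[of n], of 1]
  by simp

lemma chern_multiples_hyperplane:
  "chern_multiples (cp_topology n) (hclass n) (c (cp_topology n) (hyperplane_bundle n)) (\<lambda>k. int (1 choose k))"
proof -
  let ?X = "cp_topology n" and ?c = "c (cp_topology n) (hyperplane_bundle n)"
  note X = compact_cp_topology[of n] Hausdorff_cp_topology[of n]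
  note H = complex_vector_bundle_hyperplane[of n]
  have "cohomologous (2 * k) ?X (?c k) (\<lambda>\<sigma>. int (1 choose k) * cup_power (hclass n) k \<sigma>)" for k
  proof -
    consider "k = 0" | "k = 1" | "k > 1"
      by linarith
    then show ?thesis
    proof cases
      case 1
      then show ?thesis
        using chern_zero[OF X H] by simp
    next
      case 2
      have "cohomologous 2 ?X (?c 1) (cup 0 2 (\<lambda>_. 1) (hclass n))"
        by (intro cohomologous_eqI cup_one_left[symmetric])
      then show ?thesis
        using 2 by simp
    next
      case 3
      then show ?thesis
        using chern_rank[OF X H, of k] by (simp add: binomial_eq_0 hyperplane_bundle_def)
    qed
  qed
  then show ?thesis
    using chern_cocycle[OF X H] by (simp add: chern_multiples_def)
qed

text \<open>Splitting off one hyperplane bundle at a time gives Pascal's rule, here as Vandermonde's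
  identity with first argument 1.\<close>

lemma chern_multiples_hyperplane_multiple:
  "chern_multiples (cp_topology n) (hclass n) (c (cp_topology n) (hyperplane_multiple n m))
     (\<lambda>k. int (m choose k))"
proof (induction m)
  case 0
  note X = compact_cp_topology[of n] Hausdorff_cp_topology[of n]
  note B = complex_vector_bundle_hyperplane_multiple[of n 0]
  have "cohomologous (2 * k) (cp_topology n) (c (cp_topology n) (hyperplane_multiple n 0) k)
      (\<lambda>\<sigma>. int (0 choose k) * cup_power (hclass n) k \<sigma>)" for k
    using chern_zero[OF X B] chern_rank[OF X B, of k] by (cases "k = 0") (auto simp: binomial_eq_0)
  then show ?case
    using chern_cocycle[OF X B] by (simp add: chern_multiples_def)
next
  case (Suc m)
  let ?X = "cp_topology n"
  let ?S = "direct_sum_bundle (hyperplane_bundle n) (hyperplane_multiple n m)"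
  note X = compact_cp_topology[of n] Hausdorff_cp_topology[of n]
  note B = complex_vector_bundle_hyperplane[of n] complex_vector_bundle_hyperplane_multiple[of n m]
  note S = complex_vector_bundle_direct_sum[OF B]
  have "(\<Sum>i\<le>k. int (1 choose i) * int (m choose (k - i))) = int (Suc m choose k)" for k
    unfolding of_nat_mult[symmetric] of_nat_sum[symmetric] using vandermonde[of 1 m k] by simp
  then have "cohomologous (2 * k) ?X (c ?X ?S k) (\<lambda>\<sigma>. int (Suc m choose k) * cup_power (hclass n) k \<sigma>)" for k
    using cohomologous_trans[OF chern_sum[OF X B]
        chern_multiples_product[OF cocycle_hclass chern_multiples_hyperplane Suc]] by simp
  then have "chern_multiples ?X (hclass n) (c ?X ?S) (\<lambda>k. int (Suc m choose k))"
    using chern_cocycle[OF X S] by (simp add: chern_multiples_def)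
  then show ?case
    using chern_multiples_iso[OF X S _ bundle_iso_hyperplane_sum] complex_vector_bundle_hyperplane_multiple
    by simp
qed

lemma chern_multiples_tangent:
  "chern_multiples (cp_topology n) (hclass n)
     (c (cp_topology n) (tangent_bundle (CP n))) (\<lambda>k. int (Suc n choose k))"
proof -
  let ?X = "cp_topology n" and ?T = "tangent_bundle (CP n)"
  let ?S = "direct_sum_bundle ?T (trivial_bundle ?X 1)"
  note X = compact_cp_topology[of n] Hausdorff_cp_topology[of n]
  note T = complex_vector_bundle_tangent_cp[of n]
  have "chern_multiples ?X (hclass n) (c ?X ?S) (\<lambda>k. int (Suc n choose k))"
    by (rule chern_multiples_iso[OF X complex_vector_bundle_hyperplane_multiple
        complex_vector_bundle_direct_sum[OF T complex_vector_bundle_trivial] bundle_iso_euler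
        chern_multiples_hyperplane_multiple])
  then have "cohomologous (2 * k) ?X (c ?X ?T k) (\<lambda>\<sigma>. int (Suc n choose k) * cup_power (hclass n) k \<sigma>)" for k
    using cohomologous_trans[OF cohomologous_sym[OF chern_sum_trivial[OF X T]]]
    unfolding chern_multiples_def by blast
  then show ?thesis
    using chern_cocycle[OF X T] by (simp add: chern_multiples_def)
qed

text \<open>A trivial summand does not change Chern classes, so stable triviality makes the total
  class of the tangent bundle plus N equal to 1.\<close>

lemma chern_multiples_normal:
  assumes N: "stable_normal_bundle (CP n) N"
    and conv: "\<And>k. (\<Sum>i\<le>k. int (Suc n choose i) * \<beta> (k - i)) = of_bool (k = 0)"
  shows "chern_multiples (cp_topology n) (hclass n) (c (cp_topology n) N) \<beta>"
proof -
  let ?X = "cp_topology n" and ?T = "tangent_bundle (CP n)"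
  note X = compact_cp_topology[of n] Hausdorff_cp_topology[of n]
  note T = complex_vector_bundle_tangent_cp[of n]
  obtain a b where NB: "complex_vector_bundle ?X N"
    and iso: "bundle_iso ?X (direct_sum_bundle (direct_sum_bundle ?T N) (trivial_bundle ?X a)) (trivial_bundle ?X b)"
    using N by (auto simp: stable_normal_bundle_def)
  note S = complex_vector_bundle_direct_sum[OF T NB]
  have "cohomologous (2 * k) ?X (c ?X (direct_sum_bundle ?T N) k)
      (\<lambda>\<sigma>. of_bool (k = 0) * cup_power (hclass n) k \<sigma>)" for k
  proof (cases "k = 0")
    case True
    then show ?thesis
      using chern_zero[OF X S] by simp
  next
    case False
    have "cohomologous (2 * k) ?X (c ?X (direct_sum_bundle ?T N) k)
        (c ?X (direct_sum_bundle (direct_sum_bundle ?T N) (trivial_bundle ?X a)) k)"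
      by (rule cohomologous_sym[OF chern_sum_trivial[OF X S]])
    moreover have "cohomologous (2 * k) ?X
        (c ?X (direct_sum_bundle (direct_sum_bundle ?T N) (trivial_bundle ?X a)) k) (c ?X (trivial_bundle ?X b) k)"
      by (rule chern_iso[OF X complex_vector_bundle_direct_sum[OF S complex_vector_bundle_trivial]
            complex_vector_bundle_trivial iso])
    moreover have "cohomologous (2 * k) ?X (c ?X (trivial_bundle ?X b) k) (\<lambda>_. 0)"
      using False by (intro chern_trivial[OF X]) simp
    ultimately have "cohomologous (2 * k) ?X (c ?X (direct_sum_bundle ?T N) k) (\<lambda>_. 0)"
      using cohomologous_trans by blast
    then show ?thesis
      using False by simp
  qed
  then show ?thesis
    by (rule chern_multiples_complement[OF X T NB cocycle_hclass chern_multiples_tangent _ _ conv]) simp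
qed

section \<open>The value of the top power of the hyperplane class\<close>

lemma fundamental_cp: "fundamental_cycle (CP n) (\<mu> (CP n))"
  by (rule fundamental[OF compact_complex_manifold_cp])

lemma relcycle_cp: "singular_relcycle (2 * n) (cp_topology n) {} (\<mu> (CP n))"
  using fundamental_cp[of n] by (simp add: fundamental_cycle_def)

lemma cp_points_0: "\<exists>L. cp_points 0 = {L}"
proof -
  have "cline v = cline (\<lambda>k. if k = 0 then 1 else 0)" if "v \<in> cvecs 0" for v
  proof -
    have "v = (\<lambda>k. v 0 * (if k = 0 then 1 else 0))" "v 0 \<noteq> 0"
      using that by (auto simp: cvecs_iff fun_eq_iff)
    then show ?thesis
      using cline_scale[of "v 0" "\<lambda>k. if k = 0 then 1 else 0"] by simp
  qed
  moreover have "(\<lambda>k. if k = 0 then 1 else 0) \<in> cvecs 0"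
    by (auto simp: cvecs_iff)
  ultimately show ?thesis
    unfolding cp_points_cvecs by blast
qed

text \<open>The complement of the only point is empty, so the local orientation condition makes the
  fundamental cycle homologous to a single simplex, and homologous 0-chains have the same
  augmentation.\<close>

lemma augmentation_cp_0: "cochain_eval (\<lambda>_. 1) (\<mu> (CP 0)) = 1"
proof -
  let ?M = "CP 0" and ?X = "cp_topology 0"
  obtain L where L: "cp_points 0 = {L}"
    using cp_points_0 by blast
  then have "L \<in> cp_dom 0 0"
    using cp_dom_covers[of 0] by auto
  moreover have "orientation_simplex 0 (cchart ?M 0 L) 1 ` standard_simplex 0 \<subseteq> cchart ?M 0 ` cp_dom 0 0"
    unfolding cchart_cp_image[OF order_refl] by (auto simp: orientation_simplex_def topspace_cspace)
  ultimately have "homologous_rel 0 ?X (topspace ?X - {L}) (\<mu> ?M)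
      (frag_of (restrict (chart_inv ?M 0 \<circ> orientation_simplex 0 (cchart ?M 0 L) 1) (standard_simplex 0)))"
    using fundamental_cp[of 0] unfolding fundamental_cycle_def cp_simps by fastforce
  then obtain \<sigma> where "homologous_rel 0 ?X {} (\<mu> ?M) (frag_of \<sigma>)"
    using L by auto
  then obtain d where "chain_boundary 1 d = \<mu> ?M - frag_of \<sigma>"
    by (auto simp: homologous_rel_def singular_boundary)
  then have "cochain_eval (\<lambda>_. 1) (\<mu> ?M) - 1 = cochain_eval (coboundary 1 (\<lambda>_. 1)) d"
    by (simp flip: cochain_eval_chain_boundary add: cochain_eval_diff)
  also have "coboundary 1 (\<lambda>_. 1) = (\<lambda>_. 0)"
    by (simp add: coboundary_Suc fun_eq_iff)
  finally show ?thesis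
    by (simp add: cochain_eval_def)
qed

text \<open>Since CP^n is literally a subset of the next space, the pullback along the inclusion is
  the same cochain, read on fewer simplices.\<close>

lemma hclass_restrict: "cohomologous 2 (cp_topology n) (hclass (Suc n)) (hclass n)"
proof -
  let ?X = "cp_topology n" and ?Y = "cp_topology (Suc n)"
  let ?P = "pullback_bundle ?X (\<lambda>L. L) (hyperplane_bundle (Suc n))"
  note X = compact_cp_topology[of n] Hausdorff_cp_topology[of n]
  note Y = compact_cp_topology[of "Suc n"] Hausdorff_cp_topology[of "Suc n"]
  note H = complex_vector_bundle_hyperplane
  have "cohomologous 2 ?X (c ?X ?P 1) (cochain_pullback 2 (\<lambda>L. L) (hclass (Suc n)))"
    using chern_pullback[OF X Y continuous_map_cp_inclusion H, of 1] by simp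
  moreover have "cohomologous 2 ?X (cochain_pullback 2 (\<lambda>L. L) (hclass (Suc n))) (hclass (Suc n))"
    by (rule cohomologous_eqI) (simp add: cochain_pullback_def simplex_map_id_gen)
  moreover have "cohomologous 2 ?X (c ?X ?P 1) (hclass n)"
    using chern_iso[OF X complex_vector_bundle_pullback[OF continuous_map_cp_inclusion H] H
        bundle_iso_hyperplane_restrict, of 1] by simp
  ultimately show ?thesis
    using cohomologous_trans cohomologous_sym by blast
qed

text \<open>\<open>cup_power\<close> has its last factor on the right, as in the normalisation
  clause of \<open>chern_classes\<close>. That clause removes the factor and passes to the
  hyperplane, where the class of the larger space may be replaced by that of CP^n.\<close>

lemma cup_power_hclass_eval: "cochain_eval (cup_power (hclass n) n) (\<mu> (CP n)) = 1"
proof (induction n)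
  case 0
  then show ?case
    by (simp add: augmentation_cp_0)
next
  case (Suc n)
  have coc: "cocycle (2 * n) (cp_topology (Suc n)) (cup_power (hclass (Suc n)) n)"
    by (rule cocycle_cup_power[OF cocycle_hclass])
  have "cochain_eval (cup_power (hclass (Suc n)) (Suc n)) (\<mu> (CP (Suc n)))
      = cochain_eval (cup_power (hclass (Suc n)) n) (\<mu> (CP n))"
    using conjunct2[OF conjunct2[OF conjunct2[OF conjunct2[OF chern[unfolded chern_classes_def]]]]] coc unfolding cup_power.simps by blast
  also have "\<dots> = cochain_eval (cup_power (hclass n) n) (\<mu> (CP n))"
    by (rule cochain_eval_cohomologous[OF _ relcycle_cp])
      (rule cohomologous_cup_power[OF cocycle_continuous_inclusion[OF continuous_map_cp_inclusion cocycle_hclass]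
          cocycle_hclass hclass_restrict])
  finally show ?case
    using Suc by simp
qed

section \<open>Chern polynomials of projective spaces\<close>

lemma chern_number_poly_tangent_cp:
  "chern_number_poly c \<mu> (CP n) (tangent_bundle (CP n))
     = of_nat (n + 1) * N_poly n"
proof -
  have "chern_number_poly c \<mu> (CP n) (tangent_bundle (CP n))
      = chern_poly (\<lambda>k. int (Suc n choose k)) n"
    using chern_number_poly_multiples[of "CP n" "hclass n" c _ _ \<mu>]
      cocycle_hclass chern_multiples_tangent relcycle_cp cup_power_hclass_eval by simp
  then show ?thesis
    by (simp only: chern_poly_binomial N_poly Suc_eq_plus1)
qed

lemma chern_number_poly_normal_cp:
  assumes N: "stable_normal_bundle (CP n) N"
  shows "chern_number_poly c \<mu> (CP n) N = of_nat (n + 1) * L_poly n"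
proof -
  define A where "A = Abs_fps (\<lambda>k. int (Suc n choose k))"
  \<comment> \<open>The coefficients of (1 + h)^(-n-1), the integers that stand for the normal
    classes.\<close>
  define \<beta> where "\<beta> = fps_nth (fps_right_inverse A 1)"
  have "A * fps_right_inverse A 1 = 1"
    by (rule fps_right_inverse) (simp add: A_def)
  then have "fps_nth (A * fps_right_inverse A 1) k = of_bool (k = 0)" for k
    by simp
  then have conv: "(\<Sum>i\<le>k. int (Suc n choose i) * \<beta> (k - i)) = of_bool (k = 0)" for k
    by (simp only: fps_mult_nth A_def \<beta>_def fps_nth_Abs_fps atLeast0AtMost)
  have "chern_number_poly c \<mu> (CP n) N = chern_poly \<beta> n"
    using chern_number_poly_multiples[of "CP n" "hclass n" c _ _ \<mu>]
      cocycle_hclass chern_multiples_normal[OF N conv] relcycle_cp cup_power_hclass_eval by simp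
  then show ?thesis
    by (simp only: chern_poly_inverse[OF conv] L_poly Suc_eq_plus1)
qed

end

theorem theorem1p3:
  fixes \<mu> :: "point cmanifold \<Rightarrow> point chain"
    and c :: "point topology \<Rightarrow> point cbundle \<Rightarrow> nat \<Rightarrow> point cochain"
    and \<nu> :: "point cmanifold \<Rightarrow> point cbundle"
    and cls :: "nat \<Rightarrow> nat \<Rightarrow> rvec set \<Rightarrow> jfield \<Rightarrow> 'o::comm_ring_1"
    and \<Phi>\<^sub>\<tau> \<Phi>\<^sub>\<nu> :: "'o \<Rightarrow> int tpoly"
    and \<iota> :: "'o \<Rightarrow> 'q::comm_ring_1"
    and a :: "nat \<Rightarrow> nat \<Rightarrow> 'o"
    and g\<^sub>F :: "'q fps"
  assumes fundamental_cycles: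
      "\<And>M. compact_complex_manifold M \<Longrightarrow> fundamental_cycle M (\<mu> M)"
    and chern_classes: "chern_classes \<mu> c"
    and normal_bundles:
      "\<And>M. compact_complex_manifold M \<Longrightarrow> stable_normal_bundle M (\<nu> M)"
    and cobordism_ring: "complex_cobordism_ring cls"
    and \<Phi>\<^sub>\<tau>: "comm_ring_hom \<Phi>\<^sub>\<tau>"
      "\<And>M. compact_complex_manifold M \<Longrightarrow>
         \<Phi>\<^sub>\<tau> (cobordism_class cls M) = chern_number_poly c \<mu> M (tangent_bundle M)"
    and \<Phi>\<^sub>\<nu>: "comm_ring_hom \<Phi>\<^sub>\<nu>"
      "\<And>M. compact_complex_manifold M \<Longrightarrow>
         \<Phi>\<^sub>\<nu> (cobordism_class cls M) = chern_number_poly c \<mu> M (\<nu> M)"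
    and rationalization: "rationalization \<iota>"
    and F: "formal_group a" "is_logarithm \<iota> a g\<^sub>F"
      "\<And>n. n \<ge> 1 \<Longrightarrow>
         of_nat (n + 1) * fps_nth g\<^sub>F (n + 1)
         = \<iota> (cobordism_class cls (complex_projective_space n))"
  shows "(\<forall>f\<^sub>\<tau>. is_exponential rat_tpoly (\<lambda>i j. \<Phi>\<^sub>\<tau> (a i j)) f\<^sub>\<tau>
              \<longleftrightarrow> f\<^sub>\<tau> = normalized_series (\<lambda>k. rat_tpoly (M_poly k))) \<and>
         (\<forall>f\<^sub>\<nu>. is_exponential rat_tpoly (\<lambda>i j. \<Phi>\<^sub>\<nu> (a i j)) f\<^sub>\<nu>
              \<longleftrightarrow> f\<^sub>\<nu> = normalized_series (\<lambda>k. rat_tpoly (tvar k))) \<and>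
         (\<forall>g\<^sub>\<tau>. is_logarithm rat_tpoly (\<lambda>i j. \<Phi>\<^sub>\<tau> (a i j)) g\<^sub>\<tau>
              \<longleftrightarrow> g\<^sub>\<tau> = normalized_series (\<lambda>k. rat_tpoly (N_poly k))) \<and>
         (\<forall>g\<^sub>\<nu>. is_logarithm rat_tpoly (\<lambda>i j. \<Phi>\<^sub>\<nu> (a i j)) g\<^sub>\<nu>
              \<longleftrightarrow> g\<^sub>\<nu> = normalized_series (\<lambda>k. rat_tpoly (L_poly k)))"
proof -
  interpret chern_theory \<mu> c
    using fundamental_cycles chern_classes by unfold_locales
  have \<tau>: "\<Phi>\<^sub>\<tau> (cobordism_class cls (complex_projective_space n)) = of_nat (n + 1) * N_poly n" for n
    unfolding \<Phi>\<^sub>\<tau>(2)[OF compact_complex_manifold_cp] by (rule chern_number_poly_tangent_cp)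
  have \<nu>: "\<Phi>\<^sub>\<nu> (cobordism_class cls (complex_projective_space n)) = of_nat (n + 1) * L_poly n" for n
    unfolding \<Phi>\<^sub>\<nu>(2)[OF compact_complex_manifold_cp]
    by (rule chern_number_poly_normal_cp[OF normal_bundles[OF compact_complex_manifold_cp]])
  show ?thesis
    using formal_group_logarithm[OF \<Phi>\<^sub>\<tau>(1) rationalization F(2,3) \<tau> compositional_inverses_M_N]
      formal_group_logarithm[OF \<Phi>\<^sub>\<nu>(1) rationalization F(2,3) \<nu> compositional_inverses_t_L]
    by simp
qed

end
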